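(* Let $\phi:[0,1]\to[0,1]$ be the Gauss transformation. (1) If $\alpha>1$ then, for almost all $x_0\in[0,1]$, and more precisely whenever $x_0$ is an irrational number with continued fraction expansion $[\,i_0,i_1,\dots]$ such that $\log i_n=o(n)$ as $n\to\infty$, $$\liminf_{n\to\infty}n^{1/\alpha}|\phi^n(x)-x_0|=0\qquad\text{for almost all }x\in[0,1].$$ (2) If $0<\alpha<1$, then for all $x_0\in[0,1]$, $$\liminf_{n\to\infty}n^{1/\alpha}|\phi^n(x)-x_0|=\infty\qquad\text{for almost all }x\in[0,1].$$ (3) If $x_0=[\,i_0,i_1,\dots]\in[0,1]$ is irrational with $\log i_n=o(n)$ as $n\to\infty$, then $$\mathrm{Dim}\left\{x\in[0,1]:\ \liminf_{n\to\infty}n^{1/\alpha}|\phi^n(x)-x_0|=0\right\}=1\qquad\text{for any }\alpha>0,$$ and $$\mathrm{Dim}\left\{x\in[0,1]:\ \liminf_{n\to\infty}e^{n\kappa}|\phi^n(x)-x_0|=0\right\}\ge\frac{\pi^2}{\pi^2+6\kappa\log2}\qquad\text{for any }\kappa>0.$$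
   Context: The Gauss transformation is $\phi(x)=\frac1x-\left[\frac1x\right]$ for $x\neq0$ and $\phi(0)=0$, where $[\cdot]$ is the integer part; $\phi^n$ is the $n$-th iterate. For irrational $x\in(0,1)$ the continued fraction expansion is $x=[\,n_0,n_1,n_2,\dots]$ with $n_j=[1/\phi^j(x)]$, i.e. $x=\cfrac1{n_0+\cfrac1{n_1+\cdots}}$. "Almost all" refers to Lebesgue measure and $\mathrm{Dim}$ is the usual Hausdorff dimension. *)

theory Defs
  imports "HOL-Analysis.Analysis" "HOL-Library.Landau_Symbols"
begin

definition gauss_map :: "real \<Rightarrow> real" where
  "gauss_map x = (if x = 0 then 0 else 1 / x - of_int \<lfloor>1 / x\<rfloor>)"

(* Digits are numbered from 0; they are the continued fraction digits only for irrational x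
   in (0,1), which is the only case in which they are used. *)
definition cf_digit :: "real \<Rightarrow> nat \<Rightarrow> int" where
  "cf_digit x n = \<lfloor>1 / (gauss_map ^^ n) x\<rfloor>"

definition slow_cf :: "real \<Rightarrow> bool" where
  "slow_cf x \<longleftrightarrow> x \<in> {0..1} \<and> x \<notin> \<rat> \<and>
     (\<lambda>n. ln (real_of_int (cf_digit x n))) \<in> o(\<lambda>n. real n)"

(* |U|^s, with the usual conventions that the empty set has weight 0 and that every
   nonempty set has weight 1 for s = 0 (whereas 0 powr 0 = 0 in HOL). *)
definition diam_weight :: "real \<Rightarrow> 'a::metric_space set \<Rightarrow> ennreal" where
  "diam_weight s U =
     (if U = {} then 0 else if s = 0 then 1 else ennreal (diameter U powr s))"

(* Boundedness of the covering sets must be demanded explicitly, since the value of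
   diameter is meaningless on unbounded sets. *)
definition hausdorff_premeasure :: "real \<Rightarrow> real \<Rightarrow> 'a::metric_space set \<Rightarrow> ennreal" where
  "hausdorff_premeasure s \<delta> A =
     (INF U \<in> {U :: nat \<Rightarrow> 'a set. A \<subseteq> (\<Union>i. U i) \<and> (\<forall>i. bounded (U i) \<and> diameter (U i) \<le> \<delta>)}.
        \<Sum>i. diam_weight s (U i))"

definition hausdorff_measure :: "real \<Rightarrow> 'a::metric_space set \<Rightarrow> ennreal" where
  "hausdorff_measure s A = (SUP \<delta> \<in> {0<..}. hausdorff_premeasure s \<delta> A)"

definition hausdorff_dim :: "'a::metric_space set \<Rightarrow> ereal" where
  "hausdorff_dim A = (INF s \<in> {s :: real. 0 \<le> s \<and> hausdorff_measure s A = 0}. ereal s)"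

end

theory Submission
  imports Defs "HOL-Probability.Probability" "HOL-Real_Asymp.Real_Asymp"
begin

text \<open>Continued fraction cylinders are quasi-independent: the length of the cylinder of a
  concatenated word is the product of the lengths up to a factor \<open>4\<close>. Hence among consecutive
  blocks of \<open>k\<close> digits the first \<open>k\<close> digits of \<open>x\<^sub>0\<close>, whose cylinder has length \<open>l\<close>, are missed
  \<open>k/l\<close> times with probability at most \<open>exp (- k/4)\<close>; hitting them before time about \<open>k\<^sup>2/l\<close> gives
  part (1), because \<open>l\<close> decays exponentially. Part (2) is the Borel-Cantelli lemma for the invariant
  Gauss measure.

  For part (3), let \<open>\<lambda> = \<pi>\<^sup>2/(6 ln 2)\<close> be the Lyapunov exponent. Jensen's inequality and invariance
  give \<open>\<Sum> |I|\<^sup>s \<ge> c exp ((1 - s) n \<lambda>)\<close> for the sum over the cylinders of order \<open>n\<close>. If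
  \<open>(1 - s) \<lambda> > s \<kappa>\<close>, i.e. \<open>s < \<lambda>/(\<lambda> + \<kappa>)\<close>, then a random concatenation of independent blocks with
  weights proportional to \<open>|I|\<^sup>s\<close> still satisfies a Frostman condition with exponent \<open>s\<close> after the
  insertion, at very sparse times \<open>m\<close>, of a prefix of \<open>x\<^sub>0\<close> whose cylinder has length about
  \<open>exp (- m \<kappa>)\<close>; such a prefix exists because \<open>log i\<^sub>n = o(n)\<close>. Restricting to bounded
  digits keeps distinct cylinders separated. The polynomial target sets contain the exponential
  ones for every \<open>\<kappa>\<close>.\<close>

section \<open>Continued fraction words and cylinders\<close>

text \<open>Two rates compete. Summing \<open>|I|^s\<close> over cylinders gains
  \<open>(1 - s) * \<lambda>\<close> per digit, while reaching the target at time \<open>m\<close>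
  costs \<open>s * \<kappa> * m\<close> in one insertion. Only the last insertion can be charged in
  full, so all earlier ones together must be \<open>o(m)\<close>; this makes the insertion times
  factorials. Each concatenation loses a constant factor. The loss is per block and not per digit,
  so a long block length \<open>n\<close> lets the surplus \<open>exp (n * d)\<close> outweigh it.
  The inserted prefixes of \<open>x0\<close> may contain arbitrarily large digits. Separation is
  therefore asked only of the free blocks, and an inserted word is constrained only in its first
  digit: that keeps the tail behind a free block away from \<open>0\<close>, where neighbouring
  cylinders would touch. The value \<open>\<lambda>\<close> is the Gauss integral of
  \<open>- 2 * ln x\<close>, the logarithm of the absolute derivative of the Gauss map. Since
  cylinder lengths are inverse derivatives up to bounded distortion, exponentials of Birkhoff sums
  become powers of cylinder lengths.\<close>

fun cf_eval :: "nat list \<Rightarrow> real \<Rightarrow> real" where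
  "cf_eval [] y = y"
| "cf_eval (a # u) y = 1 / (real a + cf_eval u y)"

text \<open>In terms of the convergent denominators this is \<open>q_k + y * q_(k-1)\<close>, the
  denominator of the Moebius map \<open>cf_eval u\<close>, whose derivative at \<open>y\<close> has
  absolute value \<open>1 / (cf_den u y)^2\<close>. The product form makes
  \<open>cf_den_append\<close> a chain rule.\<close>

fun cf_den :: "nat list \<Rightarrow> real \<Rightarrow> real" where
  "cf_den [] y = 1"
| "cf_den (a # u) y = (real a + cf_eval u y) * cf_den u y"

text \<open>The classical length \<open>1 / (q_k * (q_k + q_(k-1)))\<close>; see
  \<open>emeasure_cyl\<close>.\<close>

definition cyl_len :: "nat list \<Rightarrow> real" where
  "cyl_len u = 1 / (cf_den u 0 * cf_den u 1)"

lemma cf_eval_append: "cf_eval (u @ v) y = cf_eval u (cf_eval v y)"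
  by (induction u) auto

lemma cf_den_append: "cf_den (u @ v) y = cf_den u (cf_eval v y) * cf_den v y"
  by (induction u) (auto simp: cf_eval_append)

lemma cf_eval_bounds: "0 \<notin> set u \<Longrightarrow> y \<in> {0..1} \<Longrightarrow> cf_eval u y \<in> {0..1}"
proof (induction u)
  case (Cons a u)
  then have "real a \<ge> 1" "cf_eval u y \<ge> 0" using Cons.IH Cons.prems by simp_all
  then show ?case by (auto simp: divide_simps)
qed auto

lemma cf_eval_open:
  assumes "0 \<notin> set u" "0 < y" "y < 1"
  shows "0 < cf_eval u y \<and> cf_eval u y < 1"
  using assms
proof (induction u)
  case (Cons a u)
  then have "real a \<ge> 1" "cf_eval u y > 0" using Cons.IH Cons.prems by simp_all
  then show ?case by (auto simp: divide_simps)
qed auto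

lemma cf_den_ge_1: "0 \<notin> set u \<Longrightarrow> y \<in> {0..1} \<Longrightarrow> cf_den u y \<ge> 1"
proof (induction u)
  case (Cons a u)
  then have "real a \<ge> 1" "cf_eval u y \<ge> 0" "cf_den u y \<ge> 1"
    using cf_eval_bounds[of u y] Cons.IH Cons.prems by simp_all
  then have "1 * 1 \<le> (real a + cf_eval u y) * cf_den u y" by (intro mult_mono) auto
  then show ?case by simp
qed auto

text \<open>\<open>cf_eval u\<close> is a Moebius map of determinant \<open>(-1) ^ length u\<close>:
  every digit contributes one orientation-reversing inversion.\<close>

lemma cf_eval_diff:
  assumes "0 \<notin> set u" "y \<in> {0..1}" "z \<in> {0..1}"
  shows "cf_eval u y - cf_eval u z = (-1) ^ length u * (y - z) / (cf_den u y * cf_den u z)"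
  using assms
proof (induction u)
  case (Cons a u)
  let ?Y = "real a + cf_eval u y" and ?Z = "real a + cf_eval u z"
  have a: "real a \<ge> 1" using Cons.prems by auto
  have p: "?Y > 0" "?Z > 0"
    using a cf_eval_bounds[of u y] cf_eval_bounds[of u z] Cons.prems by auto
  have "cf_eval (a # u) y - cf_eval (a # u) z = - (cf_eval u y - cf_eval u z) / (?Y * ?Z)"
    using p by (simp add: field_simps)
  also have "\<dots> = - ((-1) ^ length u * (y - z) / (cf_den u y * cf_den u z)) / (?Y * ?Z)"
    using Cons by simp
  finally show ?case by (simp add: mult_ac)
qed auto

lemma abs_cf_eval_diff:
  assumes "0 \<notin> set u" "y \<in> {0..1}" "z \<in> {0..1}"
  shows "\<bar>cf_eval u y - cf_eval u z\<bar> = \<bar>y - z\<bar> / (cf_den u y * cf_den u z)"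
  using cf_eval_diff[OF assms] cf_den_ge_1[of u y] cf_den_ge_1[of u z] assms
  by (simp add: abs_mult power_abs)

text \<open>The bound on denominators alone is not inductive, because
  \<open>cf_den (a # u) y\<close> equals \<open>a * cf_den u y + cf_eval u y * cf_den u y\<close>.
  The second conjunct controls the numerators \<open>cf_eval u y * cf_den u y\<close>. It fails for
  the empty word, whose numerator is \<open>y\<close>; there \<open>a \<ge> 1\<close> gives the step
  directly.\<close>

lemma cf_den_distortion_aux:
  assumes "0 \<notin> set u" "y \<in> {0..1}" "z \<in> {0..1}"
  shows "cf_den u y \<le> 2 * cf_den u z \<and>
    (u \<noteq> [] \<longrightarrow> cf_eval u y * cf_den u y \<le> 2 * (cf_eval u z * cf_den u z))"
  using assms
proof (induction u)
  case (Cons a u)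
  have a: "real a \<ge> 1" using Cons.prems by auto
  have b: "cf_eval u x \<ge> 0" "cf_eval u x \<le> 1" "cf_den u x \<ge> 1" if "x \<in> {0..1}" for x
    using cf_eval_bounds[of u x] cf_den_ge_1[of u x] Cons.prems that by auto
  \<comment> \<open>The numerator of \<open>a # u\<close> is the denominator of \<open>u\<close>, so
    the second conjunct for \<open>a # u\<close> is the first one for \<open>u\<close>.\<close>
  have n: "cf_eval (a # u) x * cf_den (a # u) x = cf_den u x" if "x \<in> {0..1}" for x
    using a b[OF that] by (simp add: field_simps)
  have IH: "cf_den u y \<le> 2 * cf_den u z"
     "u \<noteq> [] \<Longrightarrow> cf_eval u y * cf_den u y \<le> 2 * (cf_eval u z * cf_den u z)"
    using Cons by auto
  have "cf_den (a # u) y \<le> 2 * cf_den (a # u) z"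
  proof (cases "u = []")
    case True
    then show ?thesis using a Cons.prems by auto
  next
    case False
    have "real a * cf_den u y \<le> real a * (2 * cf_den u z)" using IH(1) a by (intro mult_left_mono) auto
    with IH(2)[OF False] show ?thesis by (simp add: algebra_simps)
  qed
  with IH(1) n[OF Cons.prems(2)] n[OF Cons.prems(3)] show ?case by presburger
qed auto

lemma cf_den_distortion:
  "0 \<notin> set u \<Longrightarrow> y \<in> {0..1} \<Longrightarrow> z \<in> {0..1} \<Longrightarrow> cf_den u y \<le> 2 * cf_den u z"
  using cf_den_distortion_aux by blast

lemma cyl_len_pos: "0 \<notin> set u \<Longrightarrow> 0 < cyl_len u"
  using cf_den_ge_1[of u 0] cf_den_ge_1[of u 1] by (auto simp: cyl_len_def)

lemma cyl_len_le_1: "0 \<notin> set u \<Longrightarrow> cyl_len u \<le> 1"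
  using cf_den_ge_1[of u 0] cf_den_ge_1[of u 1] mult_mono[of 1 "cf_den u 0" 1 "cf_den u 1"]
  by (auto simp: cyl_len_def divide_simps)

lemma cyl_len_Nil [simp]: "cyl_len [] = 1"
  by (simp add: cyl_len_def)

lemma cf_den_prod_le:
  assumes "0 \<notin> set u" "y \<in> {0..1}" "z \<in> {0..1}"
  shows "cf_den u y * cf_den u z \<le> 4 / cyl_len u"
proof -
  have "cf_den u y * cf_den u z \<le> (2 * cf_den u 0) * (2 * cf_den u 1)"
    using assms cf_den_ge_1[of u 0] cf_den_ge_1[of u z]
    by (intro mult_mono cf_den_distortion) auto
  then show ?thesis by (simp add: cyl_len_def)
qed

text \<open>\<open>cf_eval u\<close> maps the segment between \<open>y\<close> and \<open>z\<close>,
  of length \<open>cyl_len v\<close>, onto the segment of \<open>u @ v\<close>; the contraction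
  factor \<open>1 / (cf_den u y * cf_den u z)\<close> is at least \<open>cyl_len u / 4\<close> by
  distortion.\<close>

lemma cyl_len_append:
  assumes "0 \<notin> set u" "0 \<notin> set v"
  shows "cyl_len (u @ v) \<ge> cyl_len u * cyl_len v / 4"
proof -
  define y z where "y = cf_eval v 0" and "z = cf_eval v 1"
  have b: "y \<in> {0..1}" "z \<in> {0..1}" using assms cf_eval_bounds[of v] by (auto simp: y_def z_def)
  have p: "cf_den u y * cf_den u z > 0" using b cf_den_ge_1[of u] assms by (intro mult_pos_pos) force+
  have "cyl_len u / 4 \<le> 1 / (cf_den u y * cf_den u z)"
    using cf_den_prod_le[OF assms(1) b] cyl_len_pos[OF assms(1)] p by (simp add: field_simps)
  then have "cyl_len u / 4 * cyl_len v \<le> 1 / (cf_den u y * cf_den u z) * cyl_len v"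
    using cyl_len_pos[OF assms(2)] by (intro mult_right_mono) auto
  also have "\<dots> = cyl_len (u @ v)"
    by (simp add: cyl_len_def cf_den_append y_def z_def mult_ac)
  finally show ?thesis by simp
qed

lemma cyl_len_eq: "0 \<notin> set u \<Longrightarrow> cyl_len u = \<bar>cf_eval u 0 - cf_eval u 1\<bar>"
  using abs_cf_eval_diff[of u 0 1] by (simp add: cyl_len_def)

lemma cf_eval_in_segment:
  assumes "0 \<notin> set u" "x \<in> {0..1}"
  shows "cf_eval u x \<in> closed_segment (cf_eval u 0) (cf_eval u 1)"
proof -
  have e: "cf_eval u x - cf_eval u 0 = (-1) ^ length u * (x / (cf_den u x * cf_den u 0))"
    "cf_eval u 1 - cf_eval u x = (-1) ^ length u * ((1 - x) / (cf_den u 1 * cf_den u x))"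
    using cf_eval_diff[of u x 0] cf_eval_diff[of u 1 x] assms by auto
  have "cf_den u 0 \<ge> 1" "cf_den u 1 \<ge> 1" "cf_den u x \<ge> 1"
    using cf_den_ge_1[of u] assms by auto
  then have p: "x / (cf_den u x * cf_den u 0) \<ge> 0" "(1 - x) / (cf_den u 1 * cf_den u x) \<ge> 0"
    using assms by auto
  obtain P Q where PQ: "cf_eval u x - cf_eval u 0 = (-1) ^ length u * P"
    "cf_eval u 1 - cf_eval u x = (-1) ^ length u * Q" "0 \<le> P" "0 \<le> Q"
    using e p by blast
  then show ?thesis
    by (cases "even (length u)") (auto simp: closed_segment_eq_real_ivl)
qed

lemma cf_eval_close:
  assumes "0 \<notin> set u" "y \<in> {0..1}" "z \<in> {0..1}"
  shows "\<bar>cf_eval u y - cf_eval u z\<bar> \<le> cyl_len u"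
  using cf_eval_in_segment[OF assms(1,2)] cf_eval_in_segment[OF assms(1,3)]
  unfolding cyl_len_eq[OF assms(1)]
  by (auto simp: closed_segment_eq_real_ivl split: if_splits)

lemma cf_eval_separated:
  assumes "0 \<notin> set u" "y \<in> {0..1}" "z \<in> {0..1}"
  shows "cyl_len u * \<bar>y - z\<bar> / 4 \<le> \<bar>cf_eval u y - cf_eval u z\<bar>"
proof -
  have "1 \<le> cf_den u y" "1 \<le> cf_den u z" using assms cf_den_ge_1[of u] by auto
  then have p: "0 < cf_den u y * cf_den u z" by (intro mult_pos_pos) auto
  have "cyl_len u / 4 \<le> 1 / (cf_den u y * cf_den u z)"
    using cf_den_prod_le[OF assms] cyl_len_pos[OF assms(1)] p by (simp add: field_simps)
  from mult_right_mono[OF this, of "\<bar>y - z\<bar>"] show ?thesis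
    unfolding abs_cf_eval_diff[OF assms] by simp
qed

text \<open>Two consecutive digits contribute the factor \<open>a * (b + t) + 1 \<ge> 2\<close>. A
  single digit \<open>1\<close> followed by a small tail gives no definite gain, hence the halved
  exponent.\<close>

lemma cf_den_growth:
  assumes "0 \<notin> set u" "y \<in> {0..1}"
  shows "cf_den u y \<ge> 2 ^ (length u div 2)"
  using assms
proof (induction u rule: induct_list012)
  case (3 a b u)
  define t where "t = cf_eval u y"
  have t: "t \<ge> 0" "real a \<ge> 1" "real b \<ge> 1" using cf_eval_bounds[of u y] "3.prems" by (auto simp: t_def)
  have "(real a + 1 / (real b + t)) * (real b + t) = real a * (real b + t) + 1"
    using t by (simp add: field_simps)
  moreover have "1 * 1 \<le> real a * (real b + t)" using t by (intro mult_mono) auto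
  ultimately have "2 * 2 ^ (length u div 2) \<le> (real a + 1 / (real b + t)) * (real b + t) * cf_den u y"
    using 3 by (intro mult_mono) auto
  then show ?case by (simp add: t_def mult_ac)
qed (auto simp: cf_eval_bounds)

text \<open>Both denominators are at least \<open>2 ^ (length u div 2)\<close>; the factor
  \<open>2\<close> covers odd lengths.\<close>

lemma cyl_len_decay:
  assumes "0 \<notin> set u"
  shows "cyl_len u \<le> 2 * (1/2) ^ length u"
proof -
  let ?k = "length u div 2"
  have "2 ^ ?k * 2 ^ ?k \<le> cf_den u 0 * cf_den u 1"
    using cf_den_growth[of u] cf_den_ge_1[of u] assms
    by (intro mult_mono) (auto intro: order_trans[OF zero_le_one])
  then have "(2::real) ^ (2 * ?k) \<le> cf_den u 0 * cf_den u 1"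
    by (simp add: power_add mult_2)
  moreover have "(2::real) ^ length u \<le> 2 ^ (2 * ?k + 1)" by (intro power_increasing) auto
  ultimately have *: "(2::real) ^ length u \<le> 2 * (cf_den u 0 * cf_den u 1)" by simp
  have p: "cf_den u 0 * cf_den u 1 > 0" using cf_den_ge_1[of u 0] cf_den_ge_1[of u 1] assms by auto
  have "1 / (cf_den u 0 * cf_den u 1) \<le> 2 / 2 ^ length u"
    using * p by (simp add: field_simps)
  then show ?thesis by (simp add: cyl_len_def power_one_over)
qed

lemma continuous_on_cf_eval: "0 \<notin> set u \<Longrightarrow> continuous_on {0..1} (cf_eval u)"
proof (induction u)
  case (Cons a u)
  then have "real a + cf_eval u x \<noteq> 0" if "x \<in> {0..1}" for x
    using cf_eval_bounds[of u x] that by (auto simp: add_nonneg_eq_0_iff)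
  with Cons show ?case by (auto intro!: continuous_intros)
qed auto

lemma gauss_map_Cons:
  assumes "a \<ge> 1" "0 < t" "t < 1"
  shows "gauss_map (1 / (real a + t)) = t" "\<lfloor>1 / (1 / (real a + t))\<rfloor> = int a"
  using assms by (auto simp: gauss_map_def floor_eq_iff)

lemma gauss_map_iter_cf_eval:
  assumes "0 \<notin> set u" "0 < y" "y < 1"
  shows "(gauss_map ^^ length u) (cf_eval u y) = y"
  using assms
proof (induction u)
  case (Cons a u)
  have "gauss_map (cf_eval (a # u) y) = cf_eval u y"
    using gauss_map_Cons[of a "cf_eval u y"] cf_eval_open[of u y] Cons.prems by auto
  then show ?case using Cons by (simp add: funpow_swap1[symmetric] funpow_Suc_right del: funpow.simps(2))
qed auto

section \<open>Digit words of irrational points, and cylinders as sets\<close>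

definition irr01 :: "real set" where
  "irr01 = {0<..<1} - \<rat>"

definition cf_word :: "real \<Rightarrow> nat \<Rightarrow> nat list" where
  "cf_word x n = map (\<lambda>j. nat (cf_digit x j)) [0..<n]"

text \<open>Rational points are left out, so that different words of equal length give disjoint sets
  with no common endpoints. A word containing \<open>0\<close> has the empty cylinder.\<close>

definition cyl :: "nat list \<Rightarrow> real set" where
  "cyl u = {x \<in> irr01. cf_word x (length u) = u}"

lemma gauss_map_eq_frac: "gauss_map x = frac (1 / x)"
  by (auto simp: gauss_map_def frac_def)

lemma gauss_map_bounds: "0 \<le> gauss_map x" "gauss_map x < 1"
  by (simp_all add: gauss_map_eq_frac frac_lt_1)

lemma gauss_map_iter_bounds: "x \<in> {0..1} \<Longrightarrow> (gauss_map ^^ n) x \<in> {0..1}"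
  using gauss_map_bounds by (cases n) (auto intro: less_imp_le)

lemma gauss_map_irr01: "x \<in> irr01 \<Longrightarrow> gauss_map x \<in> irr01"
proof -
  assume x: "x \<in> irr01"
  have "gauss_map x \<notin> \<rat>"
  proof
    assume "gauss_map x \<in> \<rat>"
    then have "gauss_map x + of_int \<lfloor>1 / x\<rfloor> \<in> \<rat>" by simp
    then have "1 / x \<in> \<rat>" by (simp add: gauss_map_eq_frac frac_def)
    then have "x \<in> \<rat>" using Rats_divide[of 1 "1 / x"] by simp
    then show False using x by (auto simp: irr01_def)
  qed
  moreover from this have "gauss_map x \<noteq> 0" by auto
  ultimately show ?thesis using gauss_map_bounds[of x] by (auto simp: irr01_def)
qed

lemma gauss_map_iter_irr01: "x \<in> irr01 \<Longrightarrow> (gauss_map ^^ n) x \<in> irr01"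
  by (induction n) (auto simp: gauss_map_irr01)

lemma gauss_map_Rats: "x \<in> \<rat> \<Longrightarrow> gauss_map x \<in> \<rat>"
  by (auto simp: gauss_map_def)

lemma gauss_map_iter_Rats: "x \<in> \<rat> \<Longrightarrow> (gauss_map ^^ n) x \<in> \<rat>"
  by (induction n) (auto simp: gauss_map_Rats)

lemma length_cf_word [simp]: "length (cf_word x n) = n"
  by (simp add: cf_word_def)

lemma cf_word_0 [simp]: "cf_word x 0 = []"
  by (simp add: cf_word_def)

lemma gauss_map_iter_add: "(gauss_map ^^ (m + n)) x = (gauss_map ^^ n) ((gauss_map ^^ m) x)"
  by (subst add.commute) (simp add: funpow_add)

lemma cf_word_add: "cf_word x (m + n) = cf_word x m @ cf_word ((gauss_map ^^ m) x) n"
proof -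
  have "map (\<lambda>j. nat (cf_digit x j)) [m..<m + n] =
      map (\<lambda>j. nat (cf_digit ((gauss_map ^^ m) x) j)) [0..<n]"
    by (rule nth_equalityI) (auto simp: cf_digit_def gauss_map_iter_add)
  then show ?thesis
    unfolding cf_word_def using upt_add_eq_append[of 0 m n] by simp
qed

lemma cf_word_Suc: "cf_word x (Suc n) = nat \<lfloor>1 / x\<rfloor> # cf_word (gauss_map x) n"
  using cf_word_add[of x 1 n] by (simp add: cf_word_def cf_digit_def)

lemma cf_word_pos: "x \<in> irr01 \<Longrightarrow> 0 \<notin> set (cf_word x n)"
proof (induction n arbitrary: x)
  case (Suc n)
  then have "1 / x \<ge> 1" by (auto simp: irr01_def)
  then show ?case using Suc gauss_map_irr01[of x] by (auto simp: cf_word_Suc)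
qed auto

lemma cf_eval_cf_word: "x \<in> irr01 \<Longrightarrow> cf_eval (cf_word x n) ((gauss_map ^^ n) x) = x"
proof (induction n arbitrary: x)
  case (Suc n)
  have x: "0 < x" "x < 1" using Suc.prems by (auto simp: irr01_def)
  then have "\<lfloor>1 / x\<rfloor> \<ge> 0" by simp
  moreover have "cf_eval (cf_word (gauss_map x) n) ((gauss_map ^^ n) (gauss_map x)) = gauss_map x"
    using Suc gauss_map_irr01 by blast
  moreover have "real_of_int \<lfloor>1 / x\<rfloor> + gauss_map x = 1 / x" using x by (simp add: gauss_map_def)
  ultimately show ?case using x
    by (simp add: cf_word_Suc funpow_swap1)
qed auto

lemma cf_word_cf_eval:
  "0 \<notin> set u \<Longrightarrow> 0 < y \<Longrightarrow> y < 1 \<Longrightarrow> cf_word (cf_eval u y) (length u) = u"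
proof (induction u)
  case (Cons a u)
  then show ?case
    using gauss_map_Cons[of a "cf_eval u y"] cf_eval_open[of u y] by (simp add: cf_word_Suc)
qed auto

lemma cf_eval_irr01: "0 \<notin> set u \<Longrightarrow> y \<in> irr01 \<Longrightarrow> cf_eval u y \<in> irr01"
  using cf_eval_open[of u y] gauss_map_iter_cf_eval[of u y] gauss_map_iter_Rats[of "cf_eval u y" "length u"]
  by (auto simp: irr01_def)

lemma cf_eval_in_cyl: "0 \<notin> set u \<Longrightarrow> y \<in> irr01 \<Longrightarrow> cf_eval u y \<in> cyl u"
  using cf_eval_irr01[of u y] cf_word_cf_eval[of u y] by (auto simp: cyl_def irr01_def)

lemma cf_word_in_cyl: "x \<in> irr01 \<Longrightarrow> x \<in> cyl (cf_word x n)"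
  by (simp add: cyl_def)

lemma cyl_empty: "0 \<in> set u \<Longrightarrow> cyl u = {}"
  using cf_word_pos[of _ "length u"] by (force simp: cyl_def)

lemma cyl_cf_eval: "x \<in> cyl u \<Longrightarrow> cf_eval u ((gauss_map ^^ length u) x) = x"
  using cf_eval_cf_word[of x "length u"] by (simp add: cyl_def)

lemma cf_eval_Rats: "y \<in> \<rat> \<Longrightarrow> cf_eval u y \<in> \<rat>"
  by (induction u) (auto intro!: Rats_divide Rats_add)

text \<open>The inclusion from right to left is the intermediate value theorem for the continuous
  map \<open>cf_eval u\<close>; a preimage of an irrational point is irrational because
  \<open>cf_eval u\<close> preserves the rationals.\<close>

lemma cyl_eq:
  assumes "0 \<notin> set u"
  shows "cyl u = closed_segment (cf_eval u 0) (cf_eval u 1) - \<rat>"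
proof (intro equalityI subsetI)
  fix x assume x: "x \<in> cyl u"
  then have "(gauss_map ^^ length u) x \<in> irr01" by (auto simp: cyl_def gauss_map_iter_irr01)
  then have "x \<in> closed_segment (cf_eval u 0) (cf_eval u 1)"
    using cf_eval_in_segment[OF assms, of "(gauss_map ^^ length u) x"] cyl_cf_eval[OF x]
    by (auto simp: irr01_def)
  then show "x \<in> closed_segment (cf_eval u 0) (cf_eval u 1) - \<rat>" using x by (auto simp: cyl_def irr01_def)
next
  fix x assume x: "x \<in> closed_segment (cf_eval u 0) (cf_eval u 1) - \<rat>"
  have "connected (cf_eval u ` {0..1})"
    by (intro connected_continuous_image continuous_on_cf_eval assms) auto
  then have "closed_segment (cf_eval u 0) (cf_eval u 1) \<subseteq> cf_eval u ` {0..1}"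
    by (intro closed_segment_subset) (auto simp: connected_convex_1)
  then obtain y where y: "y \<in> {0..1}" "x = cf_eval u y" using x by blast
  have "y \<notin> \<rat>" using x y cf_eval_Rats by auto
  then have "y \<in> irr01" using y by (auto simp: irr01_def less_le)
  then show "x \<in> cyl u" using cf_eval_in_cyl assms y by blast
qed

lemma countable_Rats_real: "countable (\<rat> :: real set)"
  by (simp add: countable_rat)

lemma null_sets_Rats: "(\<rat> :: real set) \<in> null_sets lborel"
  using countable_Rats_real by (rule countable_imp_null_set_lborel)

lemma sets_Rats_borel [measurable]: "(\<rat> :: real set) \<in> sets borel"
  using null_setsD2[OF null_sets_Rats] by simp

lemma sets_irr01 [measurable]: "irr01 \<in> sets borel"
  by (auto simp: irr01_def)

lemma sets_cyl [measurable]: "cyl u \<in> sets borel"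
  by (cases "0 \<in> set u") (auto simp: cyl_empty cyl_eq closed_segment_eq_real_ivl)

lemma emeasure_cyl:
  assumes "0 \<notin> set u"
  shows "emeasure lborel (cyl u) = ennreal (cyl_len u)"
proof -
  have "emeasure lborel (cyl u) = emeasure lborel (closed_segment (cf_eval u 0) (cf_eval u 1))"
    unfolding cyl_eq[OF assms] by (intro emeasure_Diff_null_set null_sets_Rats) (auto simp: closed_segment_eq_real_ivl)
  also have "\<dots> = ennreal (cyl_len u)"
    unfolding cyl_len_eq[OF assms] by (auto simp: closed_segment_eq_real_ivl)
  finally show ?thesis .
qed

lemma measurable_gauss_map [measurable]: "gauss_map \<in> borel_measurable borel"
proof -
  have "gauss_map = (\<lambda>x. 1 / x - of_int \<lfloor>1 / x\<rfloor>)"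
    by (auto simp: gauss_map_def fun_eq_iff)
  also have "\<dots> \<in> borel_measurable borel" by measurable
  finally show ?thesis .
qed

lemma measurable_gauss_map_iter [measurable]: "(gauss_map ^^ n) \<in> borel_measurable borel"
proof (induction n)
  case (Suc n)
  then show ?case by (simp add: comp_def)
qed (auto simp: id_def)

section \<open>The Gauss measure\<close>

text \<open>Taken on the whole line with no mass outside \<open>{0..1}\<close>, so that
  \<open>gauss_map\<close> needs no restriction and distribution functions can be compared.\<close>

definition gauss_measure :: "real measure" where
  "gauss_measure = density lborel (\<lambda>x. ennreal (indicator {0..1} x / ((1 + x) * ln 2)))"

lemma sets_gauss_measure [simp, measurable_cong]: "sets gauss_measure = sets borel"
  by (simp add: gauss_measure_def)

lemma space_gauss_measure [simp]: "space gauss_measure = UNIV"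
  by (simp add: gauss_measure_def)

lemma nn_integral_gauss_measure:
  assumes [measurable]: "f \<in> borel_measurable borel"
  shows "(\<integral>\<^sup>+x. f x \<partial>gauss_measure) =
    (\<integral>\<^sup>+x. ennreal (indicator {0..1} x / ((1 + x) * ln 2)) * f x \<partial>lborel)"
  unfolding gauss_measure_def by (subst nn_integral_density) auto

lemma emeasure_gauss_measure_Icc:
  assumes "0 \<le> a" "a \<le> b" "b \<le> 1"
  shows "emeasure gauss_measure {a..b} = ennreal ((ln (1 + b) - ln (1 + a)) / ln 2)"
proof -
  have "emeasure gauss_measure {a..b} =
      (\<integral>\<^sup>+x. ennreal (indicator {0..1} x / ((1 + x) * ln 2)) * indicator {a..b} x \<partial>lborel)"
    unfolding gauss_measure_def by (subst emeasure_density) auto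
  also have "\<dots> = (\<integral>\<^sup>+x. ennreal (1 / ((1 + x) * ln 2)) * indicator {a..b} x \<partial>lborel)"
    using assms by (intro nn_integral_cong) (auto split: split_indicator)
  also have "\<dots> = ennreal (ln (1 + b) / ln 2 - ln (1 + a) / ln 2)"
    using assms by (intro nn_integral_FTC_Icc) (auto intro!: derivative_eq_intros simp: divide_simps)
  finally show ?thesis by (simp add: diff_divide_distrib)
qed

lemma prob_space_gauss_measure: "prob_space gauss_measure"
proof
  have "emeasure gauss_measure UNIV = emeasure gauss_measure {0..1}"
    unfolding gauss_measure_def by (subst (1 2) emeasure_density) (auto intro!: nn_integral_cong split: split_indicator)
  then show "emeasure gauss_measure (space gauss_measure) = 1"
    by (simp add: emeasure_gauss_measure_Icc)
qed

lemma AE_gauss_measure: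
  assumes [measurable]: "Measurable.pred borel P"
  shows "(AE x in gauss_measure. P x) \<longleftrightarrow> (AE x in lborel. x \<in> {0..1} \<longrightarrow> P x)"
  unfolding gauss_measure_def
  by (subst AE_density) (auto intro!: AE_cong simp: ennreal_neg not_le split: split_indicator)

lemma emeasure_gauss_measure_le:
  assumes [measurable]: "A \<in> sets borel"
  shows "emeasure gauss_measure A \<le> ennreal (1 / ln 2) * emeasure lborel A"
proof -
  have *: "indicator {0..1} x / ((1 + x) * ln 2) \<le> 1 / ln 2" for x :: real
  proof (cases "x \<in> {0..1}")
    case True
    then have "1 / ((1 + x) * ln 2) \<le> 1 / (1 * ln 2)"
      by (intro divide_left_mono mult_right_mono mult_pos_pos) auto
    then show ?thesis using True by simp
  qed simp
  have "emeasure gauss_measure A =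
      (\<integral>\<^sup>+x. ennreal (indicator {0..1} x / ((1 + x) * ln 2)) * indicator A x \<partial>lborel)"
    unfolding gauss_measure_def by (subst emeasure_density) auto
  also have "\<dots> \<le> (\<integral>\<^sup>+x. ennreal (1 / ln 2) * indicator A x \<partial>lborel)"
    using * by (intro nn_integral_mono mult_right_mono ennreal_leI) auto
  also have "\<dots> = ennreal (1 / ln 2) * emeasure lborel A"
    by (subst nn_integral_cmult) auto
  finally show ?thesis .
qed

lemma measure_gauss_measure_Icc:
  assumes "0 \<le> a" "a \<le> b" "b \<le> 1"
  shows "measure gauss_measure {a..b} = (ln (1 + b) - ln (1 + a)) / ln 2"
  using emeasure_gauss_measure_Icc[OF assms] assms by (simp add: measure_def)

lemma AE_gauss_measure_01: "AE x in gauss_measure. x \<in> {0..1}"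
  by (subst AE_gauss_measure) auto

lemma gauss_map_le_iff:
  assumes "0 < x" "x \<le> 1" "0 \<le> t" "t < 1"
  shows "gauss_map x \<le> t \<longleftrightarrow> (\<exists>k::nat. x \<in> {1 / (real (Suc k) + t)..1 / real (Suc k)})"
proof
  assume g: "gauss_map x \<le> t"
  have "1 / x \<ge> 1" using assms by simp
  then have "\<lfloor>1 / x\<rfloor> = int (Suc (nat (\<lfloor>1 / x\<rfloor> - 1)))" by (simp add: one_le_floor)
  then obtain k where k: "\<lfloor>1 / x\<rfloor> = int (Suc k)" by blast
  have "real (Suc k) \<le> 1 / x" "1 / x \<le> real (Suc k) + t"
    using g assms k of_int_floor_le[of "1 / x"] by (auto simp: gauss_map_def)
  then show "\<exists>k::nat. x \<in> {1 / (real (Suc k) + t)..1 / real (Suc k)}"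
    using assms by (intro exI[of _ k]) (auto simp: field_simps)
next
  assume "\<exists>k::nat. x \<in> {1 / (real (Suc k) + t)..1 / real (Suc k)}"
  then obtain k :: nat where k: "1 / (real (Suc k) + t) \<le> x" "x \<le> 1 / real (Suc k)" by auto
  have p: "real (Suc k) + t > 0" using assms by auto
  have "1 / x \<ge> real (Suc k)" using k(2) assms by (simp add: field_simps)
  moreover have "1 / x \<le> real (Suc k) + t"
    using k(1) assms p by (simp add: divide_le_eq pos_divide_le_eq mult.commute)
  ultimately have "\<lfloor>1 / x\<rfloor> = int (Suc k)" using assms by (intro floor_unique) auto
  then show "gauss_map x \<le> t" using assms \<open>1 / x \<le> _\<close> by (auto simp: gauss_map_def)
qed

text \<open>Up to a null set the preimage is the disjoint union of the branch intervals
  \<open>B k\<close>. With \<open>K = k + 1\<close>, the ratio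
  \<open>(1 + 1/K) / (1 + 1/(K + t))\<close> is the quotient of \<open>(K + t) / K\<close> by its
  successor, so the logarithms telescope to \<open>g 0\<close>; this is what singles out the density
  \<open>1 / (1 + x)\<close>.\<close>

lemma measure_gauss_map_vimage:
  assumes t: "0 \<le> t" "t < 1"
  shows "measure gauss_measure (gauss_map -` {..t}) = ln (1 + t) / ln 2"
proof -
  interpret prob_space gauss_measure by (rule prob_space_gauss_measure)
  define B where "B k = {1 / (real (Suc k) + t)..1 / real (Suc k)}" for k
  have ivl: "0 \<le> 1 / (real (Suc k) + t)" "1 / (real (Suc k) + t) \<le> 1 / real (Suc k)"
      "1 / real (Suc k) \<le> 1" for k
    using t by (auto intro!: divide_left_mono)
  define g where "g k = ln ((real (Suc k) + t) / real (Suc k)) / ln 2" for k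
  have mB: "measure gauss_measure (B k) = g k - g (Suc k)" for k
  proof -
    have p: "real (Suc k) > 0" "real (Suc k) + t > 0" using t by auto
    have "measure gauss_measure (B k) = ln ((1 + 1 / real (Suc k)) / (1 + 1 / (real (Suc k) + t))) / ln 2"
    proof -
      have "0 < 1 + 1 / real (Suc k)" "0 < 1 + 1 / (real (Suc k) + t)"
        using add_pos_pos[OF zero_less_one divide_pos_pos[OF zero_less_one p(1)]]
          add_pos_pos[OF zero_less_one divide_pos_pos[OF zero_less_one p(2)]] by auto
      then show ?thesis
        unfolding B_def using measure_gauss_measure_Icc[OF ivl(1,2,3)[of k]] by (subst ln_div) auto
    qed
    also have "(1 + 1 / real (Suc k)) / (1 + 1 / (real (Suc k) + t)) =
        ((real (Suc k) + t) / real (Suc k)) / ((real (Suc (Suc k)) + t) / real (Suc (Suc k)))"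
      using t by (simp add: divide_simps)
    also have "ln \<dots> / ln 2 = g k - g (Suc k)"
      unfolding g_def using t by (subst ln_div) (auto simp: diff_divide_distrib)
    finally show ?thesis .
  qed
  have "g \<longlonglongrightarrow> ln 1 / ln 2"
  proof -
    have "(\<lambda>k. 1 + t * inverse (real (Suc k))) \<longlonglongrightarrow> 1 + t * 0"
      by (intro tendsto_intros LIMSEQ_inverse_real_of_nat)
    moreover have "1 + t * inverse (real (Suc k)) = (real (Suc k) + t) / real (Suc k)" for k
      by (simp add: field_simps)
    ultimately have "(\<lambda>k. (real (Suc k) + t) / real (Suc k)) \<longlonglongrightarrow> 1" by simp
    then show ?thesis unfolding g_def by (intro tendsto_intros) auto
  qed
  then have "(\<lambda>k. g k - g (Suc k)) sums (g 0 - 0)"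
    using telescope_sums'[of g 0] by simp
  moreover have "(\<lambda>k. measure gauss_measure (B k)) sums measure gauss_measure (\<Union>k. B k)"
  proof (intro finite_measure_UNION)
    show "disjoint_family B"
    proof -
      have "B i \<inter> B j = {}" if "i < j" for i j
      proof -
        have "real (Suc i) + t < real (Suc j)" using that t by auto
        then have "1 / real (Suc j) < 1 / (real (Suc i) + t)"
          using t by (intro divide_strict_left_mono) auto
        then show ?thesis by (auto simp: B_def)
      qed
      then show ?thesis unfolding disjoint_family_on_def by (metis inf_commute linorder_neqE_nat)
    qed
  qed (auto simp: B_def)
  ultimately have "measure gauss_measure (\<Union>k. B k) = g 0"
    unfolding mB using sums_unique2 by fastforce
  moreover have "measure gauss_measure (gauss_map -` {..t}) = measure gauss_measure (\<Union>k. B k)"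
  proof (rule measure_eq_AE)
    have "AE x in lborel. x \<noteq> (0::real)" by (rule AE_lborel_singleton)
    then show "AE x in gauss_measure. (x \<in> gauss_map -` {..t}) = (x \<in> (\<Union>k. B k))"
      by (subst AE_gauss_measure)
         (auto simp: gauss_map_le_iff[OF _ _ t] B_def less_le elim!: eventually_mono)
  qed (auto simp: B_def intro!: measurable_sets_borel[OF measurable_gauss_map])
  ultimately show ?thesis by (simp add: g_def)
qed

theorem gauss_measure_invariant: "distr gauss_measure borel gauss_map = gauss_measure"
proof (rule cdf_unique)
  interpret prob_space gauss_measure by (rule prob_space_gauss_measure)
  show "real_distribution gauss_measure"
    by (intro real_distribution.intro real_distribution_axioms.intro) (auto simp: prob_space_gauss_measure)
  show "real_distribution (distr gauss_measure borel gauss_map)"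
    by (intro real_distribution_distr) auto
  show "cdf (distr gauss_measure borel gauss_map) = cdf gauss_measure"
  proof
    fix t :: real
    have 1: "cdf (distr gauss_measure borel gauss_map) t = measure gauss_measure (gauss_map -` {..t})"
      by (simp add: cdf_def measure_distr)
    have "measure gauss_measure (gauss_map -` {..t}) = measure gauss_measure {..t}"
    proof -
      consider "t < 0" | "0 \<le> t" "t < 1" | "1 \<le> t" by linarith
      then show ?thesis
      proof cases
        case 1
        have "measure gauss_measure {..t} = measure gauss_measure {}"
          using 1 by (intro measure_eq_AE eventually_mono[OF AE_gauss_measure_01]) auto
        moreover have "gauss_map -` {..t} = {}"
          using less_le_trans[OF 1 gauss_map_bounds(1)] by (auto simp: not_le[symmetric])
        ultimately show ?thesis by simp
      next
        case 2
        have "measure gauss_measure {..t} = measure gauss_measure {0..t}"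
          using 2 by (intro measure_eq_AE eventually_mono[OF AE_gauss_measure_01]) auto
        then show ?thesis using 2 measure_gauss_map_vimage[OF 2] by (simp add: measure_gauss_measure_Icc)
      next
        case 3
        have "measure gauss_measure {..t} = measure gauss_measure UNIV"
          using 3 by (intro measure_eq_AE eventually_mono[OF AE_gauss_measure_01]) auto
        moreover have "gauss_map -` {..t} = UNIV"
          using 3 gauss_map_bounds(2) by (auto intro: less_imp_le less_le_trans)
        ultimately show ?thesis by simp
      qed
    qed
    then show "cdf (distr gauss_measure borel gauss_map) t = cdf gauss_measure t"
      unfolding 1 by (simp add: cdf_def)
  qed
qed

lemma nn_integral_gauss_map_iter:
  assumes [measurable]: "f \<in> borel_measurable borel"
  shows "(\<integral>\<^sup>+x. f ((gauss_map ^^ n) x) \<partial>gauss_measure) = (\<integral>\<^sup>+x. f x \<partial>gauss_measure)"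
proof (induction n)
  case (Suc n)
  have "(\<integral>\<^sup>+x. f ((gauss_map ^^ n) (gauss_map x)) \<partial>gauss_measure) =
      (\<integral>\<^sup>+x. f ((gauss_map ^^ n) x) \<partial>distr gauss_measure borel gauss_map)"
    by (subst nn_integral_distr) auto
  then show ?case using Suc by (simp add: gauss_measure_invariant funpow_swap1)
qed simp

lemma emeasure_gauss_map_iter_vimage:
  assumes [measurable]: "A \<in> sets borel"
  shows "emeasure gauss_measure ((gauss_map ^^ n) -` A) = emeasure gauss_measure A"
proof -
  have [measurable]: "(gauss_map ^^ n) -` A \<in> sets borel"
    by (rule measurable_sets_borel[OF measurable_gauss_map_iter assms])
  have "emeasure gauss_measure ((gauss_map ^^ n) -` A) =
      (\<integral>\<^sup>+x. indicator A ((gauss_map ^^ n) x) \<partial>gauss_measure)"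
    by (simp flip: indicator_vimage)
  also have "\<dots> = emeasure gauss_measure A"
    by (subst nn_integral_gauss_map_iter) auto
  finally show ?thesis .
qed

lemma AE_lebesgue_of_gauss_measure:
  assumes "AE x in gauss_measure. P x" "Measurable.pred borel P"
  shows "AE x\<in>{0..1} in lebesgue. P x"
  using assms AE_gauss_measure[of P] by (intro AE_completion) auto

text \<open>By invariance the event of being in \<open>A n\<close> at time \<open>n\<close> has the
  Gauss measure of \<open>A n\<close>, so the convergence half of Borel-Cantelli applies without any
  independence. The density is at most \<open>1 / ln 2\<close>, so the targets may be measured by
  Lebesgue measure.\<close>

lemma gauss_borel_cantelli:
  assumes A[measurable]: "\<And>n. A n \<in> sets borel"
    and bd: "\<And>n. emeasure lborel (A n) \<le> ennreal (b n)" and "summable b" "\<And>n. 0 \<le> b n"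
    and Q: "\<And>x. x \<in> {0..1} \<Longrightarrow> eventually (\<lambda>n. (gauss_map ^^ n) x \<notin> A n) sequentially \<Longrightarrow> Q x"
  shows "AE x\<in>{0..1} in lebesgue. Q x"
proof -
  interpret prob_space gauss_measure by (rule prob_space_gauss_measure)
  define B where "B n = (gauss_map ^^ n) -` A n" for n
  have [measurable]: "B n \<in> sets borel" for n
    unfolding B_def by (rule measurable_sets_borel[OF measurable_gauss_map_iter A])
  have "emeasure gauss_measure (B n) \<le> ennreal (b n / ln 2)" for n
  proof -
    have "emeasure gauss_measure (B n) \<le> ennreal (1 / ln 2) * emeasure lborel (A n)"
      unfolding B_def by (subst emeasure_gauss_map_iter_vimage) (auto intro: emeasure_gauss_measure_le)
    also have "\<dots> \<le> ennreal (1 / ln 2) * ennreal (b n)" by (intro mult_left_mono bd) auto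
    also have "\<dots> = ennreal (b n / ln 2)" using assms(4) by (subst ennreal_mult[symmetric]) auto
    finally show ?thesis .
  qed
  then have "measure gauss_measure (B n) \<le> b n / ln 2" for n
    using \<open>\<And>n. 0 \<le> b n\<close> by (simp add: emeasure_eq_measure)
  then have "summable (\<lambda>n. measure gauss_measure (B n))"
    using \<open>summable b\<close> by (intro summable_comparison_test'[OF summable_divide[OF \<open>summable b\<close>, of "ln 2"]]) auto
  then have "AE x in gauss_measure. eventually (\<lambda>n. x \<in> space gauss_measure - B n) sequentially"
    by (intro borel_cantelli_AE1) (auto simp: emeasure_eq_measure)
  then have "AE x in gauss_measure. eventually (\<lambda>n. x \<notin> B n) sequentially" by simp
  moreover have "Measurable.pred borel (\<lambda>x. eventually (\<lambda>n. x \<notin> B n) sequentially)" by measurable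
  ultimately have "AE x\<in>{0..1} in lebesgue. eventually (\<lambda>n. x \<notin> B n) sequentially"
    by (rule AE_lebesgue_of_gauss_measure)
  then show ?thesis using Q by (auto simp: B_def elim!: eventually_mono)
qed

section \<open>Almost everywhere statements\<close>

lemma liminf_ereal_eq_0_iff:
  assumes "\<And>n. 0 \<le> f n"
  shows "liminf (\<lambda>n. ereal (f n)) = 0 \<longleftrightarrow> (\<forall>e>0. \<forall>m. \<exists>n\<ge>m. f n < e)"
proof
  assume L: "liminf (\<lambda>n. ereal (f n)) = 0"
  show "\<forall>e>0. \<forall>m. \<exists>n\<ge>m. f n < e"
  proof (intro allI impI, rule ccontr)
    fix e :: real and m
    assume e: "e > 0" "\<not> (\<exists>n\<ge>m. f n < e)"
    then have "\<forall>\<^sub>F n in sequentially. ereal e \<le> ereal (f n)"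
      by (auto simp: eventually_sequentially not_less)
    then have "ereal e \<le> liminf (\<lambda>n. ereal (f n))" by (rule Liminf_bounded)
    then show False using L e by simp
  qed
next
  assume A: "\<forall>e>0. \<forall>m. \<exists>n\<ge>m. f n < e"
  have "0 \<le> liminf (\<lambda>n. ereal (f n))"
    using assms by (intro Liminf_bounded) auto
  moreover have "\<not> 0 < liminf (\<lambda>n. ereal (f n))"
  proof
    assume "0 < liminf (\<lambda>n. ereal (f n))"
    then obtain e where e: "0 < ereal e" "ereal e < liminf (\<lambda>n. ereal (f n))"
      using ereal_dense2[of 0 "liminf (\<lambda>n. ereal (f n))"] by (auto simp: zero_ereal_def)
    then have "\<forall>\<^sub>F n in sequentially. ereal e < ereal (f n)" by (intro less_LiminfD)
    then obtain m where "\<And>n. n \<ge> m \<Longrightarrow> e < f n" by (auto simp: eventually_sequentially)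
    moreover have "e > 0" using e by simp
    ultimately show False using A by (meson less_asym)
  qed
  ultimately show "liminf (\<lambda>n. ereal (f n)) = 0" by (simp add: less_le)
qed

section \<open>Quasi-independence of digit blocks\<close>

lemma cyl_append_iff:
  assumes "x \<in> cyl u"
  shows "x \<in> cyl (u @ w) \<longleftrightarrow> (gauss_map ^^ length u) x \<in> cyl w"
  using assms gauss_map_iter_irr01[of x] by (auto simp: cyl_def cf_word_add)

lemma cyl_append_subset: "cyl (u @ w) \<subseteq> cyl u"
  by (auto simp: cyl_def cf_word_add)

text \<open>\<open>C\<close> depends only on the first \<open>n\<close> digits, so it is a countable
  disjoint union of cylinders. Inside each of them the word \<open>w\<close> comes next with
  conditional probability at least \<open>cyl_len w / 4\<close>, by
  \<open>cyl_len_append\<close>.\<close>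

lemma cyl_quasi_independence:
  fixes G :: "nat list set" and n :: nat
  defines "C \<equiv> {x \<in> irr01. cf_word x n \<in> G}"
  assumes w: "0 \<notin> set w"
  shows "C \<in> sets borel"
    and "ennreal (cyl_len w / 4) * emeasure lborel C \<le> emeasure lborel (C \<inter> (gauss_map ^^ n) -` cyl w)"
proof -
  define H where "H = {u \<in> G. length u = n \<and> 0 \<notin> set u}"
  have C: "C = (\<Union>u\<in>H. cyl u)"
    using cf_word_pos by (fastforce simp: C_def H_def cyl_def)
  have CI: "C \<inter> (gauss_map ^^ n) -` cyl w = (\<Union>u\<in>H. cyl (u @ w))"
  proof -
    have "x \<in> cyl (u @ w) \<longleftrightarrow> x \<in> cyl u \<and> (gauss_map ^^ n) x \<in> cyl w" if "u \<in> H" for u x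
      using that cyl_append_iff[of x u w] cyl_append_subset[of u w] by (auto simp: H_def)
    then show ?thesis unfolding C by blast
  qed
  show "C \<in> sets borel" unfolding C by (intro sets.countable_UN'') auto
  have disj: "disjoint_family_on cyl H"
    by (auto simp: disjoint_family_on_def H_def cyl_def)
  have disj': "disjoint_family_on (\<lambda>u. cyl (u @ w)) H"
    using disj cyl_append_subset unfolding disjoint_family_on_def by blast
  have "ennreal (cyl_len w / 4) * emeasure lborel C =
      (\<integral>\<^sup>+u. ennreal (cyl_len w / 4) * emeasure lborel (cyl u) \<partial>count_space H)"
    unfolding C using disj by (subst emeasure_UN_countable) (auto simp: nn_integral_cmult)
  also have "\<dots> \<le> (\<integral>\<^sup>+u. emeasure lborel (cyl (u @ w)) \<partial>count_space H)"
  proof (rule nn_integral_mono)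
    fix u assume "u \<in> space (count_space H)"
    then have u: "0 \<notin> set u" by (simp add: H_def)
    have "ennreal (cyl_len w / 4) * emeasure lborel (cyl u) = ennreal (cyl_len w / 4 * cyl_len u)"
      using cyl_len_pos[OF w] cyl_len_pos[OF u] by (subst ennreal_mult) (auto simp: emeasure_cyl[OF u])
    also have "\<dots> \<le> ennreal (cyl_len (u @ w))"
      using cyl_len_append[OF u w] by (intro ennreal_leI) (simp add: mult.commute)
    also have "\<dots> = emeasure lborel (cyl (u @ w))" using u w by (subst emeasure_cyl) auto
    finally show "ennreal (cyl_len w / 4) * emeasure lborel (cyl u) \<le> emeasure lborel (cyl (u @ w))" .
  qed
  also have "\<dots> = emeasure lborel (C \<inter> (gauss_map ^^ n) -` cyl w)"
    unfolding CI using disj' by (subst emeasure_UN_countable) auto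
  finally show "ennreal (cyl_len w / 4) * emeasure lborel C \<le> emeasure lborel (C \<inter> (gauss_map ^^ n) -` cyl w)" .
qed

text \<open>Only disjoint blocks, at multiples of \<open>length w\<close>, are tested: the event is
  then determined by the first \<open>j * length w\<close> digits, which is exactly where the next
  tested block begins.\<close>

definition miss_set :: "nat list \<Rightarrow> nat \<Rightarrow> real set" where
  "miss_set w j = {x \<in> irr01. \<forall>i<j. (gauss_map ^^ (i * length w)) x \<notin> cyl w}"

lemma miss_set_word_event:
  obtains G where "miss_set w j = {x \<in> irr01. cf_word x (j * length w) \<in> G}"
proof
  let ?k = "length w"
  let ?G = "{v. \<forall>i<j. take ?k (drop (i * ?k) v) \<noteq> w}"
  have "(gauss_map ^^ (i * ?k)) x \<in> cyl w \<longleftrightarrow> take ?k (drop (i * ?k) (cf_word x (j * ?k))) = w"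
    if x: "x \<in> irr01" and ij: "i < j" for x i
  proof -
    obtain d where "j = i + Suc d" using less_imp_Suc_add[OF ij] by auto
    then have "j * ?k = i * ?k + (?k + d * ?k)" by (simp add: add_mult_distrib)
    then have "take ?k (drop (i * ?k) (cf_word x (j * ?k))) = cf_word ((gauss_map ^^ (i * ?k)) x) ?k"
      by (simp add: cf_word_add)
    then show ?thesis using gauss_map_iter_irr01[OF x] by (auto simp: cyl_def)
  qed
  then show "miss_set w j = {x \<in> irr01. cf_word x (j * ?k) \<in> ?G}"
    by (auto simp: miss_set_def)
qed

text \<open>Given that the first \<open>j\<close> blocks avoid \<open>w\<close>, the next one equals
  \<open>w\<close> with conditional probability at least \<open>cyl_len w / 4\<close>.\<close>

lemma miss_set_decay:
  assumes w: "0 \<notin> set w"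
  shows "miss_set w j \<in> sets borel \<and> emeasure lborel (miss_set w j) \<noteq> \<infinity> \<and>
    measure lborel (miss_set w j) \<le> (1 - cyl_len w / 4) ^ j"
proof (induction j)
  case 0
  have "emeasure lborel irr01 \<le> emeasure lborel {0<..<1::real}"
    by (intro emeasure_mono) (auto simp: irr01_def)
  then have "emeasure lborel irr01 \<le> 1" by simp
  moreover from this have "measure lborel irr01 \<le> 1"
    by (auto simp: measure_def enn2real_leI)
  ultimately show ?case by (auto simp: miss_set_def top_unique)
next
  case (Suc j)
  let ?M = "miss_set w" and ?T = "gauss_map ^^ (j * length w)"
  let ?A = "?M j \<inter> ?T -` cyl w"
  obtain G where G: "?M j = {x \<in> irr01. cf_word x (j * length w) \<in> G}"
    using miss_set_word_event by blast
  have [measurable]: "?M j \<in> sets borel" "?T -` cyl w \<in> sets borel"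
    using Suc measurable_sets_borel[OF measurable_gauss_map_iter sets_cyl] by auto
  have eq: "?M (Suc j) = ?M j - ?A" by (auto simp: miss_set_def less_Suc_eq)
  have fin: "emeasure lborel ?A \<noteq> \<infinity>"
    using Suc emeasure_mono[of ?A "?M j" lborel] by (auto simp: top_unique)
  have "ennreal (cyl_len w / 4) * emeasure lborel (?M j) \<le> emeasure lborel ?A"
    using cyl_quasi_independence(2)[OF w, of "j * length w" G] by (simp add: G)
  then have "ennreal (cyl_len w / 4 * measure lborel (?M j)) \<le> ennreal (measure lborel ?A)"
    using Suc fin cyl_len_pos[OF w] by (subst ennreal_mult) (simp_all add: emeasure_eq_ennreal_measure)
  then have "cyl_len w / 4 * measure lborel (?M j) \<le> measure lborel ?A" by simp
  then have "measure lborel (?M (Suc j)) \<le> (1 - cyl_len w / 4) * measure lborel (?M j)"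
    unfolding eq using Suc by (subst measure_Diff) (auto simp: algebra_simps)
  also have "\<dots> \<le> (1 - cyl_len w / 4) * (1 - cyl_len w / 4) ^ j"
    using Suc cyl_len_le_1[OF w] by (intro mult_left_mono) auto
  finally show ?case
    using Suc emeasure_mono[of "?M (Suc j)" "?M j" lborel] by (auto simp: eq top_unique)
qed

lemma AE_lborel_countable: "countable A \<Longrightarrow> AE x in lborel. x \<notin> (A :: real set)"
  using countable_imp_null_set_lborel by (rule AE_not_in)

lemma sq_exp_tendsto_0:
  assumes "0 < (b::real)"
  shows "(\<lambda>k. 2 * (real k + 1) ^ 2 * exp (- b * real k)) \<longlonglongrightarrow> 0"
  using assms by real_asymp

text \<open>A hit of the prefix \<open>w k\<close> before block number \<open>j k\<close> happens at
  a time \<open>n\<close> of order at most \<open>k^2 / l k\<close> and within distance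
  \<open>l k\<close> of \<open>x0\<close>. The weighted distance is then at most a polynomial in
  \<open>k\<close> times \<open>l k powr (1 - 1 / \<alpha>)\<close>, which decays exponentially as
  \<open>\<alpha> > 1\<close>; \<open>c k\<close> is this bound.\<close>

lemma AE_shrinking_target_zero:
  assumes x0: "x0 \<in> irr01" and \<alpha>: "1 < \<alpha>"
  shows "AE x\<in>{0..1} in lebesgue. liminf (\<lambda>n. ereal (real n powr (1 / \<alpha>) * \<bar>(gauss_map ^^ n) x - x0\<bar>)) = 0"
proof -
  \<comment> \<open>The length \<open>Suc k\<close> keeps blocks nonempty and turns the bound
    \<open>2 * (1/2) ^ Suc k\<close> into \<open>(1/2) ^ k\<close>.\<close>
  define w where "w k = cf_word x0 (Suc k)" for k
  define l where "l k = cyl_len (w k)" for k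
  define j where "j k = nat \<lceil>real k / l k\<rceil>" for k
  define c where "c k = 2 * (real k + 1) ^ 2 * ((1/2) ^ k) powr (1 - 1 / \<alpha>)" for k
  have wpos: "0 \<notin> set (w k)" for k using cf_word_pos[OF x0] by (simp add: w_def)
  have l: "0 < l k" "l k \<le> 1" "l k \<le> (1/2) ^ k" for k
    using cyl_len_pos[OF wpos] cyl_len_le_1[OF wpos] cyl_len_decay[OF wpos, of k]
    by (auto simp: l_def w_def)
  have jk: "real k / l k \<le> real (j k)" "real (j k) < real k / l k + 1" for k
  proof -
    have "0 \<le> real k / l k" using l[of k] by simp
    then show "real k / l k \<le> real (j k)" "real (j k) < real k / l k + 1"
      unfolding j_def by linarith+
  qed
  have "0 < ln 2 * (1 - 1 / \<alpha>)" using \<alpha> by simp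
  then have "(\<lambda>k. 2 * (real k + 1) ^ 2 * exp (- (ln 2 * (1 - 1 / \<alpha>)) * real k)) \<longlonglongrightarrow> 0"
    by (rule sq_exp_tendsto_0)
  moreover have "2 * (real k + 1) ^ 2 * exp (- (ln 2 * (1 - 1 / \<alpha>)) * real k) = c k" for k
    by (simp add: c_def powr_def ln_realpow ln_div)
  ultimately have c0: "c \<longlonglongrightarrow> 0" by simp
  have miss: "emeasure lborel (miss_set (w k) (j k)) \<le> ennreal (exp (- real k / 4))" for k
  proof -
    note d = miss_set_decay[OF wpos, of k "j k"]
    have "(1 - l k / 4) ^ j k \<le> exp (- (l k / 4)) ^ j k"
      using l[of k] exp_ge_add_one_self[of "- (l k / 4)"] by (intro power_mono) auto
    also have "\<dots> = exp (- (real (j k) * l k / 4))" by (simp flip: exp_of_nat_mult)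
    also have "\<dots> \<le> exp (- real k / 4)" using jk(1)[of k] l[of k] by (simp add: field_simps)
    finally show ?thesis using d by (simp add: emeasure_eq_ennreal_measure l_def ennreal_leI)
  qed
  \<comment> \<open>Missing every prefix from \<open>K\<close> on is no more likely than missing a
    single one, and these probabilities tend to \<open>0\<close>.\<close>
  have null: "AE x in lborel. x \<notin> (\<Inter>k\<in>{K..}. miss_set (w k) (j k))" for K
  proof -
    let ?B = "\<Inter>k\<in>{K..}. miss_set (w k) (j k)"
    have [measurable]: "?B \<in> sets borel" using miss_set_decay[OF wpos] by (intro sets.countable_INT'') auto
    have "emeasure lborel ?B \<le> ennreal (exp (- real k / 4))" if "k \<ge> K" for k
      using that miss_set_decay[OF wpos] by (intro order_trans[OF emeasure_mono miss[of k]]) auto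
    moreover have "(\<lambda>k. ennreal (exp (- real k / 4))) \<longlonglongrightarrow> ennreal 0"
      by (intro tendsto_ennrealI) real_asymp
    ultimately have "emeasure lborel ?B \<le> 0"
      by (intro tendsto_lowerbound[of _ _ sequentially]) (auto simp: eventually_sequentially)
    then show ?thesis by (intro AE_not_in) (auto simp: null_sets_def)
  qed
  have "AE x in lborel. \<forall>K. x \<notin> (\<Inter>k\<in>{K..}. miss_set (w k) (j k))"
    using null by (simp only: AE_all_countable) blast
  \<comment> \<open>This countable set contains every irrational point whose orbit meets
    \<open>x0\<close>.\<close>
  moreover have "AE x in lborel. x \<notin> range (\<lambda>u. cf_eval u x0)"
    by (intro AE_lborel_countable) auto
  moreover have "AE x in lborel. x \<notin> (\<rat> :: real set)"
    by (intro AE_lborel_countable countable_Rats_real)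
  ultimately have "AE x in lborel. x \<in> {0..1} \<longrightarrow>
      liminf (\<lambda>n. ereal (real n powr (1 / \<alpha>) * \<bar>(gauss_map ^^ n) x - x0\<bar>)) = 0"
  proof eventually_elim
    case (elim x)
    show ?case
    proof
      assume "x \<in> {0..1}"
      then have x: "x \<in> irr01" using elim(3) by (auto simp: irr01_def less_le)
      have ne: "(gauss_map ^^ n) x \<noteq> x0" for n
        using cf_eval_cf_word[OF x, of n] elim(2) by (metis rangeI)
      show "liminf (\<lambda>n. ereal (real n powr (1 / \<alpha>) * \<bar>(gauss_map ^^ n) x - x0\<bar>)) = 0"
      proof (subst liminf_ereal_eq_0_iff, simp, intro allI impI)
        fix e :: real and m :: nat assume e: "e > 0"
        \<comment> \<open>The orbit stays at least \<open>d > 0\<close> away from \<open>x0\<close>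
          before time \<open>m\<close>, so a hit within distance less than \<open>d\<close> must
          occur at a time \<open>n \<ge> m\<close>.\<close>
        define d where "d = Min (insert 1 ((\<lambda>n. \<bar>(gauss_map ^^ n) x - x0\<bar>) ` {..<m}))"
        have d: "d > 0" "\<And>n. n < m \<Longrightarrow> d \<le> \<bar>(gauss_map ^^ n) x - x0\<bar>"
          using ne by (auto simp: d_def)
        have "(\<lambda>k. (1/2::real) ^ k) \<longlonglongrightarrow> 0" by (intro LIMSEQ_power_zero) auto
        then have "eventually (\<lambda>k. (1/2::real) ^ k < d) sequentially"
          using d(1) by (rule order_tendstoD)
        moreover have "eventually (\<lambda>k. c k < e) sequentially" using c0 e by (rule order_tendstoD)
        ultimately have "eventually (\<lambda>k. (1/2::real) ^ k < d \<and> c k < e) sequentially"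
          by (rule eventually_conj)
        then obtain K where K: "\<And>k. k \<ge> K \<Longrightarrow> (1/2::real) ^ k < d \<and> c k < e"
          unfolding eventually_sequentially by blast
        obtain k where k: "k \<ge> K" "x \<notin> miss_set (w k) (j k)" using elim(1) by blast
        then obtain i where i: "i < j k" "(gauss_map ^^ (i * Suc k)) x \<in> cyl (w k)"
          using x by (auto simp: miss_set_def w_def)
        define n where "n = i * Suc k"
        let ?y = "(gauss_map ^^ n) x"
        have "\<bar>?y - x0\<bar> \<le> l k"
        proof -
          have "?y = cf_eval (w k) ((gauss_map ^^ Suc k) ?y)" "x0 = cf_eval (w k) ((gauss_map ^^ Suc k) x0)"
            using cyl_cf_eval[OF i(2)] cf_eval_cf_word[OF x0, of "Suc k"] by (simp_all add: w_def n_def del: funpow.simps)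
          moreover have "(gauss_map ^^ Suc k) ?y \<in> irr01" "(gauss_map ^^ Suc k) x0 \<in> irr01"
            using x x0 by (auto intro!: gauss_map_iter_irr01 simp del: funpow.simps)
          ultimately show ?thesis
            unfolding l_def using cf_eval_close[OF wpos[of k]] by (metis (no_types, lifting) Diff_iff greaterThanLessThan_iff atLeastAtMost_iff irr01_def less_imp_le)
        qed
        then have "\<bar>?y - x0\<bar> < d" using l(3)[of k] K[OF k(1)] by linarith
        then have "n \<ge> m" using d(2)[of n] by (force simp: not_less[symmetric])
        have "real n = real i * (real k + 1)" by (simp add: n_def algebra_simps)
        also have "\<dots> \<le> real (j k) * (real k + 1)" using i(1) by (intro mult_right_mono) auto
        also have "\<dots> \<le> (2 * (real k + 1) / l k) * (real k + 1)"
        proof (intro mult_right_mono)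
          have "real k / l k + 1 \<le> real k / l k + 1 / l k" using l[of k] by simp
          also have "\<dots> \<le> 2 * (real k + 1) / l k" using l[of k] by (simp add: field_simps)
          finally show "real (j k) \<le> 2 * (real k + 1) / l k" using jk(2)[of k] by linarith
        qed auto
        also have "\<dots> = 2 * (real k + 1) ^ 2 / l k" by (simp add: power2_eq_square algebra_simps)
        finally have n: "real n \<le> 2 * (real k + 1) ^ 2 / l k" .
        have "real n powr (1 / \<alpha>) * \<bar>?y - x0\<bar> \<le> (2 * (real k + 1) ^ 2 / l k) powr (1 / \<alpha>) * l k"
          using n \<alpha> \<open>\<bar>?y - x0\<bar> \<le> l k\<close> by (intro mult_mono powr_mono2) auto
        also have "\<dots> = (2 * (real k + 1) ^ 2) powr (1 / \<alpha>) * l k powr (1 - 1 / \<alpha>)"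
          using l[of k] by (simp add: powr_divide powr_diff)
        also have "\<dots> \<le> (2 * (real k + 1) ^ 2) powr 1 * ((1/2) ^ k) powr (1 - 1 / \<alpha>)"
        proof (intro mult_mono powr_mono powr_mono2)
          have "1 * 1 \<le> 2 * (real k + 1) ^ 2" by (intro mult_mono) auto
          then show "1 \<le> 2 * (real k + 1) ^ 2" by simp
        qed (use l[of k] \<alpha> in auto)
        also have "\<dots> = c k" by (simp add: c_def)
        also have "\<dots> < e" using K[OF k(1)] by simp
        finally show "\<exists>n\<ge>m. real n powr (1 / \<alpha>) * \<bar>(gauss_map ^^ n) x - x0\<bar> < e"
          using \<open>n \<ge> m\<close> by blast
      qed
    qed
  qed
  then show ?thesis by (rule AE_completion)
qed

text \<open>Targets of radius \<open>M * n powr (- 1 / \<alpha>)\<close> have summable lengths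
  because \<open>1 / \<alpha> > 1\<close>; letting \<open>M\<close> run through the naturals makes
  the lower limit infinite.\<close>

lemma AE_shrinking_target_infinite:
  assumes \<alpha>: "0 < \<alpha>" "\<alpha> < 1"
  shows "AE x\<in>{0..1} in lebesgue. liminf (\<lambda>n. ereal (real n powr (1 / \<alpha>) * \<bar>(gauss_map ^^ n) x - x0\<bar>)) = \<infinity>"
proof -
  have "AE x\<in>{0..1} in lebesgue. eventually (\<lambda>n. real M \<le> real n powr (1 / \<alpha>) * \<bar>(gauss_map ^^ n) x - x0\<bar>) sequentially"
    for M :: nat
  proof (rule gauss_borel_cantelli)
    let ?r = "\<lambda>n. real M * real n powr (- 1 / \<alpha>)"
    let ?A = "\<lambda>n. {x0 - ?r n..x0 + ?r n}"
    show "summable (\<lambda>n. 2 * ?r n)"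
      using \<alpha> by (intro summable_mult) (auto simp: summable_real_powr_iff field_simps)
    fix x assume "eventually (\<lambda>n. (gauss_map ^^ n) x \<notin> ?A n) sequentially"
    then show "eventually (\<lambda>n. real M \<le> real n powr (1 / \<alpha>) * \<bar>(gauss_map ^^ n) x - x0\<bar>) sequentially"
      using eventually_gt_at_top[of 0]
    proof eventually_elim
      case (elim n)
      then have "?r n \<le> \<bar>(gauss_map ^^ n) x - x0\<bar>" by auto
      then have "real n powr (1 / \<alpha>) * ?r n \<le> real n powr (1 / \<alpha>) * \<bar>(gauss_map ^^ n) x - x0\<bar>"
        by (intro mult_left_mono) auto
      moreover have "real n powr (1 / \<alpha>) * real n powr (- 1 / \<alpha>) = 1"
        using elim by (simp flip: powr_add)
      then have "real n powr (1 / \<alpha>) * ?r n = real M" by (simp add: mult.left_commute)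
      ultimately show ?case by linarith
    qed
  qed auto
  then have "AE x in lebesgue. \<forall>M::nat. x \<in> {0..1} \<longrightarrow>
      eventually (\<lambda>n. real M \<le> real n powr (1 / \<alpha>) * \<bar>(gauss_map ^^ n) x - x0\<bar>) sequentially"
    unfolding AE_all_countable by blast
  then show ?thesis
  proof eventually_elim
    case (elim x)
    show ?case
    proof
      assume "x \<in> {0..1}"
      then have "ereal (real M) \<le> liminf (\<lambda>n. ereal (real n powr (1 / \<alpha>) * \<bar>(gauss_map ^^ n) x - x0\<bar>))" for M
        using elim by (intro Liminf_bounded) auto
      then show "liminf (\<lambda>n. ereal (real n powr (1 / \<alpha>) * \<bar>(gauss_map ^^ n) x - x0\<bar>)) = \<infinity>"
        by (intro ereal_top) (meson ereal_less_eq(3) order_trans real_arch_simple)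
    qed
  qed
qed

lemma slow_cf_irr01: "slow_cf x \<Longrightarrow> x \<in> irr01"
  by (auto simp: slow_cf_def irr01_def less_le)

text \<open>The digit \<open>cf_digit x n\<close> is at most the inverse of the orbit point, and for
  each \<open>j\<close> a typical orbit enters \<open>{0..exp (- n / Suc j)}\<close> at only
  finitely many times \<open>n\<close>.\<close>

lemma AE_slow_cf: "AE x\<in>{0..1} in lebesgue. slow_cf x"
proof -
  have "AE x\<in>{0..1} in lebesgue. eventually (\<lambda>n. exp (- real n / real (Suc j)) \<le> (gauss_map ^^ n) x) sequentially" for j
  proof (rule gauss_borel_cantelli)
    have "summable (\<lambda>n. exp (- 1 / real (Suc j)) ^ n)" by (intro summable_geometric) auto
    then show "summable (\<lambda>n. exp (- real n / real (Suc j)))" by (simp flip: exp_of_nat_mult)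
    fix x :: real assume x: "x \<in> {0..1}"
      "eventually (\<lambda>n. (gauss_map ^^ n) x \<notin> {0..exp (- real n / real (Suc j))}) sequentially"
    show "eventually (\<lambda>n. exp (- real n / real (Suc j)) \<le> (gauss_map ^^ n) x) sequentially"
      using x(2) by eventually_elim (use gauss_map_iter_bounds[OF x(1)] in auto)
  qed auto
  then have "AE x in lebesgue. \<forall>j. x \<in> {0..1} \<longrightarrow>
      eventually (\<lambda>n. exp (- real n / real (Suc j)) \<le> (gauss_map ^^ n) x) sequentially"
    unfolding AE_all_countable by blast
  moreover have "AE x in lebesgue. x \<notin> (\<rat> :: real set)"
    by (intro AE_completion AE_lborel_countable countable_Rats_real)
  ultimately show ?thesis
  proof eventually_elim
    case (elim x)
    show ?case
    proof
      assume x01: "x \<in> {0..1}"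
      then have x: "x \<in> irr01" using elim(2) by (auto simp: irr01_def less_le)
      have "(\<lambda>n. ln (real_of_int (cf_digit x n))) \<in> o(\<lambda>n. real n)"
      proof (rule landau_o.smallI)
        fix c :: real assume c: "c > 0"
        obtain j where j: "1 / real (Suc j) < c" using c reals_Archimedean[of c] by (auto simp: inverse_eq_divide)
        have "eventually (\<lambda>n. exp (- real n / real (Suc j)) \<le> (gauss_map ^^ n) x) sequentially"
          using elim(1) x01 by blast
        then show "\<forall>\<^sub>F n in sequentially. norm (ln (real_of_int (cf_digit x n))) \<le> c * norm (real n)"
        proof eventually_elim
          case (elim n)
          let ?y = "(gauss_map ^^ n) x"
          have y: "0 < ?y" "?y < 1" using gauss_map_iter_irr01[OF x, of n] by (auto simp: irr01_def)
          have 1: "1 \<le> real_of_int (cf_digit x n)" using y by (simp add: cf_digit_def one_le_floor)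
          have "real_of_int (cf_digit x n) \<le> 1 / ?y" by (simp add: cf_digit_def)
          also have "\<dots> \<le> 1 / exp (- real n / real (Suc j))" using elim y by (intro divide_left_mono) auto
          also have "\<dots> = exp (real n / real (Suc j))" by (simp add: exp_minus field_simps)
          finally have "ln (real_of_int (cf_digit x n)) \<le> ln (exp (real n / real (Suc j)))"
            using 1 by (subst ln_le_cancel_iff) auto
          then have "ln (real_of_int (cf_digit x n)) \<le> real n / real (Suc j)" by (simp only: ln_exp)
          also have "\<dots> \<le> c * real n" using j mult_right_mono[of "1 / real (Suc j)" c "real n"] by simp
          finally show ?case using 1 by simp
        qed
      qed
      then show "slow_cf x" using x01 elim(2) by (simp add: slow_cf_def)
    qed
  qed
qed

section \<open>The pressure lower bound\<close>

definition gauss_lyapunov :: real where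
  "gauss_lyapunov = pi\<^sup>2 / (6 * ln 2)"

lemma gauss_lyapunov_pos: "0 < gauss_lyapunov"
  by (simp add: gauss_lyapunov_def)

section \<open>The Lyapunov exponent as an integral\<close>

lemma continuous_on_x_ln_x: "continuous_on {0..1} (\<lambda>x::real. x * ln x)"
proof -
  have "((\<lambda>x::real. x * ln x) \<longlongrightarrow> 0) (at_right 0)" by real_asymp
  moreover have "at (0::real) within {0..1} \<le> at_right 0"
  proof -
    have "at (0::real) within {0..1} = at 0 within {0<..1}"
      by (rule at_within_nhd[of _ UNIV]) auto
    also have "\<dots> \<le> at_right 0" by (rule at_le) auto
    finally show ?thesis .
  qed
  ultimately have "((\<lambda>x::real. x * ln x) \<longlongrightarrow> 0) (at 0 within {0..1})" by (rule tendsto_mono[rotated])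
  moreover have "continuous (at x within {0..1}) (\<lambda>x. x * ln x)" if "0 < x" for x :: real
    using that by (intro continuous_intros) auto
  ultimately show ?thesis
    unfolding continuous_on_eq_continuous_within continuous_within
    by (metis atLeastAtMost_iff less_eq_real_def mult_zero_left)
qed

lemma has_integral_power_ln:
  "((\<lambda>x::real. - (x ^ k * ln x)) has_integral 1 / (real k + 1)\<^sup>2) {0..1}"
proof -
  \<comment> \<open>The primitive from integration by parts; \<open>x * ln x\<close> is kept
    together for the sake of continuity at \<open>0\<close>.\<close>
  define F where "F x = x ^ Suc k / (real k + 1)\<^sup>2 - x ^ k * (x * ln x) / (real k + 1)" for x :: real
  have "((\<lambda>x. - (x ^ k * ln x)) has_integral F 1 - F 0) {0..1}"
  proof (rule fundamental_theorem_of_calculus_interior)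
    show "continuous_on {0..1} F"
      unfolding F_def by (intro continuous_intros continuous_on_x_ln_x) auto
    fix x :: real assume x: "x \<in> {0<..<1}"
    define K where "K = real k + 1"
    have K: "K > 0" by (simp add: K_def)
    have F: "F = (\<lambda>x. x ^ Suc k / K\<^sup>2 - x ^ Suc k * ln x / K)"
      by (auto simp: F_def K_def mult_ac)
    have 1: "((\<lambda>x. x ^ Suc k) has_real_derivative K * x ^ k) (at x)"
      using DERIV_pow[of "Suc k" x] by (simp add: K_def add.commute)
    have 2: "((\<lambda>x. x ^ Suc k * ln x) has_real_derivative K * x ^ k * ln x + 1 / x * x ^ Suc k) (at x)"
      using x by (intro DERIV_mult 1 DERIV_ln_divide) auto
    have "(F has_real_derivative (K * x ^ k / K\<^sup>2 - (K * x ^ k * ln x + 1 / x * x ^ Suc k) / K)) (at x)"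
      unfolding F by (intro DERIV_diff DERIV_cdivide 1 2)
    also have "K * x ^ k / K\<^sup>2 - (K * x ^ k * ln x + 1 / x * x ^ Suc k) / K = - (x ^ k * ln x)"
      using x K by (simp add: field_simps power2_eq_square)
    finally show "(F has_vector_derivative - (x ^ k * ln x)) (at x)"
      by (simp add: has_real_derivative_iff_has_vector_derivative)
  qed auto
  moreover have "F 1 - F 0 = 1 / (real k + 1)\<^sup>2" by (simp add: F_def)
  ultimately show ?thesis by simp
qed

text \<open>Reversing the sign of the terms with even denominator subtracts twice
  \<open>A m / 4\<close> from \<open>A (2 * m)\<close>, so the limit is half of
  \<open>pi^2 / 6\<close>.\<close>

lemma alternating_squares_tendsto:
  "(\<lambda>m. \<Sum>k<2 * m. (- 1) ^ k / (real k + 1)\<^sup>2) \<longlonglongrightarrow> pi\<^sup>2 / 12"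
proof -
  define A where "A n = (\<Sum>k<n. 1 / (real k + 1)\<^sup>2)" for n
  have A: "A \<longlonglongrightarrow> pi\<^sup>2 / 6"
    using inverse_squares_sums by (simp add: sums_def A_def[abs_def] add.commute)
  then have "(\<lambda>m. A (2 * m)) \<longlonglongrightarrow> pi\<^sup>2 / 6"
    by (rule filterlim_compose) (auto intro!: filterlim_subseq simp: strict_mono_def)
  then have "(\<lambda>m. A (2 * m) - A m / 2) \<longlonglongrightarrow> pi\<^sup>2 / 6 - pi\<^sup>2 / 6 / 2"
    using A by (intro tendsto_intros) auto
  moreover have "(\<Sum>k<2 * m. (- 1) ^ k / (real k + 1)\<^sup>2) = A (2 * m) - A m / 2" for m
  proof (induction m)
    case (Suc m)
    have "1 / (2 * real m + 2)\<^sup>2 = 1 / (real m + 1)\<^sup>2 / 4"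
      by (simp add: field_simps power2_eq_square)
    then show ?case using Suc by (simp add: A_def add.commute add_divide_distrib)
  qed (simp add: A_def)
  ultimately show ?thesis by simp
qed

lemma alternating_geometric_bounds:
  fixes x :: real
  assumes "0 \<le> x" "x \<le> 1"
  shows "0 \<le> (\<Sum>k<2 * m. (- 1) ^ k * x ^ k)" "(\<Sum>k<2 * m. (- 1) ^ k * x ^ k) \<le> 1 / (1 + x)"
proof -
  have "(\<Sum>k<2 * m. (- 1) ^ k * x ^ k) = (\<Sum>k<2 * m. (- x) ^ k)"
    by (simp add: power_minus[of x])
  also have "\<dots> = (1 - x ^ (2 * m)) / (1 + x)"
    using assms by (subst geometric_sum) (auto simp: field_simps)
  finally have *: "(\<Sum>k<2 * m. (- 1) ^ k * x ^ k) = (1 - x ^ (2 * m)) / (1 + x)" .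
  have "0 \<le> x ^ (2 * m)" "x ^ (2 * m) \<le> 1" using assms by (auto intro: power_le_one)
  then show "0 \<le> (\<Sum>k<2 * m. (- 1) ^ k * x ^ k)" "(\<Sum>k<2 * m. (- 1) ^ k * x ^ k) \<le> 1 / (1 + x)"
    unfolding * using assms by (auto intro!: divide_right_mono)
qed

text \<open>Replace \<open>1 / (1 + x)\<close> by partial sums of its alternating geometric series.
  With an even number of terms they are nonnegative and lie below, and integrating them termwise
  against \<open>- ln x\<close> gives the alternating sum of inverse squares, with limit
  \<open>pi^2 / 12\<close>.\<close>

lemma gauss_lyapunov_le_nn_integral:
  "ennreal gauss_lyapunov \<le> (\<integral>\<^sup>+x. ennreal (- 2 * ln x) \<partial>gauss_measure)"
proof -
  define S where "S m = (\<Sum>k<2 * m. (- 1) ^ k / (real k + 1)\<^sup>2)" for m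
  define f where "f m x = (\<Sum>k<2 * m. (- 1) ^ k * x ^ k) * (- ln x)" for m and x :: real
  have "ennreal (2 / ln 2 * S m) \<le> (\<integral>\<^sup>+x. ennreal (- 2 * ln x) \<partial>gauss_measure)" for m
  proof -
    have *: "((\<lambda>x. \<Sum>k<2 * m. (- 1) ^ k * (- (x ^ k * ln x))) has_integral S m) {0..1}"
      unfolding S_def using has_integral_mult_right[OF has_integral_power_ln]
      by (intro has_integral_sum) (auto simp: divide_inverse)
    have "((\<lambda>x. 2 / ln 2 * f m x) has_integral 2 / ln 2 * S m) {0..1}"
    proof (intro has_integral_mult_right)
      have "f m = (\<lambda>x. \<Sum>k<2 * m. (- 1) ^ k * (- (x ^ k * ln x)))"
        unfolding f_def sum_distrib_right by (intro ext sum.cong refl) simp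
      then show "(f m has_integral S m) {0..1}" using * by simp
    qed
    moreover have "f m x \<ge> 0" if "x \<in> {0..1}" for x
    proof -
      have "0 \<le> - ln x" using that by (cases "x = 0") auto
      then show ?thesis
        unfolding f_def using that by (intro mult_nonneg_nonneg alternating_geometric_bounds(1)) auto
    qed
    ultimately have "ennreal (2 / ln 2 * S m) = (\<integral>\<^sup>+x. ennreal (2 / ln 2 * f m x) * indicator {0..1} x \<partial>lborel)"
      by (subst nn_integral_has_integral_lebesgue'[where I = "2 / ln 2 * S m"]) auto
    also have "\<dots> \<le> (\<integral>\<^sup>+x. ennreal (indicator {0..1} x / ((1 + x) * ln 2)) * ennreal (- 2 * ln x) \<partial>lborel)"
    proof (rule nn_integral_mono)
      fix x :: real
      show "ennreal (2 / ln 2 * f m x) * indicator {0..1} x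
          \<le> ennreal (indicator {0..1} x / ((1 + x) * ln 2)) * ennreal (- 2 * ln x)"
      proof (cases "x \<in> {0..1}")
        case True
        then have l: "0 \<le> - ln x" by (cases "x = 0") auto
        have "f m x \<le> 1 / (1 + x) * (- ln x)"
          unfolding f_def using True l alternating_geometric_bounds(2)[of x m] by (intro mult_right_mono) auto
        then have "2 / ln 2 * f m x \<le> 2 / ln 2 * (1 / (1 + x) * (- ln x))"
          by (intro mult_left_mono) auto
        also have "\<dots> = 1 / ((1 + x) * ln 2) * (- 2 * ln x)" using True by (simp add: field_simps)
        finally have "ennreal (2 / ln 2 * f m x) \<le> ennreal (1 / ((1 + x) * ln 2) * (- 2 * ln x))"
          by (rule ennreal_leI)
        also have "\<dots> = ennreal (1 / ((1 + x) * ln 2)) * ennreal (- 2 * ln x)"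
          using True l by (intro ennreal_mult) auto
        finally show ?thesis using True by simp
      qed simp
    qed
    also have "\<dots> = (\<integral>\<^sup>+x. ennreal (- 2 * ln x) \<partial>gauss_measure)"
      by (subst nn_integral_gauss_measure) auto
    finally show ?thesis .
  qed
  moreover have "(\<lambda>m. ennreal (2 / ln 2 * S m)) \<longlonglongrightarrow> ennreal (2 / ln 2 * (pi\<^sup>2 / 12))"
    unfolding S_def by (intro tendsto_ennrealI tendsto_intros alternating_squares_tendsto)
  ultimately have "ennreal (2 / ln 2 * (pi\<^sup>2 / 12)) \<le> (\<integral>\<^sup>+x. ennreal (- 2 * ln x) \<partial>gauss_measure)"
    by (intro tendsto_upperbound[of _ _ sequentially]) auto
  then show ?thesis by (simp add: gauss_lyapunov_def field_simps)
qed

section \<open>From Birkhoff sums to sums over cylinders\<close>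

definition words :: "nat \<Rightarrow> nat \<Rightarrow> nat list set" where
  "words A n = {u. set u \<subseteq> {1..A} \<and> length u = n}"

lemma finite_words [simp]: "finite (words A n)"
  unfolding words_def by (rule finite_lists_length_eq) auto

lemma words_pos: "u \<in> words A n \<Longrightarrow> 0 \<notin> set u"
  by (auto simp: words_def)

lemma words_mono: "A \<le> B \<Longrightarrow> words A n \<subseteq> words B n"
  by (auto simp: words_def)

text \<open>At the actual tail of \<open>x\<close>, each factor \<open>a + cf_eval u y\<close> of
  the denominator is the inverse of a point of the orbit.\<close>

lemma ln_cf_den_cf_word:
  "x \<in> irr01 \<Longrightarrow> ln (cf_den (cf_word x n) ((gauss_map ^^ n) x)) = (\<Sum>i<n. - ln ((gauss_map ^^ i) x))"
proof (induction n arbitrary: x)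
  case (Suc n)
  let ?y = "gauss_map x" and ?z = "(gauss_map ^^ Suc n) x"
  have z: "?z = (gauss_map ^^ n) ?y" by (simp add: funpow_swap1)
  have y: "?y \<in> irr01" using Suc.prems gauss_map_irr01 by blast
  have x: "0 < x" using Suc.prems by (auto simp: irr01_def)
  have "1 / (real (nat \<lfloor>1 / x\<rfloor>) + cf_eval (cf_word ?y n) ?z) = x"
    using cf_eval_cf_word[OF Suc.prems, of "Suc n"] by (simp add: cf_word_Suc)
  then have e: "real (nat \<lfloor>1 / x\<rfloor>) + cf_eval (cf_word ?y n) ?z = 1 / x"
    by (metis div_by_1 divide_divide_eq_right mult_1)
  have "(gauss_map ^^ n) ?y \<in> irr01" using y gauss_map_iter_irr01 by blast
  then have "cf_den (cf_word ?y n) ?z \<ge> 1"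
    using cf_word_pos[OF y] unfolding z by (intro cf_den_ge_1) (auto simp: irr01_def)
  moreover have "cf_den (cf_word x (Suc n)) ?z = 1 / x * cf_den (cf_word ?y n) ?z"
    by (simp only: cf_word_Suc cf_den.simps e)
  ultimately have "ln (cf_den (cf_word x (Suc n)) ?z) = ln (1 / x) + ln (cf_den (cf_word ?y n) ?z)"
    using x by (simp only:) (rule ln_mult_pos, auto)
  also have "\<dots> = - ln x + (\<Sum>i<n. - ln ((gauss_map ^^ i) ?y))"
    using x Suc.IH[OF y] by (simp add: z ln_div del: funpow.simps)
  also have "\<dots> = (\<Sum>i<Suc n. - ln ((gauss_map ^^ i) x))"
    by (subst sum.lessThan_Suc_shift) (simp add: funpow_swap1)
  finally show ?case .
qed simp

text \<open>Jensen's inequality for the exponential, in the form \<open>e\<^sup>f \<ge> e\<^sup>m (1 + f - m)\<close>: only the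
  mean of the Birkhoff sums under the invariant measure enters, so no ergodicity is needed.\<close>

lemma nn_integral_exp_birkhoff:
  assumes "0 \<le> t"
  shows "ennreal (exp (t * real n * gauss_lyapunov)) \<le>
    (\<integral>\<^sup>+x. ennreal (exp (t * (\<Sum>i<n. - 2 * ln ((gauss_map ^^ i) x)))) \<partial>gauss_measure)"
proof -
  interpret prob_space gauss_measure by (rule prob_space_gauss_measure)
  define f where "f x = t * (\<Sum>i<n. - 2 * ln ((gauss_map ^^ i) x))" for x
  define m where "m = t * real n * gauss_lyapunov"
  have m: "m \<ge> 0" using assms gauss_lyapunov_pos by (simp add: m_def)
  have [measurable]: "f \<in> borel_measurable borel" unfolding f_def by measurable
  have nonneg: "0 \<le> - 2 * ln ((gauss_map ^^ i) x)" if "x \<in> {0..1}" for x i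
  proof -
    have "0 \<le> (gauss_map ^^ i) x" "(gauss_map ^^ i) x \<le> 1" using gauss_map_iter_bounds[OF that] by auto
    then show ?thesis by (cases "(gauss_map ^^ i) x = 0") auto
  qed
  have "ennreal m = (\<Sum>i<n. ennreal t * ennreal gauss_lyapunov)"
  proof -
    have "(\<Sum>i<n. ennreal t * ennreal gauss_lyapunov) = (\<Sum>i<n. ennreal (t * gauss_lyapunov))"
      using assms gauss_lyapunov_pos by (simp add: ennreal_mult)
    also have "\<dots> = ennreal (\<Sum>i<n. t * gauss_lyapunov)"
      using assms gauss_lyapunov_pos by (intro sum_ennreal) auto
    finally show ?thesis by (simp add: m_def mult_ac)
  qed
  also have "\<dots> \<le> (\<Sum>i<n. ennreal t * (\<integral>\<^sup>+x. ennreal (- 2 * ln ((gauss_map ^^ i) x)) \<partial>gauss_measure))"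
    using gauss_lyapunov_le_nn_integral nn_integral_gauss_map_iter[of "\<lambda>x. ennreal (- 2 * ln x)"]
    by (intro sum_mono mult_left_mono) auto
  also have "\<dots> = (\<integral>\<^sup>+x. ennreal t * (\<Sum>i<n. ennreal (- 2 * ln ((gauss_map ^^ i) x))) \<partial>gauss_measure)"
    by (subst nn_integral_cmult, simp, subst nn_integral_sum) (auto simp: sum_distrib_left)
  also have "\<dots> = (\<integral>\<^sup>+x. ennreal (f x) \<partial>gauss_measure)"
  proof (rule nn_integral_cong_AE, rule eventually_mono[OF AE_gauss_measure_01])
    fix x :: real assume x: "x \<in> {0..1}"
    show "ennreal t * (\<Sum>i<n. ennreal (- 2 * ln ((gauss_map ^^ i) x))) = ennreal (f x)"
    proof -
      have "(\<Sum>i<n. ennreal (- 2 * ln ((gauss_map ^^ i) x))) = ennreal (\<Sum>i<n. - 2 * ln ((gauss_map ^^ i) x))"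
        by (rule sum_ennreal) (rule nonneg[OF x])
      then show ?thesis
        unfolding f_def using sum_nonneg[of "{..<n}", OF nonneg[OF x]] assms
        by (simp only: ennreal_mult)
    qed
  qed
  finally have mf: "ennreal m \<le> (\<integral>\<^sup>+x. ennreal (f x) \<partial>gauss_measure)" .
  \<comment> \<open>The tangent inequality is integrated in the additive form
    \<open>exp m * (1 + f) \<le> exp f + exp m * m\<close>, which avoids subtraction in
    \<open>ennreal\<close>; the finite summand \<open>exp m * m\<close> is cancelled at the
    end.\<close>
  have "ennreal (exp m) + ennreal (exp m * m) = ennreal (exp m) * (1 + ennreal m)"
    using m by (simp add: ennreal_mult ring_distribs)
  also have "\<dots> \<le> ennreal (exp m) * (1 + (\<integral>\<^sup>+x. ennreal (f x) \<partial>gauss_measure))"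
    using mf by (intro mult_left_mono add_left_mono) auto
  also have "\<dots> = (\<integral>\<^sup>+x. ennreal (exp m) * (1 + ennreal (f x)) \<partial>gauss_measure)"
    using emeasure_space_1 by (subst nn_integral_cmult, simp, subst nn_integral_add) auto
  also have "\<dots> \<le> (\<integral>\<^sup>+x. ennreal (exp (f x)) + ennreal (exp m * m) \<partial>gauss_measure)"
  proof (rule nn_integral_mono_AE, rule eventually_mono[OF AE_gauss_measure_01])
    fix x :: real assume x: "x \<in> {0..1}"
    have f: "0 \<le> f x" unfolding f_def by (intro mult_nonneg_nonneg sum_nonneg nonneg[OF x] assms)
    have "exp m * (1 + (f x - m)) \<le> exp m * exp (f x - m)" by (intro mult_left_mono exp_ge_add_one_self) auto
    then have "exp m * (1 + f x) \<le> exp (f x) + exp m * m" by (simp add: algebra_simps flip: exp_add)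
    then have "ennreal (exp m * (1 + f x)) \<le> ennreal (exp (f x) + exp m * m)" by (rule ennreal_leI)
    moreover have "ennreal (exp m * (1 + f x)) = ennreal (exp m) * (1 + ennreal (f x))"
      using f by (subst ennreal_mult) (auto simp: ennreal_plus)
    moreover have "ennreal (exp (f x) + exp m * m) = ennreal (exp (f x)) + ennreal (exp m * m)"
      using m by (intro ennreal_plus) auto
    ultimately show "ennreal (exp m) * (1 + ennreal (f x)) \<le> ennreal (exp (f x)) + ennreal (exp m * m)" by simp
  qed
  also have "\<dots> = (\<integral>\<^sup>+x. ennreal (exp (f x)) \<partial>gauss_measure) + ennreal (exp m * m)"
    using emeasure_space_1 by (subst nn_integral_add) auto
  finally have "ennreal (exp m) \<le> (\<integral>\<^sup>+x. ennreal (exp (f x)) \<partial>gauss_measure)"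
    by (simp add: add.commute[of _ "ennreal (exp m * m)"] ennreal_add_left_cancel_le)
  then show ?thesis by (simp add: f_def m_def)
qed

text \<open>On \<open>cyl u\<close> the Birkhoff sum is \<open>ln (D * D)\<close>, where the
  denominator \<open>D\<close> at the actual tail satisfies
  \<open>D * D \<le> 4 / cyl_len u\<close>. The integrand is thus at most
  \<open>(4 / cyl_len u) powr t\<close>, on a set of mass at most
  \<open>cyl_len u / ln 2\<close>.\<close>

lemma nn_integral_exp_birkhoff_cyl:
  assumes u: "0 \<notin> set u" and t: "0 \<le> t" "t \<le> 1"
  shows "(\<integral>\<^sup>+x. ennreal (exp (t * (\<Sum>i<length u. - 2 * ln ((gauss_map ^^ i) x)))) * indicator (cyl u) x \<partial>gauss_measure)
    \<le> ennreal (4 / ln 2 * cyl_len u powr (1 - t))"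
proof -
  have "(\<integral>\<^sup>+x. ennreal (exp (t * (\<Sum>i<length u. - 2 * ln ((gauss_map ^^ i) x)))) * indicator (cyl u) x \<partial>gauss_measure)
      \<le> (\<integral>\<^sup>+x. ennreal ((4 / cyl_len u) powr t) * indicator (cyl u) x \<partial>gauss_measure)"
  proof (intro nn_integral_mono)
    fix x
    show "ennreal (exp (t * (\<Sum>i<length u. - 2 * ln ((gauss_map ^^ i) x)))) * indicator (cyl u) x
        \<le> ennreal ((4 / cyl_len u) powr t) * indicator (cyl u) x"
    proof (cases "x \<in> cyl u")
      case True
      then have x: "x \<in> irr01" "cf_word x (length u) = u" by (auto simp: cyl_def)
      define D where "D = cf_den u ((gauss_map ^^ length u) x)"
      have y: "(gauss_map ^^ length u) x \<in> {0..1}"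
        using gauss_map_iter_irr01[OF x(1), of "length u"] by (auto simp: irr01_def)
      have D1: "D \<ge> 1" unfolding D_def using cf_den_ge_1[OF u y] .
      have DD: "D * D \<le> 4 / cyl_len u" unfolding D_def using cf_den_prod_le[OF u y y] .
      have "(\<Sum>i<length u. - 2 * ln ((gauss_map ^^ i) x)) = 2 * ln D"
        using ln_cf_den_cf_word[OF x(1), of "length u"] x(2)
        by (simp add: D_def sum_distrib_left[symmetric] sum_negf)
      also have "\<dots> = ln (D * D)" using D1 by (simp add: ln_mult)
      finally have "exp (t * (\<Sum>i<length u. - 2 * ln ((gauss_map ^^ i) x))) = (D * D) powr t"
        using D1 by (simp add: powr_def)
      also have "\<dots> \<le> (4 / cyl_len u) powr t" using DD D1 t by (intro powr_mono2) auto
      finally show ?thesis using True by (simp add: ennreal_leI)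
    qed simp
  qed
  also have "\<dots> = ennreal ((4 / cyl_len u) powr t) * emeasure gauss_measure (cyl u)"
    by (subst nn_integral_cmult_indicator) auto
  also have "\<dots> \<le> ennreal ((4 / cyl_len u) powr t) * (ennreal (1 / ln 2) * ennreal (cyl_len u))"
    using emeasure_gauss_measure_le[OF sets_cyl, of u] emeasure_cyl[OF u] by (intro mult_left_mono) auto
  also have "\<dots> = ennreal ((4 / cyl_len u) powr t * (1 / ln 2 * cyl_len u))"
    using cyl_len_pos[OF u] by (simp flip: ennreal_mult)
  also have "\<dots> \<le> ennreal (4 / ln 2 * cyl_len u powr (1 - t))"
  proof (rule ennreal_leI)
    have "(4 / cyl_len u) powr t * (1 / ln 2 * cyl_len u) = 4 powr t / ln 2 * cyl_len u powr (1 - t)"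
      using cyl_len_pos[OF u] by (simp add: powr_divide powr_diff)
    also have "\<dots> \<le> 4 / ln 2 * cyl_len u powr (1 - t)"
      using powr_mono[of t 1 4] t by (intro mult_right_mono divide_right_mono) auto
    finally show "(4 / cyl_len u) powr t * (1 / ln 2 * cyl_len u) \<le> 4 / ln 2 * cyl_len u powr (1 - t)" .
  qed
  finally show ?thesis .
qed

text \<open>As \<open>A\<close> grows, the cylinders with digits at most \<open>A\<close> exhaust
  almost every point, so by monotone convergence a finite alphabet already carries more than half of
  the Jensen bound. This half and the factor \<open>ln 2 / 4\<close> of
  \<open>nn_integral_exp_birkhoff_cyl\<close> make \<open>ln 2 / 8\<close>. The threshold
  \<open>A0\<close> depends on \<open>n\<close>.\<close>

lemma word_sum_lower:
  assumes s: "0 < s" "s < 1"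
  obtains A0 where "\<And>A. A0 \<le> A \<Longrightarrow>
    ln 2 / 8 * exp ((1 - s) * real n * gauss_lyapunov) \<le> (\<Sum>u\<in>words A n. cyl_len u powr s)"
proof -
  define g where "g x = ennreal (exp ((1 - s) * (\<Sum>i<n. - 2 * ln ((gauss_map ^^ i) x))))" for x
  define E where "E = exp ((1 - s) * real n * gauss_lyapunov)"
  define C where "C A = (\<Union>u\<in>words A n. cyl u)" for A
  have [measurable]: "g \<in> borel_measurable borel" unfolding g_def by measurable
  have [measurable]: "C A \<in> sets borel" for A
    unfolding C_def by (intro sets.finite_UN) auto
  have bound: "(\<integral>\<^sup>+x. g x * indicator (C A) x \<partial>gauss_measure) \<le> ennreal (4 / ln 2 * (\<Sum>u\<in>words A n. cyl_len u powr s))" for A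
  proof -
    have "(\<integral>\<^sup>+x. g x * indicator (C A) x \<partial>gauss_measure)
        \<le> (\<integral>\<^sup>+x. (\<Sum>u\<in>words A n. g x * indicator (cyl u) x) \<partial>gauss_measure)"
    proof (intro nn_integral_mono)
      fix x
      show "g x * indicator (C A) x \<le> (\<Sum>u\<in>words A n. g x * indicator (cyl u) x)"
      proof (cases "x \<in> C A")
        case True
        then obtain u where "u \<in> words A n" "x \<in> cyl u" by (auto simp: C_def)
        then show ?thesis
          using True member_le_sum[of u "words A n" "\<lambda>u. g x * indicator (cyl u) x"] by simp
      qed simp
    qed
    also have "\<dots> = (\<Sum>u\<in>words A n. \<integral>\<^sup>+x. g x * indicator (cyl u) x \<partial>gauss_measure)"
      by (intro nn_integral_sum) auto
    also have "\<dots> \<le> (\<Sum>u\<in>words A n. ennreal (4 / ln 2 * cyl_len u powr s))"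
    proof (intro sum_mono)
      fix u assume "u \<in> words A n"
      then show "(\<integral>\<^sup>+x. g x * indicator (cyl u) x \<partial>gauss_measure) \<le> ennreal (4 / ln 2 * cyl_len u powr s)"
        using nn_integral_exp_birkhoff_cyl[OF words_pos, of u A n "1 - s"] s by (simp add: g_def words_def)
    qed
    also have "\<dots> = ennreal (4 / ln 2 * (\<Sum>u\<in>words A n. cyl_len u powr s))"
      by (subst sum_ennreal) (auto simp: sum_distrib_left)
    finally show ?thesis .
  qed
  have "ennreal (E / 2) < ennreal E" by (intro ennreal_lessI) (auto simp: E_def)
  also have "\<dots> \<le> (\<integral>\<^sup>+x. g x \<partial>gauss_measure)"
    unfolding E_def g_def using s by (intro nn_integral_exp_birkhoff) auto
  also have "\<dots> = (\<integral>\<^sup>+x. (SUP A. g x * indicator (C A) x) \<partial>gauss_measure)"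
  proof (rule nn_integral_cong_AE)
    have "AE x in lborel. x \<notin> (\<rat> :: real set)" by (intro AE_lborel_countable countable_Rats_real)
    then have "AE x in gauss_measure. x \<in> irr01"
      by (subst AE_gauss_measure) (auto simp: irr01_def less_le elim!: eventually_mono)
    then show "AE x in gauss_measure. g x = (SUP A. g x * indicator (C A) x)"
    proof eventually_elim
      case (elim x)
      obtain A where A: "set (cf_word x n) \<subseteq> {..A}"
        using finite_nat_iff_bounded_le[of "set (cf_word x n)"] by auto
      then have "x \<in> C A"
        using cf_word_in_cyl[OF elim, of n] cf_word_pos[OF elim, of n]
        by (fastforce simp: C_def words_def Suc_le_eq intro: gr0I)
      then have "g x \<le> (SUP A. g x * indicator (C A) x)" by (intro SUP_upper2[of A]) auto
      moreover have "(SUP A. g x * indicator (C A) x) \<le> g x"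
        by (intro SUP_least) (auto split: split_indicator)
      ultimately show ?case by (rule antisym)
    qed
  qed
  also have "\<dots> = (SUP A. \<integral>\<^sup>+x. g x * indicator (C A) x \<partial>gauss_measure)"
  proof (rule nn_integral_monotone_convergence_SUP)
    show "incseq (\<lambda>A x. g x * indicator (C A) x)"
      using words_mono by (fastforce simp: incseq_def le_fun_def C_def intro!: mult_left_mono split: split_indicator)
  qed measurable
  finally obtain A0 where "ennreal (E / 2) < (\<integral>\<^sup>+x. g x * indicator (C A0) x \<partial>gauss_measure)"
    by (auto simp: less_SUP_iff)
  also note bound[of A0]
  finally have "E / 2 < 4 / ln 2 * (\<Sum>u\<in>words A0 n. cyl_len u powr s)"
    by (subst (asm) ennreal_less_iff) (auto simp: E_def)
  then have A0: "ln 2 / 8 * E \<le> (\<Sum>u\<in>words A0 n. cyl_len u powr s)" by (simp add: field_simps)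
  show ?thesis
  proof (rule that)
    fix A assume "A0 \<le> A"
    then have "(\<Sum>u\<in>words A0 n. cyl_len u powr s) \<le> (\<Sum>u\<in>words A n. cyl_len u powr s)"
      by (intro sum_mono2 words_mono) auto
    then show "ln 2 / 8 * exp ((1 - s) * real n * gauss_lyapunov) \<le> (\<Sum>u\<in>words A n. cyl_len u powr s)"
      using A0 by (simp add: E_def)
  qed
qed

section \<open>Hausdorff measure and dimension\<close>

text \<open>Stated for the law of a random point \<open>X\<close>. Covering sets need not be
  measurable, so \<open>U i\<close> is replaced by the event \<open>B i\<close> that
  \<open>X\<close> is within \<open>diameter (U i)\<close> of one chosen value of \<open>X\<close>
  in \<open>U i\<close>; hence the ball condition is needed only around values of
  \<open>X\<close>.\<close>

lemma mass_distribution_principle: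
  fixes X :: "'w \<Rightarrow> real"
  assumes "prob_space M" and X[measurable]: "X \<in> borel_measurable M"
    and A: "\<And>w. w \<in> space M \<Longrightarrow> X w \<in> A" and s: "0 < s" and C: "0 < C"
    and ball: "\<And>w r. w \<in> space M \<Longrightarrow> 0 < r \<Longrightarrow> measure M {v \<in> space M. \<bar>X v - X w\<bar> \<le> r} \<le> C * r powr s"
  shows "hausdorff_measure s A \<noteq> 0"
proof -
  interpret prob_space M by fact
  have "ennreal (1 / C) \<le> (\<Sum>i. diam_weight s (U i))"
    if U: "A \<subseteq> (\<Union>i. U i)" "\<And>i. bounded (U i)" for U :: "nat \<Rightarrow> real set"
  proof -
    define c where "c i = (SOME w. w \<in> space M \<and> X w \<in> U i)" for i
    define B where "B i = (if \<exists>w\<in>space M. X w \<in> U i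
      then {v \<in> space M. \<bar>X v - X (c i)\<bar> \<le> diameter (U i)} else {})" for i
    have c: "c i \<in> space M \<and> X (c i) \<in> U i" if "w \<in> space M" "X w \<in> U i" for w i
      unfolding c_def by (rule someI[of _ w]) (use that in auto)
    have [measurable]: "B i \<in> events" for i
    proof (cases "\<exists>w\<in>space M. X w \<in> U i")
      case True
      have "{v \<in> space M. \<bar>X v - X (c i)\<bar> \<le> diameter (U i)} \<in> events" by measurable
      then show ?thesis unfolding B_def if_P[OF True] .
    qed (simp add: B_def)
    have le: "emeasure M (B i) \<le> ennreal C * diam_weight s (U i)" for i
    proof (cases "\<exists>w\<in>space M. X w \<in> U i")
      case True
      then have ci: "c i \<in> space M" "X (c i) \<in> U i" using c by blast+
      have d: "diameter (U i) \<ge> 0" using U(2) by (rule diameter_ge_0)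
      have "measure M (B i) \<le> C * diameter (U i) powr s"
      proof (cases "diameter (U i) = 0")
        \<comment> \<open>The ball condition speaks of positive radii, so a one-point set is treated
          by letting \<open>r\<close> tend to \<open>0\<close>.\<close>
        case True
        have "measure M (B i) \<le> C * r powr s" if "r > 0" for r
        proof -
          have "measure M (B i) \<le> measure M {v \<in> space M. \<bar>X v - X (c i)\<bar> \<le> r}"
            using that True by (intro finite_measure_mono) (auto simp: B_def)
          then show ?thesis using ball[OF ci(1) that] by linarith
        qed
        then have "eventually (\<lambda>r. measure M (B i) \<le> C * r powr s) (at_right 0)"
          by (auto simp: eventually_at_right_less elim!: eventually_mono intro: eventually_mono[OF eventually_at_right_less])
        moreover have "((\<lambda>r. C * r powr s) \<longlongrightarrow> C * 0 powr s) (at_right 0)"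
          using s by (intro tendsto_intros tendsto_powr2) (auto simp: eventually_at_right_less intro: eventually_mono[OF eventually_at_right_less])
        ultimately have "measure M (B i) \<le> C * 0 powr s"
          by (intro tendsto_lowerbound[of _ _ "at_right (0::real)"]) auto
        then show ?thesis using True by simp
      next
        case False
        then show ?thesis using d ball[OF ci(1), of "diameter (U i)"] True by (simp add: B_def)
      qed
      then have "emeasure M (B i) \<le> ennreal (C * diameter (U i) powr s)"
        by (simp add: emeasure_eq_measure ennreal_leI)
      also have "\<dots> = ennreal C * diam_weight s (U i)"
        using ci(2) s C by (auto simp: diam_weight_def ennreal_mult)
      finally show ?thesis .
    qed (simp add: B_def)
    have "space M \<subseteq> (\<Union>i. B i)"
    proof
      fix w assume w: "w \<in> space M"
      then obtain i where i: "X w \<in> U i" using A[OF w] U(1) by blast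
      then have "dist (X w) (X (c i)) \<le> diameter (U i)"
        using c[OF w i] by (intro diameter_bounded_bound U(2)) auto
      then show "w \<in> (\<Union>i. B i)" using w i by (auto simp: B_def dist_real_def)
    qed
    then have "1 \<le> emeasure M (\<Union>i. B i)"
      using emeasure_mono[of "space M" "\<Union>i. B i" M] by (simp add: emeasure_space_1)
    also have "\<dots> \<le> (\<Sum>i. emeasure M (B i))" by (intro emeasure_subadditive_countably) auto
    also have "\<dots> \<le> (\<Sum>i. ennreal C * diam_weight s (U i))" by (intro suminf_le le) auto
    also have "\<dots> = ennreal C * (\<Sum>i. diam_weight s (U i))" by simp
    finally have "ennreal (1 / C) * 1 \<le> ennreal (1 / C) * (ennreal C * (\<Sum>i. diam_weight s (U i)))"
      by (rule mult_left_mono) simp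
    also have "\<dots> = (\<Sum>i. diam_weight s (U i))"
      using C by (simp add: mult.assoc[symmetric] ennreal_mult[symmetric])
    finally show ?thesis by simp
  qed
  then have "ennreal (1 / C) \<le> hausdorff_premeasure s 1 A"
    unfolding hausdorff_premeasure_def by (intro INF_greatest) auto
  also have "\<dots> \<le> hausdorff_measure s A" unfolding hausdorff_measure_def by (intro SUP_upper) auto
  finally show ?thesis using C by auto
qed

lemma hausdorff_measure_empty: "hausdorff_measure s {} = 0"
proof -
  have "hausdorff_premeasure s \<delta> ({} :: 'a::metric_space set) \<le> 0" if "0 < \<delta>" for \<delta>
  proof -
    have "hausdorff_premeasure s \<delta> ({} :: 'a set) \<le> (\<Sum>i. diam_weight s ((\<lambda>_. {}) i :: 'a set))"
      unfolding hausdorff_premeasure_def using that by (intro INF_lower) auto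
    then show ?thesis by (simp add: diam_weight_def)
  qed
  then have "hausdorff_measure s ({} :: 'a set) \<le> 0"
    unfolding hausdorff_measure_def by (intro SUP_least) auto
  then show ?thesis by simp
qed

lemma hausdorff_measure_0_nonempty:
  assumes "A \<noteq> {}"
  shows "hausdorff_measure 0 A \<noteq> 0"
proof -
  have "1 \<le> (\<Sum>i. diam_weight 0 (U i))" if "A \<subseteq> (\<Union>i. U i)" for U :: "nat \<Rightarrow> 'a set"
  proof -
    obtain i where "U i \<noteq> {}" using assms \<open>A \<subseteq> _\<close> by blast
    then have "1 = sum (\<lambda>i. diam_weight 0 (U i)) {i}" by (simp add: diam_weight_def)
    also have "\<dots> \<le> (\<Sum>i. diam_weight 0 (U i))" by (rule sum_le_suminf) auto
    finally show ?thesis .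
  qed
  then have "1 \<le> hausdorff_premeasure 0 1 A"
    unfolding hausdorff_premeasure_def by (intro INF_greatest) auto
  also have "\<dots> \<le> hausdorff_measure 0 A" unfolding hausdorff_measure_def by (intro SUP_upper) auto
  finally show ?thesis by auto
qed

lemma hausdorff_dim_geI:
  assumes "\<And>s. 0 \<le> s \<Longrightarrow> s < d \<Longrightarrow> hausdorff_measure s A \<noteq> 0"
  shows "ereal d \<le> hausdorff_dim A"
  unfolding hausdorff_dim_def using assms by (intro INF_greatest) (auto simp: not_less[symmetric])

lemma hausdorff_measure_mono:
  assumes "A \<subseteq> B"
  shows "hausdorff_measure s A \<le> hausdorff_measure s B"
  unfolding hausdorff_measure_def hausdorff_premeasure_def
  using assms by (intro SUP_mono') (intro INF_superset_mono, auto)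

lemma hausdorff_dim_mono:
  assumes "A \<subseteq> B"
  shows "hausdorff_dim A \<le> hausdorff_dim B"
proof -
  have "hausdorff_measure s A = 0" if "hausdorff_measure s B = 0" for s
    using hausdorff_measure_mono[OF assms, of s] that by simp
  then show ?thesis unfolding hausdorff_dim_def by (intro INF_superset_mono) auto
qed

text \<open>A cover by \<open>N\<close> intervals of length \<open>1 / N\<close> has total weight
  \<open>N powr (1 - s)\<close>, which tends to \<open>0\<close>.\<close>

lemma hausdorff_measure_unit_interval:
  assumes s: "1 < s"
  shows "hausdorff_measure s {0..1::real} = 0"
proof -
  have "hausdorff_premeasure s \<delta> {0..1::real} \<le> 0" if \<delta>: "0 < \<delta>" for \<delta>
  proof -
    have "hausdorff_premeasure s \<delta> {0..1::real} \<le> ennreal (real (Suc N) powr (1 - s))"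
      if N: "1 / real (Suc N) \<le> \<delta>" for N
    proof -
      define U where "U i = (if i < Suc N then {real i / real (Suc N)..(real i + 1) / real (Suc N)} else {})" for i
      have dU: "i < Suc N \<Longrightarrow> diameter (U i) = 1 / real (Suc N)" "i \<ge> Suc N \<Longrightarrow> U i = {}" for i
      proof -
        have "real i / real (Suc N) \<le> (real i + 1) / real (Suc N)" by (intro divide_right_mono) auto
        moreover have "(real i + 1) / real (Suc N) - real i / real (Suc N) = 1 / real (Suc N)"
          by (simp flip: diff_divide_distrib)
        ultimately show "i < Suc N \<Longrightarrow> diameter (U i) = 1 / real (Suc N)" "i \<ge> Suc N \<Longrightarrow> U i = {}"
          unfolding U_def by (auto simp only: diameter_closed_interval if_True if_False not_less[symmetric])
      qed
      have "{0..1} \<subseteq> (\<Union>i. U i)"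
      proof
        fix x :: real assume x: "x \<in> {0..1}"
        show "x \<in> (\<Union>i. U i)"
        proof (cases "x = 1")
          case True
          then show ?thesis by (auto simp: U_def intro!: exI[of _ N])
        next
          case False
          define i where "i = nat \<lfloor>x * real (Suc N)\<rfloor>"
          have p: "0 \<le> x * real (Suc N)" "x * real (Suc N) < real (Suc N)" using x False by auto
          then have i: "real i \<le> x * real (Suc N)" "x * real (Suc N) < real i + 1" unfolding i_def by linarith+
          then have "i < Suc N" using p by linarith
          moreover have "real i / real (Suc N) \<le> x" using i(1) by (subst pos_divide_le_eq) auto
          moreover have "x \<le> (real i + 1) / real (Suc N)" using i(2) by (subst pos_le_divide_eq) auto
          ultimately show ?thesis by (auto simp: U_def)
        qed
      qed
      moreover have "bounded (U i) \<and> diameter (U i) \<le> \<delta>" for i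
        using N \<delta> dU[of i] by (cases "i < Suc N") (auto simp: U_def)
      ultimately have "hausdorff_premeasure s \<delta> {0..1::real} \<le> (\<Sum>i. diam_weight s (U i))"
        unfolding hausdorff_premeasure_def by (intro INF_lower) auto
      also have "\<dots> = (\<Sum>i<Suc N. diam_weight s (U i))"
        by (rule suminf_finite) (auto simp: diam_weight_def dU)
      also have "\<dots> \<le> (\<Sum>i<Suc N. ennreal ((1 / real (Suc N)) powr s))"
        using s by (intro sum_mono) (auto simp: diam_weight_def dU)
      also have "\<dots> = ennreal (real (Suc N) * (1 / real (Suc N)) powr s)"
        by (subst sum_ennreal) auto
      also have "real (Suc N) * (1 / real (Suc N)) powr s = real (Suc N) powr (1 - s)"
        by (simp add: powr_divide powr_diff)
      finally show ?thesis .
    qed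
    moreover have "eventually (\<lambda>N. 1 / real (Suc N) \<le> \<delta>) sequentially"
    proof -
      have "(\<lambda>N. 1 / real (Suc N)) \<longlonglongrightarrow> 0" by real_asymp
      then have "eventually (\<lambda>N. 1 / real (Suc N) < \<delta>) sequentially" using \<delta> by (rule order_tendstoD)
      then show ?thesis by eventually_elim simp
    qed
    ultimately have "eventually (\<lambda>N. hausdorff_premeasure s \<delta> {0..1::real} \<le> ennreal (real (Suc N) powr (1 - s))) sequentially"
      by (auto elim!: eventually_mono)
    moreover have "(\<lambda>N. ennreal (real (Suc N) powr (1 - s))) \<longlonglongrightarrow> ennreal 0"
    proof (rule tendsto_ennrealI)
      have "filterlim (\<lambda>N. real (Suc N)) at_top sequentially" by real_asymp
      then show "(\<lambda>N. real (Suc N) powr (1 - s)) \<longlonglongrightarrow> 0" using s by (intro tendsto_neg_powr) auto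
    qed
    ultimately have "hausdorff_premeasure s \<delta> {0..1::real} \<le> ennreal 0"
      by (intro tendsto_lowerbound[of _ _ sequentially]) auto
    then show ?thesis by simp
  qed
  then have "hausdorff_measure s {0..1::real} \<le> 0"
    unfolding hausdorff_measure_def by (intro SUP_least) auto
  then show ?thesis by simp
qed

lemma hausdorff_dim_le_1:
  assumes "A \<subseteq> {0..1::real}"
  shows "hausdorff_dim A \<le> 1"
proof -
  have "hausdorff_dim A \<le> ereal s" if "1 < s" for s
    unfolding hausdorff_dim_def
    using that hausdorff_measure_mono[OF assms, of s] by (intro INF_lower) (simp add: hausdorff_measure_unit_interval)
  then have "hausdorff_dim A \<le> 1 + ereal e" if "0 < e" for e
    using that by (simp add: one_ereal_def)
  then show ?thesis by (rule ereal_le_epsilon2)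
qed

section \<open>Random continued fractions\<close>

definition cf_lim :: "(nat \<Rightarrow> nat list) \<Rightarrow> real" where
  "cf_lim \<sigma> = lim (\<lambda>m. cf_eval (concat (map \<sigma> [0..<m])) 0)"

lemma set_concat_prefix:
  "(\<And>i. 0 \<notin> set (\<sigma> i)) \<Longrightarrow> 0 \<notin> set (concat (map \<sigma> [0..<m]))"
  by auto

lemma length_concat_ge:
  assumes "\<And>i. \<sigma> i \<noteq> []"
  shows "m \<le> length (concat (map \<sigma> [0..<m]))"
proof (induction m)
  case (Suc m)
  have "length (\<sigma> m) \<ge> 1" using assms[of m] by (cases "\<sigma> m") auto
  then show ?case using Suc by simp
qed simp

lemma concat_prefix_add:
  "concat (map \<sigma> [0..<m + n]) = concat (map \<sigma> [0..<m]) @ concat (map (\<lambda>i. \<sigma> (m + i)) [0..<n])"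
  by (induction n) auto

context
  fixes \<sigma> :: "nat \<Rightarrow> nat list"
  assumes nonempty: "\<And>i. \<sigma> i \<noteq> []" and pos: "\<And>i. 0 \<notin> set (\<sigma> i)"
begin

lemma cf_lim_LIMSEQ: "(\<lambda>m. cf_eval (concat (map \<sigma> [0..<m])) 0) \<longlonglongrightarrow> cf_lim \<sigma>"
proof -
  let ?f = "\<lambda>m. cf_eval (concat (map \<sigma> [0..<m])) 0"
  have close: "\<bar>?f (m + n) - ?f m\<bar> \<le> 2 * (1/2) ^ m" for m n
  proof -
    let ?u = "concat (map \<sigma> [0..<m])" and ?v = "concat (map (\<lambda>i. \<sigma> (m + i)) [0..<n])"
    have p: "0 \<notin> set ?u" "0 \<notin> set ?v" using pos by auto
    have "\<bar>?f (m + n) - ?f m\<bar> = \<bar>cf_eval ?u (cf_eval ?v 0) - cf_eval ?u 0\<bar>"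
      by (simp only: concat_prefix_add cf_eval_append)
    also have "\<dots> \<le> cyl_len ?u" using p cf_eval_bounds[OF p(2), of 0] by (intro cf_eval_close) auto
    also have "\<dots> \<le> 2 * (1/2) ^ length ?u" by (rule cyl_len_decay[OF p(1)])
    also have "\<dots> \<le> 2 * (1/2) ^ m"
      using length_concat_ge[of \<sigma> m] nonempty by (intro mult_left_mono power_decreasing) auto
    finally show ?thesis .
  qed
  have "Cauchy ?f"
  proof (rule metric_CauchyI)
    fix e :: real assume e: "0 < e"
    obtain M where "(1/2::real) ^ M < e / 4" using real_arch_pow_inv[of "e / 4" "1/2"] e by auto
    then have M: "2 * (1/2::real) ^ M < e / 2" by simp
    have d: "\<bar>?f m - ?f M\<bar> < e / 2" if "m \<ge> M" for m
      using close[of M "m - M"] that M by simp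
    have "dist (?f m) (?f n) < e" if "m \<ge> M" "n \<ge> M" for m n
      using d[OF that(1)] d[OF that(2)] unfolding dist_real_def by linarith
    then show "\<exists>M. \<forall>m\<ge>M. \<forall>n\<ge>M. dist (?f m) (?f n) < e" by blast
  qed
  then show ?thesis
    unfolding cf_lim_def by (simp add: Cauchy_convergent_iff convergent_LIMSEQ_iff)
qed

lemma cf_lim_bounds: "cf_lim \<sigma> \<in> {0..1}"
proof -
  have "cf_eval (concat (map \<sigma> [0..<m])) 0 \<in> {0..1}" for m
    by (intro cf_eval_bounds set_concat_prefix pos) simp
  then have "eventually (\<lambda>m. cf_eval (concat (map \<sigma> [0..<m])) 0 \<in> {0..1}) sequentially"
    by (intro always_eventually allI)
  from Lim_in_closed_set[OF closed_atLeastAtMost this _ cf_lim_LIMSEQ] show ?thesis by simp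
qed

end

lemma cf_lim_shift:
  assumes "\<And>i. \<sigma> i \<noteq> []" "\<And>i. 0 \<notin> set (\<sigma> i)"
  shows "cf_lim \<sigma> = cf_eval (concat (map \<sigma> [0..<m])) (cf_lim (\<lambda>i. \<sigma> (m + i)))"
proof -
  let ?u = "concat (map \<sigma> [0..<m])" and ?v = "\<lambda>n. concat (map (\<lambda>i. \<sigma> (m + i)) [0..<n])"
  have p: "0 \<notin> set ?u" "0 \<notin> set (?v n)" for n using assms by auto
  have "(\<lambda>n. cf_eval (concat (map \<sigma> [0..<n + m])) 0) \<longlonglongrightarrow> cf_lim \<sigma>"
    using cf_lim_LIMSEQ[of \<sigma>, OF assms] by (rule LIMSEQ_ignore_initial_segment)
  moreover have "cf_eval (concat (map \<sigma> [0..<n + m])) 0 = cf_eval ?u (cf_eval (?v n) 0)" for n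
    by (simp only: add.commute[of n m] concat_prefix_add cf_eval_append)
  moreover have "(\<lambda>n. cf_eval ?u (cf_eval (?v n) 0)) \<longlonglongrightarrow> cf_eval ?u (cf_lim (\<lambda>i. \<sigma> (m + i)))"
    using cf_eval_bounds[OF p(2), of 0]
    by (intro continuous_on_tendsto_compose[OF continuous_on_cf_eval[OF p(1)]] cf_lim_LIMSEQ cf_lim_bounds assms) auto
  ultimately show ?thesis using LIMSEQ_unique by fastforce
qed

text \<open>Lying strictly inside the unit interval is what \<open>gauss_map_iter_cf_eval\<close>
  asks of a tail. The bound below \<open>1\<close> holds because the first digit is at least
  \<open>1\<close> and what follows it is positive; if the first piece is a single digit, this uses
  the positivity of the limit of the remaining pieces.\<close>

lemma cf_lim_open:
  assumes "\<And>i. \<sigma> i \<noteq> []" "\<And>i. 0 \<notin> set (\<sigma> i)"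
  shows "0 < cf_lim \<sigma>" "cf_lim \<sigma> < 1"
proof -
  have 1: "0 < cf_lim \<tau>" if t: "\<And>i. \<tau> i \<noteq> []" "\<And>i. 0 \<notin> set (\<tau> i)" for \<tau>
  proof -
    obtain a u where u: "\<tau> 0 = a # u" "0 \<notin> set u" "a \<noteq> 0" using t[of 0] by (cases "\<tau> 0") auto
    have "cf_lim (\<lambda>i. \<tau> (1 + i)) \<in> {0..1}" by (intro cf_lim_bounds t)
    then have "0 \<le> cf_eval u (cf_lim (\<lambda>i. \<tau> (1 + i)))" using cf_eval_bounds[OF u(2)] by auto
    then show ?thesis using cf_lim_shift[of \<tau> 1, OF t] u by (auto intro!: add_pos_nonneg)
  qed
  show "0 < cf_lim \<sigma>" by (intro 1 assms)
  obtain a u where u: "\<sigma> 0 = a # u" "0 \<notin> set u" "a \<noteq> 0" using assms[of 0] by (cases "\<sigma> 0") auto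
  let ?z = "cf_lim (\<lambda>i. \<sigma> (1 + i))"
  have z: "0 < ?z" "?z \<le> 1" using 1[of "\<lambda>i. \<sigma> (1 + i)"] cf_lim_bounds[of "\<lambda>i. \<sigma> (1 + i)"] assms by auto
  have "0 < cf_eval u ?z"
  proof (cases u)
    case (Cons b v)
    then have "0 \<le> cf_eval v ?z" "b \<noteq> 0" using cf_eval_bounds[of v ?z] u z by auto
    then show ?thesis using Cons by (auto intro!: add_pos_nonneg)
  qed (use z in simp)
  moreover have "real a \<ge> 1" using u by simp
  ultimately show "cf_lim \<sigma> < 1" using cf_lim_shift[of \<sigma> 1, OF assms] u by (simp add: divide_less_eq)
qed

lemma gauss_map_iter_cf_lim:
  assumes "\<And>i. \<sigma> i \<noteq> []" "\<And>i. 0 \<notin> set (\<sigma> i)"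
  shows "(gauss_map ^^ length (concat (map \<sigma> [0..<m]))) (cf_lim \<sigma>) = cf_lim (\<lambda>i. \<sigma> (m + i))"
  using cf_lim_open[of "\<lambda>i. \<sigma> (m + i)"] assms
  by (subst cf_lim_shift[of \<sigma> m, OF assms]) (intro gauss_map_iter_cf_eval, auto)

text \<open>Adjacent cylinders share an endpoint, so a gap appears only for restricted tails. Put
  \<open>Q = A + 1\<close>. At the first differing digit the two denominators differ by at least
  \<open>1 - (1 - 1/Q) = 1/Q\<close>, since both tails lie between \<open>1/Q\<close> and
  \<open>1\<close>. Each digit up to and including that one costs a factor \<open>1/Q^2\<close>, as
  the denominators are at most \<open>Q\<close>.\<close>

lemma cf_eval_words_separated:
  assumes "u \<in> words A n" "v \<in> words A n" "u \<noteq> v"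
    and "y \<in> {1 / (real A + 1)..1}" "z \<in> {1 / (real A + 1)..1}"
  shows "1 / (real A + 1) ^ (2 * n + 1) \<le> \<bar>cf_eval u y - cf_eval v z\<bar>"
  using assms(1-3)
proof (induction n arbitrary: u v)
  case 0
  then show ?case by (simp add: words_def)
next
  case (Suc n)
  obtain a u' where u: "u = a # u'" "u' \<in> words A n" "1 \<le> a" "a \<le> A"
    using Suc.prems(1) by (cases u) (auto simp: words_def)
  obtain b v' where v: "v = b # v'" "v' \<in> words A n" "1 \<le> b" "b \<le> A"
    using Suc.prems(2) by (cases v) (auto simp: words_def)
  define Q where "Q = real A + 1"
  have Q: "Q > 1" using u by (simp add: Q_def)
  have range: "cf_eval w x \<in> {1 / Q..1}" if "w \<in> words A n" "x \<in> {1 / Q..1}" for w x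
  proof (cases w)
    case (Cons c w')
    have "0 \<le> x" using that(2) Q by (auto intro: order_trans[of 0 "1 / Q"])
    then have "cf_eval w' x \<in> {0..1}" using Cons that words_pos[OF that(1)] by (intro cf_eval_bounds) auto
    moreover have "1 \<le> real c" "real c \<le> real A" using that(1) Cons by (auto simp: words_def)
    ultimately show ?thesis using Cons by (auto simp: Q_def intro!: divide_left_mono)
  qed (use that in simp)
  define p q where "p = cf_eval u' y" and "q = cf_eval v' z"
  have pq: "1 / Q \<le> p" "p \<le> 1" "1 / Q \<le> q" "q \<le> 1"
    using range[OF u(2)] range[OF v(2)] assms(4,5) by (auto simp: p_def q_def Q_def)
  have pq0: "0 < p" "0 < q" using pq Q by (auto intro: less_le_trans[of 0 "1 / Q"])
  have den: "0 < (real a + p) * (real b + q)" "(real a + p) * (real b + q) \<le> Q * Q"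
    using pq pq0 u v by (auto simp: Q_def intro!: mult_mono add_mono mult_pos_pos add_pos_pos)
  have eq: "\<bar>cf_eval u y - cf_eval v z\<bar> = \<bar>real b + q - (real a + p)\<bar> / ((real a + p) * (real b + q))"
  proof -
    have "real a + p > 0" "real b + q > 0" using pq0 by auto
    then have "cf_eval u y - cf_eval v z = (real b + q - (real a + p)) / ((real a + p) * (real b + q))"
      by (simp add: u v p_def[symmetric] q_def[symmetric] divide_simps)
    then show ?thesis using den(1) by simp
  qed
  have "1 / Q ^ (2 * n + 1) \<le> \<bar>real b + q - (real a + p)\<bar>"
  proof (cases "a = b")
    case True
    then have "u' \<noteq> v'" using Suc.prems(3) u v by auto
    then show ?thesis using Suc.IH[OF u(2) v(2)] True by (simp add: p_def q_def Q_def abs_minus_commute)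
  next
    case False
    then have "1 \<le> \<bar>real b - real a\<bar>" by linarith
    then have "1 / Q \<le> \<bar>real b + q - (real a + p)\<bar>" using pq by linarith
    moreover have "1 / Q ^ (2 * n + 1) \<le> 1 / Q ^ 1"
      using Q by (intro divide_left_mono power_increasing) auto
    ultimately show ?thesis by simp
  qed
  then have "1 / Q ^ (2 * n + 1) / (Q * Q) \<le> \<bar>real b + q - (real a + p)\<bar> / ((real a + p) * (real b + q))"
    using den by (intro frac_le) auto
  then show ?case unfolding eq by (simp add: Q_def mult_ac)
qed

text \<open>Take the shortest prefix whose cylinder length is at most \<open>exp (- T)\<close>. If
  it is nonempty, dropping its last digit \<open>d\<close> gives a length above
  \<open>exp (- T)\<close>, and appending \<open>d\<close> costs at most the factor
  \<open>8 * d^2\<close>, subexponential in \<open>T\<close> because \<open>log i_n = o(n)\<close>.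
  The bound on \<open>k\<close> later controls how much an inserted prefix delays the subsequent
  hits.\<close>

lemma slow_cf_prefix:
  assumes x: "slow_cf x" and \<eta>: "0 < \<eta>"
  obtains C where "0 \<le> C" "\<And>T. 0 \<le> T \<Longrightarrow> \<exists>k. cyl_len (cf_word x k) \<le> exp (- T) \<and>
    exp (- (1 + \<eta>) * T - C) \<le> cyl_len (cf_word x k) \<and> real k \<le> 2 * T + 2"
proof -
  note xi = slow_cf_irr01[OF x]
  define a where "a n = ln (real_of_int (cf_digit x n))" for n
  have "a \<in> o(\<lambda>n. real n)" using x by (simp add: slow_cf_def a_def[abs_def])
  then have "eventually (\<lambda>n. norm (a n) \<le> \<eta> / 4 * norm (real n)) sequentially"
    using \<eta> by (intro landau_o.smallD) auto
  then obtain N where N: "\<And>n. n \<ge> N \<Longrightarrow> a n \<le> \<eta> / 4 * real n" by (fastforce simp: eventually_sequentially)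
  define B where "B = Max (insert 0 (a ` {..<N}))"
  have B: "0 \<le> B" by (simp add: B_def)
  have aB: "a n \<le> \<eta> / 4 * real n + B" for n
  proof (cases "n < N")
    case True
    then have "a n \<le> B" unfolding B_def by (intro Max_ge) auto
    moreover have "0 \<le> \<eta> / 4 * real n" using \<eta> by simp
    ultimately show ?thesis by linarith
  qed (use N[of n] B in simp)
  \<comment> \<open>From \<open>ln d \<le> \<eta> / 4 * (2 * T + 1) + B\<close> it follows that
    \<open>ln (8 * d^2) \<le> \<eta> * T + C\<close>.\<close>
  define C where "C = ln 8 + \<eta> / 2 + 2 * B"
  have C: "0 \<le> C" using B \<eta> by (simp add: C_def)
  let ?l = "\<lambda>k. cyl_len (cf_word x k)"
  have len: "?l k \<le> 2 * (1/2) ^ k" for k using cyl_len_decay[OF cf_word_pos[OF xi], of k] by simp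
  have "\<exists>k. ?l k \<le> exp (- T) \<and> exp (- (1 + \<eta>) * T - C) \<le> ?l k \<and> real k \<le> 2 * T + 2" if T: "0 \<le> T" for T
  proof -
    obtain k0 where "(1/2::real) ^ k0 < exp (- T) / 2" using real_arch_pow_inv[of "exp (- T) / 2" "1/2"] by auto
    then have ex: "?l k0 \<le> exp (- T)" using len[of k0] by linarith
    define k where "k = (LEAST k. ?l k \<le> exp (- T))"
    have k: "?l k \<le> exp (- T)" unfolding k_def using ex by (rule LeastI)
    show ?thesis
    proof (cases k)
      case 0
      have "0 \<le> \<eta> * T" using T \<eta> by simp
      then have "- (1 + \<eta>) * T - C \<le> 0" using T C by (simp add: algebra_simps)
      then show ?thesis using k 0 T by (intro exI[of _ 0]) auto
    next
      case (Suc j)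
      then have j: "exp (- T) < ?l j" using not_less_Least[of j "\<lambda>k. ?l k \<le> exp (- T)"] by (simp add: k_def)
      then have "exp (- T) < 2 * (1/2) ^ j" using len[of j] by linarith
      then have "ln (exp (- T)) < ln (2 * (1/2) ^ j)" by (subst ln_less_cancel_iff) auto
      then have "real j * ln 2 < T + ln 2" by (simp add: ln_mult ln_realpow ln_div)
      moreover have "1/2 \<le> ln (2::real)" using ln_ge_iff[of 2 "1/2"] exp_half_le2 by simp
      ultimately have jT: "real j \<le> 2 * T + 1"
      proof (cases "1 \<le> real j")
        case True
        then have "(real j - 1) * (1/2) \<le> (real j - 1) * ln 2"
          using \<open>1/2 \<le> ln 2\<close> by (intro mult_left_mono) auto
        also have "\<dots> = real j * ln 2 - ln 2" by (simp add: algebra_simps)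
        also have "\<dots> < T" using \<open>real j * ln 2 < T + ln 2\<close> by simp
        finally show ?thesis by simp
      qed (use T in simp)
      define d where "d = nat (cf_digit x j)"
      have w: "cf_word x (Suc j) = cf_word x j @ [d]" by (simp add: cf_word_def d_def)
      have d0: "d \<ge> 1" using cf_word_pos[OF xi, of "Suc j"] w by auto
      have a: "a j = ln (real d)" using d0 by (simp add: a_def d_def)
      have "cyl_len [d] \<ge> 1 / (2 * real d ^ 2)"
      proof -
        have "real d * (real d + 1) \<le> real d * (2 * real d)" using d0 by (intro mult_left_mono) auto
        then have "1 / (real d * (2 * real d)) \<le> 1 / (real d * (real d + 1))"
          using d0 by (intro divide_left_mono) auto
        then show ?thesis by (simp add: cyl_len_def power2_eq_square mult_ac)
      qed
      then have "exp (- T) * (1 / (2 * real d ^ 2)) / 4 \<le> ?l j * cyl_len [d] / 4"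
        using j cyl_len_pos[OF cf_word_pos[OF xi, of j]] by (intro divide_right_mono mult_mono) auto
      also have "\<dots> \<le> ?l (Suc j)" unfolding w
        using d0 cf_word_pos[OF xi, of j] by (intro cyl_len_append) auto
      finally have low: "exp (- T) * (1 / (2 * real d ^ 2)) / 4 \<le> ?l (Suc j)" .
      have "exp (- T) * (1 / (2 * real d ^ 2)) / 4 = exp (- T - ln 8 - 2 * a j)"
      proof -
        have "exp (2 * a j) = real d ^ 2" using d0 by (simp add: a exp_double)
        then show ?thesis by (simp add: exp_diff)
      qed
      moreover have "- (1 + \<eta>) * T - C \<le> - T - ln 8 - 2 * a j"
      proof -
        have "\<eta> / 4 * real j \<le> \<eta> / 4 * (2 * T + 1)" using jT \<eta> by (intro mult_left_mono) auto
        then have "\<eta> / 4 * real j + B \<le> \<eta> / 4 * (2 * T + 1) + B" by (rule add_right_mono)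
        with aB[of j] have "a j \<le> \<eta> / 4 * (2 * T + 1) + B" by (rule order_trans)
        then show ?thesis by (simp add: C_def algebra_simps)
      qed
      ultimately have "exp (- (1 + \<eta>) * T - C) \<le> ?l (Suc j)"
        using low by (metis exp_le_cancel_iff order_trans)
      then show ?thesis using k Suc jT by (intro exI[of _ "Suc j"]) auto
    qed
  qed
  then show ?thesis using that C by blast
qed

text \<open>For \<open>m = fact (Suc i)\<close> the sum is at most
  \<open>4 * fact i = 4 * m / (i + 1)\<close>, hence at most \<open>\<epsilon> * m\<close> once
  \<open>i + 1 \<ge> 4 / \<epsilon>\<close>. Immediately after a factorial the sum is comparable
  with \<open>m\<close>, so \<open>m\<close> is restricted to factorials.\<close>

lemma fact_sparse:
  assumes "0 < (\<epsilon>::real)"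
  obtains C where "0 \<le> C" "\<And>m. m \<in> range fact \<Longrightarrow> (\<Sum>i\<in>range fact \<inter> {..<m}. real i + 1) \<le> \<epsilon> * real m + C"
proof -
  obtain J :: nat where J: "4 / \<epsilon> \<le> real J" using real_arch_simple by blast
  have main: "(\<Sum>i\<in>range fact \<inter> {..<fact (Suc j)}. real i + 1) \<le> 4 * fact j" for j
  proof -
    have sub: "range fact \<inter> {..<fact (Suc j)} \<subseteq> (fact ` {..<Suc j} :: nat set)"
    proof
      fix i :: nat assume "i \<in> range fact \<inter> {..<fact (Suc j)}"
      then obtain k where k: "i = fact k" "(fact k :: nat) < fact (Suc j)" by auto
      then have "k < Suc j" using fact_mono_nat[of "Suc j" k] by (meson leD not_le_imp_less)
      then show "i \<in> fact ` {..<Suc j}" using k by auto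
    qed
    have "(\<Sum>i\<in>range fact \<inter> {..<fact (Suc j)}. real i + 1) \<le> (\<Sum>i\<in>fact ` {..<Suc j}. real i + 1)"
      using sub by (intro sum_mono2) auto
    also have "\<dots> \<le> (\<Sum>k<Suc j. real (fact k) + 1)"
      using sum_image_le[of "{..<Suc j}" "\<lambda>i::nat. real i + 1" fact] by (simp add: comp_def)
    also have "\<dots> \<le> 4 * fact j"
    proof (induction j)
      case (Suc j)
      have "1 \<le> (fact (Suc j) :: real)" by (rule fact_ge_1)
      show ?case
      proof (cases j)
        case (Suc i)
        have "2 * (fact j :: real) \<le> real (Suc j) * fact j" using Suc by (intro mult_right_mono) auto
        moreover have "fact (Suc j) = real (Suc j) * fact j" by simp
        ultimately have "4 * fact j + (fact (Suc j) + 1) \<le> 4 * (fact (Suc j) :: real)"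
          using \<open>1 \<le> fact (Suc j)\<close> by linarith
        then show ?thesis using Suc.IH by simp
      qed simp
    qed simp
    finally show ?thesis .
  qed
  show ?thesis
  proof (rule that[of "4 * fact J"])
    fix m :: nat assume "m \<in> range fact"
    then obtain j where j: "m = fact j" by auto
    show "(\<Sum>i\<in>range fact \<inter> {..<m}. real i + 1) \<le> \<epsilon> * real m + 4 * fact J"
    proof (cases j)
      case 0
      have "range fact \<inter> {..<m} = {}" using 0 j by (auto simp: fact_ge_1 less_Suc0)
      then show ?thesis using assms by simp
    next
      case (Suc i)
      have le: "(\<Sum>i\<in>range fact \<inter> {..<m}. real i + 1) \<le> 4 * fact i" using main[of i] by (simp add: j Suc)
      show ?thesis
      proof (cases "i \<le> J")
        case True
        then have "(fact i :: real) \<le> fact J" by (rule fact_mono)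
        moreover have "0 \<le> \<epsilon> * real m" using assms by simp
        ultimately show ?thesis using le by linarith
      next
        case False
        then have "4 / \<epsilon> \<le> real (Suc i)" using J by simp
        then have "4 \<le> \<epsilon> * real (Suc i)" using assms by (simp add: field_simps)
        then have "4 * fact i \<le> \<epsilon> * real (Suc i) * (fact i :: real)" by (intro mult_right_mono) auto
        also have "\<dots> = \<epsilon> * real m" by (simp add: j Suc algebra_simps)
        finally show ?thesis using le by (smt (verit) fact_ge_zero)
      qed
    qed
  qed simp
qed

text \<open>Only the largest factorial \<open>M \<le> m\<close> is charged at the full rate
  \<open>a\<close>; by \<open>fact_sparse\<close> all smaller ones fit into
  \<open>(a' - a) * M\<close> plus a constant. Unlike there, \<open>m\<close> is arbitrary.\<close>

lemma fact_sparse_cost: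
  fixes c :: "nat \<Rightarrow> real"
  assumes "0 \<le> a" "a < a'" "0 \<le> b" and c: "\<And>i. i \<in> range fact \<Longrightarrow> c i \<le> a * real i + b"
  obtains C where "0 \<le> C" "\<And>m. (\<Sum>i\<in>range fact \<inter> {..m}. c i) \<le> a' * real m + C"
proof -
  define q where "q = a + b + 1"
  have q: "0 < q" "a \<le> q" "b \<le> q" using assms by (auto simp: q_def)
  obtain D where D: "0 \<le> D" "\<And>m. m \<in> range fact \<Longrightarrow> (\<Sum>i\<in>range fact \<inter> {..<m}. real i + 1) \<le> (a' - a) / q * real m + D"
    using fact_sparse[of "(a' - a) / q"] assms q by auto
  show ?thesis
  proof (rule that[of "q * D + b"])
    show "0 \<le> q * D + b" using q D assms by simp
    fix m :: nat
    let ?S = "range fact \<inter> {..m} :: nat set"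
    show "(\<Sum>i\<in>?S. c i) \<le> a' * real m + (q * D + b)"
    proof (cases "?S = {}")
      case True
      then show ?thesis using assms q D by simp
    next
      case False
      define M where "M = Max ?S"
      have M: "M \<in> range fact" "M \<le> m" using Max_in[of ?S] False by (auto simp: M_def)
      have S: "?S = insert M (range fact \<inter> {..<M})"
      proof (intro equalityI subsetI)
        fix i assume i: "i \<in> ?S"
        then have "i \<le> M" unfolding M_def by (intro Max_ge) simp_all
        then show "i \<in> insert M (range fact \<inter> {..<M})" using i by (cases "i = M") simp_all
      next
        fix i assume "i \<in> insert M (range fact \<inter> {..<M})"
        then show "i \<in> ?S" using M by (elim insertE IntE) simp_all
      qed
      have "(\<Sum>i\<in>?S. c i) = c M + (\<Sum>i\<in>range fact \<inter> {..<M}. c i)" unfolding S by simp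
      also have "\<dots> \<le> (a * real M + b) + (\<Sum>i\<in>range fact \<inter> {..<M}. q * (real i + 1))"
      proof (intro add_mono sum_mono c M(1))
        fix i assume i: "i \<in> range fact \<inter> {..<M}"
        have "a * real i \<le> q * real i" using q by (intro mult_right_mono) auto
        then show "c i \<le> q * (real i + 1)" using c[of i] i q by (simp add: algebra_simps)
      qed
      also have "\<dots> = (a * real M + b) + q * (\<Sum>i\<in>range fact \<inter> {..<M}. real i + 1)"
        by (simp add: sum_distrib_left)
      also have "\<dots> \<le> (a * real M + b) + q * ((a' - a) / q * real M + D)"
        using D(2)[OF M(1)] q by (intro add_left_mono mult_left_mono) auto
      also have "\<dots> = a' * real M + (q * D + b)" using q by (simp add: field_simps)
      also have "\<dots> \<le> a' * real m + (q * D + b)" using M assms by (intro add_right_mono mult_left_mono) auto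
      finally show ?thesis .
    qed
  qed
qed

text \<open>Slot \<open>t\<close> is the prescribed word \<open>w t\<close> followed by a free
  random block of \<open>n\<close> digits from \<open>1\<close> to \<open>A\<close>. Later digits of
  \<open>w t\<close> may be large: \<open>w_hd\<close> bounds just the first one, so that a tail
  starting at a slot is at least \<open>1 / (A + 1)\<close>.\<close>

locale cantor_scheme =
  fixes w :: "nat \<Rightarrow> nat list" and A n :: nat and s :: real
  assumes w_pos: "\<And>t. 0 \<notin> set (w t)" and w_hd: "\<And>t. w t \<noteq> [] \<Longrightarrow> hd (w t) \<le> A"
    and n: "1 \<le> n" and A: "1 \<le> A" and s: "0 < s"
begin

definition Z :: real where
  "Z = (\<Sum>u\<in>words A n. cyl_len u powr s)"

definition block_measure :: "nat list measure" where
  "block_measure = point_measure (words A n) (\<lambda>u. ennreal (cyl_len u powr s / Z))"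

definition code_measure :: "(nat \<Rightarrow> nat list) measure" where
  "code_measure = PiM UNIV (\<lambda>_. block_measure)"

definition slot :: "(nat \<Rightarrow> nat list) \<Rightarrow> nat \<Rightarrow> nat list" where
  "slot \<omega> t = w t @ \<omega> t"

text \<open>Includes the prescribed word \<open>w t\<close>, and so contains all digits forced by
  the blocks before \<open>t\<close>.\<close>

definition stem :: "(nat \<Rightarrow> nat list) \<Rightarrow> nat \<Rightarrow> nat list" where
  "stem \<omega> t = concat (map (slot \<omega>) [0..<t]) @ w t"

definition code_point :: "(nat \<Rightarrow> nat list) \<Rightarrow> real" where
  "code_point \<omega> = cf_lim (slot \<omega>)"

lemma Z_pos: "0 < Z"
proof -
  have u: "replicate n 1 \<in> words A n" using A by (auto simp: words_def)
  then have "0 < cyl_len (replicate n 1)" using cyl_len_pos words_pos by blast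
  then show ?thesis unfolding Z_def using u by (intro sum_pos2[of _ "replicate n 1"]) auto
qed

lemma space_block_measure: "space block_measure = words A n"
  by (simp add: block_measure_def space_point_measure)

lemma sets_block_measure: "sets block_measure = Pow (words A n)"
  by (simp add: block_measure_def sets_point_measure)

lemma prob_space_block_measure: "prob_space block_measure"
  unfolding block_measure_def
proof (rule prob_space_point_measure)
  have "(\<Sum>u\<in>words A n. ennreal (cyl_len u powr s / Z)) = ennreal (\<Sum>u\<in>words A n. cyl_len u powr s / Z)"
    using Z_pos by (intro sum_ennreal) auto
  also have "(\<Sum>u\<in>words A n. cyl_len u powr s / Z) = 1"
    using Z_pos by (simp add: Z_def flip: sum_divide_distrib)
  finally show "(\<Sum>u\<in>words A n. ennreal (cyl_len u powr s / Z)) = 1" by simp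
qed auto

lemma measure_block_measure:
  assumes "u \<in> words A n"
  shows "measure block_measure {u} = cyl_len u powr s / Z"
  using assms Z_pos by (simp add: block_measure_def measure_def emeasure_point_measure_finite)

lemma prob_space_code_measure: "prob_space code_measure"
  unfolding code_measure_def by (intro prob_space_PiM prob_space_block_measure)

lemma space_code_measure: "space code_measure = {\<omega>. \<forall>t. \<omega> t \<in> words A n}"
  by (auto simp: code_measure_def space_PiM space_block_measure PiE_def)

lemma measure_agree:
  assumes "\<omega> \<in> space code_measure"
  shows "{v \<in> space code_measure. \<forall>i<t. v i = \<omega> i} \<in> sets code_measure"
    and "measure code_measure {v \<in> space code_measure. \<forall>i<t. v i = \<omega> i} = (\<Prod>i<t. cyl_len (\<omega> i) powr s / Z)"
proof -
  interpret P: product_prob_space "\<lambda>_. block_measure" "UNIV :: nat set"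
    by (intro product_prob_spaceI prob_space_block_measure)
  have w: "\<omega> i \<in> words A n" for i using assms by (simp add: space_code_measure)
  have eq: "{v \<in> space code_measure. \<forall>i<t. v i = \<omega> i} =
      prod_emb UNIV (\<lambda>_. block_measure) {..<t} (PiE {..<t} (\<lambda>i. {\<omega> i}))"
    by (auto simp: prod_emb_def code_measure_def space_PiM PiE_iff space_block_measure extensional_def)
  have m: "{\<omega> i} \<in> sets block_measure" for i using w by (simp add: sets_block_measure)
  show "{v \<in> space code_measure. \<forall>i<t. v i = \<omega> i} \<in> sets code_measure"
    unfolding eq unfolding code_measure_def using m by (intro sets_PiM_I) auto
  have "measure code_measure {v \<in> space code_measure. \<forall>i<t. v i = \<omega> i} = (\<Prod>i<t. measure block_measure {\<omega> i})"
    unfolding eq unfolding code_measure_def using m by (intro P.measure_PiM_emb) auto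
  then show "measure code_measure {v \<in> space code_measure. \<forall>i<t. v i = \<omega> i} = (\<Prod>i<t. cyl_len (\<omega> i) powr s / Z)"
    using w by (simp add: measure_block_measure)
qed

lemma measurable_code_point: "code_point \<in> borel_measurable code_measure"
proof -
  have comp: "(\<lambda>\<omega>. \<omega> t) \<in> measurable code_measure (count_space UNIV)" for t
  proof -
    have "(\<lambda>\<omega>. \<omega> t) \<in> measurable code_measure block_measure"
      unfolding code_measure_def by (rule measurable_component_singleton) simp
    moreover have "(\<lambda>u. u) \<in> measurable block_measure (count_space UNIV)"
      unfolding block_measure_def measurable_point_measure_eq1 by simp
    ultimately show ?thesis by (rule measurable_compose)
  qed
  have "(\<lambda>\<omega>. concat (map (slot \<omega>) [0..<m])) \<in> measurable code_measure (count_space UNIV)" for m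
  proof (induction m)
    case (Suc m)
    have "(\<lambda>\<omega>. concat (map (slot \<omega>) [0..<m]) @ w m @ v) \<in> measurable code_measure (count_space UNIV)" for v
      by (rule measurable_compose[OF Suc]) simp
    from measurable_compose_countable[OF this comp[of m]]
    have "(\<lambda>\<omega>. concat (map (slot \<omega>) [0..<m]) @ w m @ \<omega> m) \<in> measurable code_measure (count_space UNIV)" .
    then show ?case by (simp add: slot_def[of _ m])
  qed simp
  then have [measurable]: "(\<lambda>\<omega>. cf_eval (concat (map (slot \<omega>) [0..<m])) 0) \<in> borel_measurable code_measure" for m
    by (rule measurable_compose) simp
  show ?thesis
    unfolding code_point_def[abs_def] cf_lim_def by measurable
qed

lemma slot_props:
  assumes "\<omega> \<in> space code_measure"
  shows "slot \<omega> t \<noteq> []" "0 \<notin> set (slot \<omega> t)" "hd (slot \<omega> t) \<le> A"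
proof -
  have w: "\<omega> t \<in> words A n" using assms by (simp add: space_code_measure)
  then have ne: "\<omega> t \<noteq> []" using n by (auto simp: words_def)
  show "slot \<omega> t \<noteq> []" using ne by (simp add: slot_def)
  show "0 \<notin> set (slot \<omega> t)" using w_pos words_pos[OF w] by (simp add: slot_def)
  have "hd (\<omega> t) \<in> set (\<omega> t)" using ne by simp
  then have "hd (\<omega> t) \<le> A" using w by (auto simp: words_def)
  then show "hd (slot \<omega> t) \<le> A" using w_hd[of t] by (cases "w t") (auto simp: slot_def)
qed

lemma tail_bounds:
  assumes "\<omega> \<in> space code_measure"
  shows "cf_lim (\<lambda>i. slot \<omega> (t + i)) \<in> {1 / (real A + 1)..1}"
proof -
  let ?\<sigma> = "\<lambda>i. slot \<omega> (t + i)"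
  note p = slot_props[OF assms]
  obtain a u where u: "slot \<omega> t = a # u" using p(1)[of t] by (cases "slot \<omega> t") auto
  have a: "1 \<le> a" "a \<le> A" "0 \<notin> set u" using p(2,3)[of t] u by auto
  let ?z = "cf_lim (\<lambda>i. ?\<sigma> (1 + i))"
  have z: "?z \<in> {0..1}" by (intro cf_lim_bounds p)
  have "cf_lim ?\<sigma> = 1 / (real a + cf_eval u ?z)"
    using cf_lim_shift[of ?\<sigma> 1] p u by simp
  moreover have "cf_eval u ?z \<in> {0..1}" using a z by (intro cf_eval_bounds)
  ultimately show ?thesis using a by (auto intro!: divide_left_mono)
qed

lemma code_point_eq:
  assumes "\<omega> \<in> space code_measure"
  shows "code_point \<omega> = cf_eval (stem \<omega> t) (cf_eval (\<omega> t) (cf_lim (\<lambda>i. slot \<omega> (Suc t + i))))"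
  unfolding code_point_def
  by (subst cf_lim_shift[of "slot \<omega>" "Suc t"])
     (use slot_props[OF assms] in \<open>auto simp: stem_def slot_def cf_eval_append[symmetric]\<close>)

lemma stem_pos: "\<omega> \<in> space code_measure \<Longrightarrow> 0 \<notin> set (stem \<omega> t)"
  using slot_props(2) w_pos by (auto simp: stem_def)

text \<open>The gap of \<open>cf_eval_words_separated\<close> between different free blocks, reduced
  by the distortion factor \<open>4\<close> of the stem in front of them.\<close>

definition sep :: real where
  "sep = 1 / (4 * (real A + 1) ^ (2 * n + 1))"

lemma sep_pos: "0 < sep"
  by (auto simp: sep_def)

lemma code_point_separated:
  assumes \<omega>: "\<omega> \<in> space code_measure" and v: "v \<in> space code_measure"
    and agree: "\<And>i. i < t \<Longrightarrow> v i = \<omega> i" and "v t \<noteq> \<omega> t"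
  shows "sep * cyl_len (stem \<omega> t) \<le> \<bar>code_point v - code_point \<omega>\<bar>"
proof -
  have st: "stem v t = stem \<omega> t"
    using agree by (auto simp: stem_def slot_def intro!: arg_cong[of _ _ concat])
  define y where "y \<omega> = cf_eval (\<omega> t) (cf_lim (\<lambda>i. slot \<omega> (Suc t + i)))" for \<omega>
  have W: "\<omega> t \<in> words A n" "v t \<in> words A n" using \<omega> v by (auto simp: space_code_measure)
  have y01: "y x \<in> {0..1}" if "x \<in> space code_measure" for x
    unfolding y_def using that words_pos[of "x t" A n]
    by (intro cf_eval_bounds cf_lim_bounds slot_props) (auto simp: space_code_measure)
  have "1 / (real A + 1) ^ (2 * n + 1) \<le> \<bar>y v - y \<omega>\<bar>"
    unfolding y_def using W assms(4) tail_bounds[OF \<omega>, of "Suc t"] tail_bounds[OF v, of "Suc t"]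
    by (intro cf_eval_words_separated) auto
  then have "cyl_len (stem \<omega> t) / 4 * (1 / (real A + 1) ^ (2 * n + 1)) \<le> cyl_len (stem \<omega> t) / 4 * \<bar>y v - y \<omega>\<bar>"
    using cyl_len_pos[OF stem_pos[OF \<omega>, of t]] by (intro mult_left_mono) auto
  also have "\<dots> \<le> \<bar>cf_eval (stem \<omega> t) (y v) - cf_eval (stem \<omega> t) (y \<omega>)\<bar>"
    using cf_eval_separated[OF stem_pos[OF \<omega>] y01[OF v] y01[OF \<omega>], of t] by simp
  also have "\<dots> = \<bar>code_point v - code_point \<omega>\<bar>"
    using code_point_eq[OF v, of t] code_point_eq[OF \<omega>, of t] by (simp add: y_def st)
  finally show ?thesis by (simp add: sep_def mult.commute)
qed

text \<open>Each complete slot uses two concatenations, \<open>w i\<close> with the block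
  \<open>\<omega> i\<close> and the result with what precedes; each costs a factor \<open>4\<close>.
  Appending the final \<open>w t\<close> costs one more.\<close>

lemma cyl_len_stem_lower:
  assumes "\<omega> \<in> space code_measure"
  shows "(\<Prod>i<t. cyl_len (\<omega> i)) * (\<Prod>i\<le>t. cyl_len (w i)) \<le> 4 * 16 ^ t * cyl_len (stem \<omega> t)"
proof -
  let ?W = "\<lambda>t. concat (map (slot \<omega>) [0..<t])"
  have W: "0 \<notin> set (?W t)" for t using slot_props(2)[OF assms] by auto
  have b: "0 \<notin> set (\<omega> t)" for t using assms words_pos by (auto simp: space_code_measure)
  have "(\<Prod>i<t. cyl_len (\<omega> i)) * (\<Prod>i<t. cyl_len (w i)) \<le> 16 ^ t * cyl_len (?W t)" for t
  proof (induction t)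
    case (Suc t)
    have pos: "0 < cyl_len (\<omega> t)" "0 < cyl_len (w t)" "0 < cyl_len (?W t)"
      using cyl_len_pos w_pos b W by blast+
    have "(\<Prod>i<Suc t. cyl_len (\<omega> i)) * (\<Prod>i<Suc t. cyl_len (w i)) =
        ((\<Prod>i<t. cyl_len (\<omega> i)) * (\<Prod>i<t. cyl_len (w i))) * (cyl_len (w t) * cyl_len (\<omega> t))"
      by (simp add: mult_ac)
    also have "\<dots> \<le> 16 ^ t * cyl_len (?W t) * (cyl_len (w t) * cyl_len (\<omega> t))"
      using pos by (intro mult_right_mono Suc) auto
    also have "\<dots> \<le> 16 ^ t * cyl_len (?W t) * (4 * cyl_len (w t @ \<omega> t))"
      using pos cyl_len_append[OF w_pos b, of t t] by (intro mult_left_mono) auto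
    also have "\<dots> = 4 * 16 ^ t * (cyl_len (?W t) * cyl_len (w t @ \<omega> t))" by simp
    also have "\<dots> \<le> 4 * 16 ^ t * (4 * cyl_len (?W t @ (w t @ \<omega> t)))"
      using cyl_len_append[OF W, of "w t @ \<omega> t" t] w_pos b by (intro mult_left_mono) auto
    finally show ?case by (simp add: slot_def[of \<omega> t])
  qed simp
  then have "(\<Prod>i<t. cyl_len (\<omega> i)) * (\<Prod>i<t. cyl_len (w i)) * cyl_len (w t) \<le> 16 ^ t * cyl_len (?W t) * cyl_len (w t)"
    using cyl_len_pos[OF w_pos, of t] by (intro mult_right_mono) auto
  also have "\<dots> = 16 ^ t * (cyl_len (?W t) * cyl_len (w t))" by simp
  also have "\<dots> \<le> 16 ^ t * (4 * cyl_len (stem \<omega> t))"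
    unfolding stem_def using cyl_len_append[OF W w_pos, of t t] by (intro mult_left_mono) auto
  finally show ?thesis by (simp add: mult_ac flip: lessThan_Suc_atMost)
qed

text \<open>The loss caused by the inserted words is paid by the surplus of \<open>Z\<close> over the constant
  \<open>16\<^sup>s\<close> coming from concatenation.\<close>

lemma prefix_weight_le:
  assumes \<omega>: "\<omega> \<in> space code_measure"
    and Zb: "16 powr s * exp (s * b) \<le> Z" and cost: "\<And>t. (\<Sum>i\<le>t. - ln (cyl_len (w i))) \<le> b * real t + C"
  shows "(\<Prod>i<t. cyl_len (\<omega> i) powr s / Z) \<le> (4 * exp C) powr s * cyl_len (stem \<omega> t) powr s"
proof -
  define P where "P = (\<Prod>i<t. cyl_len (\<omega> i))"
  define Q where "Q = (\<Prod>i\<le>t. cyl_len (w i))"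
  have b: "0 < cyl_len (\<omega> i)" for i
    using \<omega> words_pos by (intro cyl_len_pos) (auto simp: space_code_measure)
  have P: "0 < P" unfolding P_def using b by (intro prod_pos) auto
  have S: "0 < cyl_len (stem \<omega> t)" by (intro cyl_len_pos stem_pos \<omega>)
  have "exp (- (b * real t + C)) \<le> exp (- (\<Sum>i\<le>t. - ln (cyl_len (w i))))" using cost[of t] by simp
  also have "\<dots> = Q"
    unfolding Q_def sum_negf using cyl_len_pos[OF w_pos] by (simp add: exp_sum)
  finally have Q: "exp (- (b * real t + C)) \<le> Q" .
  have "P * exp (- (b * real t + C)) \<le> P * Q" using Q P by (intro mult_left_mono) auto
  also have "\<dots> \<le> 4 * 16 ^ t * cyl_len (stem \<omega> t)" unfolding P_def Q_def by (rule cyl_len_stem_lower[OF \<omega>])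
  finally have "P * exp (- (b * real t + C)) * exp (b * real t + C) \<le> 4 * 16 ^ t * cyl_len (stem \<omega> t) * exp (b * real t + C)"
    by (intro mult_right_mono) auto
  then have "P \<le> (4 * exp C) * (16 * exp b) ^ t * cyl_len (stem \<omega> t)"
    by (simp add: mult.assoc flip: exp_add) (simp add: exp_add power_mult_distrib mult_ac flip: exp_of_nat_mult)
  then have "P powr s \<le> ((4 * exp C) * (16 * exp b) ^ t * cyl_len (stem \<omega> t)) powr s"
    using P s by (intro powr_mono2) auto
  also have "\<dots> = (4 * exp C) powr s * ((16 * exp b) powr s) ^ t * cyl_len (stem \<omega> t) powr s"
  proof -
    have "(x ^ t) powr s = (x powr s) ^ t" if "0 < x" for x :: real
      using that by (simp add: powr_powr mult.commute flip: powr_realpow)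
    from this[of "16 * exp b"] show ?thesis using S by (simp only: powr_mult) simp
  qed
  also have "(16 * exp b) powr s = 16 powr s * exp (s * b)"
    by (simp add: powr_mult) (simp add: powr_def mult.commute)
  also have "(4 * exp C) powr s * (16 powr s * exp (s * b)) ^ t * cyl_len (stem \<omega> t) powr s
      \<le> (4 * exp C) powr s * Z ^ t * cyl_len (stem \<omega> t) powr s"
    using Zb by (intro mult_right_mono mult_left_mono power_mono) auto
  finally have "P powr s / Z ^ t \<le> (4 * exp C) powr s * cyl_len (stem \<omega> t) powr s"
    using Z_pos by (simp add: field_simps)
  moreover have "(\<Prod>i<t. cyl_len (\<omega> i) powr s / Z) = P powr s / Z ^ t"
    unfolding P_def using b by (simp add: prod_dividef less_imp_le prod_powr_distrib)
  ultimately show ?thesis by simp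
qed

text \<open>For a radius \<open>r\<close>, stop at the first \<open>t\<close> with
  \<open>sep * cyl_len (stem \<omega> t) \<le> r\<close>. Earlier stems separate by more than
  \<open>r\<close>, so codes of points in the ball agree before \<open>t\<close>, and
  \<open>prefix_weight_le\<close> bounds their mass. Inserted digits shrink the cylinder without
  splitting the mass, so the worst radius sits at the end of \<open>w t\<close>; this is why the
  stem, and the cost up to and including \<open>t\<close>, contain that word.\<close>

theorem hausdorff_measure_code_points:
  assumes Zb: "16 powr s * exp (s * b) \<le> Z" and cost: "\<And>t. (\<Sum>i\<le>t. - ln (cyl_len (w i))) \<le> b * real t + C"
    and B: "\<And>\<omega>. \<omega> \<in> space code_measure \<Longrightarrow> code_point \<omega> \<in> B"
  shows "hausdorff_measure s B \<noteq> 0"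
proof -
  interpret prob_space code_measure by (rule prob_space_code_measure)
  define D where "D = (4 * exp C) powr s"
  \<comment> \<open>The first summand serves radii at least \<open>sep * cyl_len (w 0)\<close>,
    where \<open>t = 0\<close> and the trivial bound \<open>1\<close> on the mass is enough; the
    second serves smaller radii.\<close>
  define K where "K = 1 / (sep * cyl_len (w 0)) powr s + D / sep powr s"
  have w0: "0 < cyl_len (w 0)" by (rule cyl_len_pos[OF w_pos])
  have D: "0 < D" by (simp add: D_def)
  have Kpos: "0 < K" using w0 sep_pos D by (auto simp: K_def intro!: add_pos_pos divide_pos_pos)
  show ?thesis
  proof (rule mass_distribution_principle[OF prob_space_code_measure measurable_code_point B s Kpos])
    fix \<omega> and r :: real assume \<omega>: "\<omega> \<in> space code_measure" and r: "0 < r"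
    let ?V = "\<lambda>t. cyl_len (stem \<omega> t)"
    let ?E = "{v \<in> space code_measure. \<bar>code_point v - code_point \<omega>\<bar> \<le> r}"
    have V: "0 < ?V t" for t by (intro cyl_len_pos stem_pos \<omega>)
    obtain m where "(1/2::real) ^ m < r / (2 * sep)"
      using real_arch_pow_inv[of "r / (2 * sep)" "1/2"] r sep_pos by auto
    then have "sep * (2 * (1/2) ^ m) < r" using sep_pos by (simp add: field_simps)
    moreover have "?V m \<le> 2 * (1/2) ^ m"
    proof -
      have "m \<le> length (stem \<omega> m)"
        using length_concat_ge[of "slot \<omega>" m] slot_props(1)[OF \<omega>] by (simp add: stem_def)
      then have "2 * (1/2::real) ^ length (stem \<omega> m) \<le> 2 * (1/2) ^ m" by (intro mult_left_mono power_decreasing) auto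
      then show ?thesis using cyl_len_decay[OF stem_pos[OF \<omega>, of m]] by linarith
    qed
    ultimately have ex: "sep * ?V m \<le> r" using sep_pos by (smt (verit) mult_left_mono)
    define t where "t = (LEAST t. sep * ?V t \<le> r)"
    have t: "sep * ?V t \<le> r" unfolding t_def using ex by (rule LeastI)
    have tl: "r < sep * ?V j" if "j < t" for j using not_less_Least[of j "\<lambda>t. sep * ?V t \<le> r"] that by (auto simp: t_def not_le)
    show "measure code_measure ?E \<le> K * r powr s"
    proof (cases t)
      case 0
      have "measure code_measure ?E \<le> 1" by (rule prob_le_1)
      also have "1 \<le> (r / (sep * cyl_len (w 0))) powr s"
        using t 0 w0 sep_pos s by (intro ge_one_powr_ge_zero) (auto simp: stem_def)
      also have "\<dots> = 1 / (sep * cyl_len (w 0)) powr s * r powr s"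
        using w0 sep_pos r by (simp add: powr_divide)
      also have "\<dots> \<le> K * r powr s"
        unfolding K_def using D sep_pos by (intro mult_right_mono) auto
      finally show ?thesis .
    next
      case (Suc t')
      have "?E \<subseteq> {v \<in> space code_measure. \<forall>i<t. v i = \<omega> i}"
      proof safe
        fix v i assume v: "v \<in> space code_measure" "\<bar>code_point v - code_point \<omega>\<bar> \<le> r" and i: "i < t"
        show "v i = \<omega> i"
        proof (rule ccontr)
          assume ne: "v i \<noteq> \<omega> i"
          define j where "j = (LEAST j. v j \<noteq> \<omega> j)"
          have j: "v j \<noteq> \<omega> j" unfolding j_def using ne by (rule LeastI)
          have ag: "v k = \<omega> k" if "k < j" for k using not_less_Least[of k] that by (auto simp: j_def)
          have "j \<le> i" unfolding j_def using ne by (rule Least_le)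
          then have "r < sep * ?V j" using i by (intro tl) simp
          also have "\<dots> \<le> \<bar>code_point v - code_point \<omega>\<bar>"
            by (rule code_point_separated[OF \<omega> v(1) ag j])
          finally show False using v(2) by simp
        qed
      qed
      then have "measure code_measure ?E \<le> measure code_measure {v \<in> space code_measure. \<forall>i<t. v i = \<omega> i}"
        by (intro finite_measure_mono measure_agree(1)[OF \<omega>])
      also have "\<dots> = (\<Prod>i<t. cyl_len (\<omega> i) powr s / Z)" by (rule measure_agree(2)[OF \<omega>])
      also have "\<dots> \<le> D * ?V t powr s" unfolding D_def by (rule prefix_weight_le[OF \<omega> Zb cost])
      also have "\<dots> \<le> D * (r / sep) powr s"
        using t D V[of t] s sep_pos by (intro mult_left_mono powr_mono2) (auto simp: field_simps)
      also have "\<dots> = D / sep powr s * r powr s" using r sep_pos by (simp add: powr_divide)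
      also have "\<dots> \<le> K * r powr s" unfolding K_def using w0 sep_pos by (intro mult_right_mono) auto
      finally show ?thesis .
    qed
  qed
qed

end

section \<open>Shrinking targets\<close>

lemma hausdorff_measure_exp_target:
  assumes x0: "slow_cf x0" and \<kappa>: "0 < \<kappa>" and s: "0 < s" "s < gauss_lyapunov / (gauss_lyapunov + \<kappa>)"
  shows "hausdorff_measure s {x \<in> {0..1}.
    liminf (\<lambda>n. ereal (exp (real n * \<kappa>) * \<bar>(gauss_map ^^ n) x - x0\<bar>)) = 0} \<noteq> 0"
proof -
  note xi = slow_cf_irr01[OF x0]
  \<comment> \<open>Chosen to give
    \<open>(1 - s) * gauss_lyapunov = s * (\<kappa> + 3 * d) + d\<close>. Beside
    \<open>\<kappa>\<close>, one \<open>d\<close> sharpens the approximation to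
    \<open>\<kappa>'\<close> against the delay by earlier insertions, one pays for the overshoot of
    the prefix length, and one for the cost of the earlier insertions. The \<open>d\<close> outside,
    times \<open>n\<close>, absorbs multiplicative constants.\<close>
  define d where "d = ((1 - s) * gauss_lyapunov - s * \<kappa>) / (3 * s + 1)"
  have s': "s * (gauss_lyapunov + \<kappa>) < gauss_lyapunov" using s(2) \<kappa> gauss_lyapunov_pos by (simp add: pos_less_divide_eq)
  then have d: "0 < d" using s by (auto simp: d_def algebra_simps intro!: divide_pos_pos)
  have dl: "(1 - s) * gauss_lyapunov = s * (\<kappa> + 3 * d) + d"
  proof -
    have "d * (3 * s + 1) = (1 - s) * gauss_lyapunov - s * \<kappa>" using s by (simp add: d_def)
    then show ?thesis by (simp add: algebra_simps)
  qed
  have s1: "s < 1"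
  proof -
    have "s * gauss_lyapunov < 1 * gauss_lyapunov" using s' s \<kappa> by (smt (verit) mult_pos_pos distrib_left)
    then show ?thesis using gauss_lyapunov_pos by simp
  qed
  \<comment> \<open>So that \<open>exp (n * d)\<close> reaches \<open>16 powr s * 8 / ln 2\<close>:
    the loss by concatenation in each slot times the constant of
    \<open>word_sum_lower\<close>.\<close>
  obtain n :: nat where nn: "1 \<le> n" "ln (16 powr s * 8 / ln 2) / d \<le> real n"
  proof -
    obtain n' :: nat where "max 1 (ln (16 powr s * 8 / ln 2) / d) \<le> real n'" using real_arch_simple by blast
    then show ?thesis using that[of n'] by simp
  qed
  define b where "b = (\<kappa> + 3 * d) * real n"
  obtain A0 where A0: "\<And>A. A0 \<le> A \<Longrightarrow>
      ln 2 / 8 * exp ((1 - s) * real n * gauss_lyapunov) \<le> (\<Sum>u\<in>words A n. cyl_len u powr s)"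
    using word_sum_lower[OF s(1) s1] by blast
  \<comment> \<open>All nonempty inserted words start with the first digit of \<open>x0\<close>,
    which must not exceed \<open>A\<close>.\<close>
  define A where "A = max (max A0 1) (nat (cf_digit x0 0))"
  have AA: "A0 \<le> A" "1 \<le> A" "nat (cf_digit x0 0) \<le> A" by (auto simp: A_def)
  define \<kappa>' where "\<kappa>' = \<kappa> + d"
  have \<kappa>': "0 < \<kappa>'" using \<kappa> d by (simp add: \<kappa>'_def)
  obtain C0 where C0: "0 \<le> C0" "\<And>T. 0 \<le> T \<Longrightarrow> \<exists>k. cyl_len (cf_word x0 k) \<le> exp (- T) \<and>
      exp (- (1 + d / \<kappa>') * T - C0) \<le> cyl_len (cf_word x0 k) \<and> real k \<le> 2 * T + 2"
    using slow_cf_prefix[OF x0, of "d / \<kappa>'"] d \<kappa>' by auto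
  \<comment> \<open>Apart from earlier insertions, slot \<open>t\<close> starts at time
    \<open>n * t\<close>, so \<open>T = \<kappa>' * n * t\<close> is the right scale. The relative
    error \<open>d / \<kappa>'\<close> allows exactly the rate
    \<open>\<kappa>' + d = \<kappa> + 2 * d\<close>.\<close>
  have "\<forall>t. \<exists>k. cyl_len (cf_word x0 k) \<le> exp (- (\<kappa>' * real n * real t)) \<and>
      exp (- (1 + d / \<kappa>') * (\<kappa>' * real n * real t) - C0) \<le> cyl_len (cf_word x0 k) \<and>
      real k \<le> 2 * (\<kappa>' * real n * real t) + 2"
    using \<kappa>' by (intro allI C0(2)) auto
  then obtain k where k: "\<And>t. cyl_len (cf_word x0 (k t)) \<le> exp (- (\<kappa>' * real n * real t))"
      "\<And>t. exp (- (1 + d / \<kappa>') * (\<kappa>' * real n * real t) - C0) \<le> cyl_len (cf_word x0 (k t))"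
      "\<And>t. real (k t) \<le> 2 * (\<kappa>' * real n * real t) + 2"
    by metis
  define w where "w t = (if t \<in> range fact then cf_word x0 (k t) else [])" for t
  have w_pos: "0 \<notin> set (w t)" for t using cf_word_pos[OF xi] by (simp add: w_def)
  interpret cantor_scheme w A n s
  proof
    fix t
    show "0 \<notin> set (w t)" by (rule w_pos)
    show "hd (w t) \<le> A" if ne: "w t \<noteq> []"
    proof -
      have "w t = cf_word x0 (k t)" using ne by (auto simp: w_def split: if_splits)
      moreover from this obtain k' where "k t = Suc k'" using ne by (cases "k t") auto
      ultimately show ?thesis using AA(3) by (simp add: cf_word_Suc cf_digit_def)
    qed
  qed (use nn AA s in auto)
  have Zb: "16 powr s * exp (s * b) \<le> Z"
  proof -
    have "ln (16 powr s * 8 / ln 2) \<le> real n * d" using nn(2) d by (simp add: pos_divide_le_eq)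
    then have "exp (ln (16 powr s * 8 / ln 2)) \<le> exp (real n * d)" by (rule exp_le_cancel_iff[THEN iffD2])
    then have "16 powr s * 8 / ln 2 \<le> exp (real n * d)" by (subst (asm) exp_ln) auto
    then have "16 powr s \<le> ln 2 / 8 * exp (real n * d)" by (simp add: field_simps)
    then have "16 powr s * exp (s * b) \<le> ln 2 / 8 * exp (real n * d) * exp (s * b)"
      by (intro mult_right_mono) auto
    also have "\<dots> = ln 2 / 8 * exp (real n * d + s * b)" by (simp add: exp_add)
    also have "real n * d + s * b = (1 - s) * real n * gauss_lyapunov"
    proof -
      have "real n * ((1 - s) * gauss_lyapunov) = real n * (s * (\<kappa> + 3 * d) + d)" by (simp only: dl)
      then show ?thesis by (simp add: b_def algebra_simps)
    qed
    finally show ?thesis using A0[OF AA(1)] unfolding Z_def by linarith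
  qed
  have np: "0 < real n" using nn by simp
  obtain C where C: "0 \<le> C" "\<And>m. (\<Sum>i\<in>range fact \<inter> {..m}. - ln (cyl_len (w i))) \<le> b * real m + C"
  proof (rule fact_sparse_cost[of "(\<kappa> + 2 * d) * real n" b C0 "\<lambda>i. - ln (cyl_len (w i))"])
    fix i :: nat assume i: "i \<in> range fact"
    have e: "(1 + d / \<kappa>') * \<kappa>' = \<kappa> + 2 * d"
      using \<kappa>' by (simp add: distrib_right) (simp add: \<kappa>'_def)
    have "- (1 + d / \<kappa>') * (\<kappa>' * real n * real i) = - ((\<kappa> + 2 * d) * real n * real i)"
      unfolding e[symmetric] by (simp only: mult_minus_left mult.assoc)
    then have "exp (- ((\<kappa> + 2 * d) * real n * real i) - C0) \<le> cyl_len (w i)"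
      using k(2)[of i] i by (simp only: w_def if_True)
    then have "ln (exp (- ((\<kappa> + 2 * d) * real n * real i) - C0)) \<le> ln (cyl_len (w i))"
      using cyl_len_pos[OF w_pos] by (subst ln_le_cancel_iff) auto
    then show "- ln (cyl_len (w i)) \<le> (\<kappa> + 2 * d) * real n * real i + C0" by simp
  qed (use \<kappa> d C0 np in \<open>auto simp: b_def\<close>)
  have cost: "(\<Sum>i\<le>t. - ln (cyl_len (w i))) \<le> b * real t + C" for t
  proof -
    have "(\<Sum>i\<le>t. - ln (cyl_len (w i))) = (\<Sum>i\<in>range fact \<inter> {..t}. - ln (cyl_len (w i)))"
      by (rule sum.mono_neutral_right) (auto simp: w_def)
    then show ?thesis using C(2)[of t] by simp
  qed
  define q where "q = 2 * \<kappa>' * real n + 2"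
  have q: "0 < q" using \<kappa>' by (simp add: q_def add_nonneg_pos)
  \<comment> \<open>The word inserted in slot \<open>i\<close> has length at most
    \<open>q * (i + 1)\<close>. With this coefficient, \<open>\<kappa>\<close> times the total delay
    before slot \<open>t\<close> is at most \<open>d / 2 * n * t\<close> plus a constant, half of
    the margin between \<open>\<kappa>'\<close> and \<open>\<kappa>\<close>.\<close>
  obtain C1 where C1: "0 \<le> C1" "\<And>m. m \<in> range fact \<Longrightarrow>
      (\<Sum>i\<in>range fact \<inter> {..<m}. real i + 1) \<le> d * real n / (2 * \<kappa> * q) * real m + C1"
    using fact_sparse[of "d * real n / (2 * \<kappa> * q)"] d np \<kappa> q by auto
  show ?thesis
  proof (rule hausdorff_measure_code_points[OF Zb cost])
    fix \<omega> assume \<omega>: "\<omega> \<in> space code_measure"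
    note sl = slot_props[OF \<omega>]
    let ?x = "code_point \<omega>"
    let ?L = "\<lambda>t. length (concat (map (slot \<omega>) [0..<t]))"
    have L: "real (?L t) = (\<Sum>i<t. real (length (w i))) + real n * real t" for t
    proof (induction t)
      case (Suc t)
      have "length (\<omega> t) = n" using \<omega> by (auto simp: space_code_measure words_def)
      then show ?case using Suc by (simp add: slot_def[of \<omega> t] algebra_simps)
    qed simp
    \<comment> \<open>\<open>?L t\<close> is the time at which slot \<open>t\<close> starts: from
      there the digits begin with \<open>w t\<close>, a prefix of \<open>x0\<close>, so the distance
      is at most \<open>cyl_len (w t)\<close>.\<close>
    have close: "exp (real (?L t) * \<kappa>) * \<bar>(gauss_map ^^ ?L t) ?x - x0\<bar> \<le> exp (\<kappa> * q * C1 - d / 2 * real t)"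
      if t: "t \<in> range fact" for t
    proof -
      have "(\<Sum>i<t. real (length (w i))) = (\<Sum>i\<in>range fact \<inter> {..<t}. real (length (w i)))"
        by (rule sum.mono_neutral_right) (auto simp: w_def)
      also have "\<dots> \<le> (\<Sum>i\<in>range fact \<inter> {..<t}. q * (real i + 1))"
      proof (rule sum_mono)
        fix i assume "i \<in> range fact \<inter> {..<t}"
        then have "real (length (w i)) \<le> 2 * (\<kappa>' * real n * real i) + 2" using k(3)[of i] by (simp add: w_def)
        also have "\<dots> \<le> q * (real i + 1)"
          using \<kappa>' by (simp add: q_def algebra_simps)
        finally show "real (length (w i)) \<le> q * (real i + 1)" .
      qed
      also have "\<dots> = q * (\<Sum>i\<in>range fact \<inter> {..<t}. real i + 1)" by (simp add: sum_distrib_left)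
      also have "\<dots> \<le> q * (d * real n / (2 * \<kappa> * q) * real t + C1)"
        using C1(2)[OF t] q by (intro mult_left_mono) auto
      finally have "\<kappa> * (\<Sum>i<t. real (length (w i))) \<le> \<kappa> * (q * (d * real n / (2 * \<kappa> * q) * real t + C1))"
        using \<kappa> by (intro mult_left_mono) auto
      also have "\<dots> = d / 2 * real n * real t + \<kappa> * q * C1" using \<kappa> q by (simp add: field_simps)
      finally have Lk: "real (?L t) * \<kappa> \<le> d / 2 * real n * real t + \<kappa> * q * C1 + \<kappa> * real n * real t"
        unfolding L by (simp add: algebra_simps)
      have g: "(gauss_map ^^ ?L t) ?x = cf_lim (\<lambda>i. slot \<omega> (t + i))"
        unfolding code_point_def by (rule gauss_map_iter_cf_lim[of "slot \<omega>", OF sl(1,2)])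
      have "cf_lim (\<lambda>i. slot \<omega> (t + i)) = cf_eval (slot \<omega> t) (cf_lim (\<lambda>i. slot \<omega> (t + (1 + i))))"
        using cf_lim_shift[of "\<lambda>i. slot \<omega> (t + i)" 1] sl by simp
      also have "\<dots> = cf_eval (w t) (cf_eval (\<omega> t) (cf_lim (\<lambda>i. slot \<omega> (t + (1 + i)))))"
        by (simp add: slot_def[of \<omega> t] cf_eval_append)
      finally have g2: "(gauss_map ^^ ?L t) ?x = cf_eval (w t) (cf_eval (\<omega> t) (cf_lim (\<lambda>i. slot \<omega> (t + (1 + i)))))"
        using g by simp
      have y: "cf_eval (\<omega> t) (cf_lim (\<lambda>i. slot \<omega> (t + (1 + i)))) \<in> {0..1}"
        using \<omega> words_pos by (intro cf_eval_bounds cf_lim_bounds sl) (auto simp: space_code_measure)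
      have x0e: "x0 = cf_eval (w t) ((gauss_map ^^ k t) x0)"
        using cf_eval_cf_word[OF xi, of "k t"] t by (simp add: w_def)
      have z: "(gauss_map ^^ k t) x0 \<in> {0..1}" using gauss_map_iter_irr01[OF xi, of "k t"] by (auto simp: irr01_def)
      have "\<bar>(gauss_map ^^ ?L t) ?x - x0\<bar> \<le> cyl_len (w t)"
        using cf_eval_close[OF w_pos[of t] y z] by (simp only: g2 flip: x0e)
      also have "\<dots> \<le> exp (- (\<kappa>' * real n * real t))" using k(1)[of t] t by (simp add: w_def)
      finally have "exp (real (?L t) * \<kappa>) * \<bar>(gauss_map ^^ ?L t) ?x - x0\<bar>
          \<le> exp (d / 2 * real n * real t + \<kappa> * q * C1 + \<kappa> * real n * real t) * exp (- (\<kappa>' * real n * real t))"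
        using Lk by (intro mult_mono) auto
      also have "\<dots> = exp (\<kappa> * q * C1 - d / 2 * (real n * real t))"
        by (simp add: \<kappa>'_def algebra_simps flip: exp_add)
      also have "\<dots> \<le> exp (\<kappa> * q * C1 - d / 2 * real t)"
        using nn d mult_right_mono[of 1 "real n" "real t"] by simp
      finally show ?thesis .
    qed
    have "liminf (\<lambda>n. ereal (exp (real n * \<kappa>) * \<bar>(gauss_map ^^ n) ?x - x0\<bar>)) = 0"
    proof (subst liminf_ereal_eq_0_iff, simp, intro allI impI)
      fix e :: real and m :: nat assume e: "0 < e"
      obtain N :: nat where N: "max (real m) ((\<kappa> * q * C1 - ln e) * 2 / d + 1) \<le> real N" using real_arch_simple by blast
      define t :: nat where "t = fact N"
      have Nt: "N \<le> t" by (simp add: t_def fact_ge_self)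
      have "(\<kappa> * q * C1 - ln e) * 2 / d < real t" using N Nt by simp
      then have "\<kappa> * q * C1 - d / 2 * real t < ln e" using d by (simp add: field_simps)
      then have "exp (\<kappa> * q * C1 - d / 2 * real t) < e" using e by (metis exp_less_cancel_iff exp_ln)
      moreover have "t \<in> range fact" by (simp add: t_def)
      ultimately have "exp (real (?L t) * \<kappa>) * \<bar>(gauss_map ^^ ?L t) ?x - x0\<bar> < e" using close[of t] by linarith
      moreover have "m \<le> ?L t" using length_concat_ge[of "slot \<omega>" t] sl(1) N Nt by simp
      ultimately show "\<exists>n\<ge>m. exp (real n * \<kappa>) * \<bar>(gauss_map ^^ n) ?x - x0\<bar> < e" by blast
    qed
    moreover have "?x \<in> {0..1}" unfolding code_point_def by (intro cf_lim_bounds sl)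
    ultimately show "?x \<in> {x \<in> {0..1}. liminf (\<lambda>n. ereal (exp (real n * \<kappa>) * \<bar>(gauss_map ^^ n) x - x0\<bar>)) = 0}"
      by simp
  qed
qed

lemma hausdorff_dim_exp_target:
  assumes x0: "slow_cf x0" and \<kappa>: "0 < \<kappa>"
  shows "ereal (gauss_lyapunov / (gauss_lyapunov + \<kappa>)) \<le> hausdorff_dim {x \<in> {0..1}.
    liminf (\<lambda>n. ereal (exp (real n * \<kappa>) * \<bar>(gauss_map ^^ n) x - x0\<bar>)) = 0}" (is "_ \<le> hausdorff_dim ?W")
proof (rule hausdorff_dim_geI)
  fix s :: real assume s: "0 \<le> s" "s < gauss_lyapunov / (gauss_lyapunov + \<kappa>)"
  show "hausdorff_measure s ?W \<noteq> 0"
  proof (cases "s = 0")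
    \<comment> \<open>At exponent \<open>0\<close> nonemptiness decides, and it follows from nonzero
      measure at some positive exponent.\<close>
    case True
    obtain r where "0 < r" "r < gauss_lyapunov / (gauss_lyapunov + \<kappa>)" using s(2) True dense by blast
    then have "hausdorff_measure r ?W \<noteq> 0" by (intro hausdorff_measure_exp_target x0 \<kappa>)
    then have "?W \<noteq> {}" using hausdorff_measure_empty by metis
    then show ?thesis unfolding True by (rule hausdorff_measure_0_nonempty)
  next
    case False
    then show ?thesis using s by (intro hausdorff_measure_exp_target x0 \<kappa>) auto
  qed
qed

lemma exp_target_subset_powr_target:
  assumes \<kappa>: "0 < \<kappa>"
  shows "{x \<in> {0..1}. liminf (\<lambda>n. ereal (exp (real n * \<kappa>) * \<bar>(gauss_map ^^ n) x - x0\<bar>)) = 0}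
    \<subseteq> {x \<in> {0..1}. liminf (\<lambda>n. ereal (real n powr p * \<bar>(gauss_map ^^ n) x - x0\<bar>)) = 0}"
proof
  fix x assume "x \<in> {x \<in> {0..1}. liminf (\<lambda>n. ereal (exp (real n * \<kappa>) * \<bar>(gauss_map ^^ n) x - x0\<bar>)) = 0}"
  then have x: "x \<in> {0..1}" and E: "\<And>e m. 0 < e \<Longrightarrow> \<exists>n\<ge>m. exp (real n * \<kappa>) * \<bar>(gauss_map ^^ n) x - x0\<bar> < e"
    using liminf_ereal_eq_0_iff[of "\<lambda>n. exp (real n * \<kappa>) * \<bar>(gauss_map ^^ n) x - x0\<bar>"] by auto
  have "eventually (\<lambda>n. real n powr p \<le> exp (real n * \<kappa>)) sequentially" using \<kappa> by real_asymp
  then obtain N where N: "\<And>n. n \<ge> N \<Longrightarrow> real n powr p \<le> exp (real n * \<kappa>)" by (auto simp: eventually_sequentially)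
  have "\<exists>n\<ge>m. real n powr p * \<bar>(gauss_map ^^ n) x - x0\<bar> < e" if e: "0 < e" for e m
  proof -
    obtain n where n: "n \<ge> max m N" "exp (real n * \<kappa>) * \<bar>(gauss_map ^^ n) x - x0\<bar> < e" using E[OF e] by blast
    have "real n powr p * \<bar>(gauss_map ^^ n) x - x0\<bar> \<le> exp (real n * \<kappa>) * \<bar>(gauss_map ^^ n) x - x0\<bar>"
      using n(1) by (intro mult_right_mono N) auto
    then show ?thesis using n by (intro exI[of _ n]) auto
  qed
  then show "x \<in> {x \<in> {0..1}. liminf (\<lambda>n. ereal (real n powr p * \<bar>(gauss_map ^^ n) x - x0\<bar>)) = 0}"
    using x liminf_ereal_eq_0_iff[of "\<lambda>n. real n powr p * \<bar>(gauss_map ^^ n) x - x0\<bar>"] by auto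
qed

text \<open>Every \<open>\<kappa> > 0\<close> yields the lower bound
  \<open>gauss_lyapunov / (gauss_lyapunov + \<kappa>)\<close>, which tends to \<open>1\<close> as
  \<open>\<kappa>\<close> decreases to \<open>0\<close>.\<close>

lemma hausdorff_dim_powr_target:
  assumes x0: "slow_cf x0"
  shows "hausdorff_dim {x \<in> {0..1}.
    liminf (\<lambda>n. ereal (real n powr p * \<bar>(gauss_map ^^ n) x - x0\<bar>)) = 0} = 1" (is "hausdorff_dim ?W = 1")
proof (rule antisym)
  show "hausdorff_dim ?W \<le> 1" by (rule hausdorff_dim_le_1) auto
  have "((\<lambda>\<kappa>. ereal (gauss_lyapunov / (gauss_lyapunov + \<kappa>))) \<longlongrightarrow> ereal (gauss_lyapunov / (gauss_lyapunov + 0))) (at_right 0)"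
    using gauss_lyapunov_pos by (intro tendsto_intros) auto
  moreover have "eventually (\<lambda>\<kappa>. ereal (gauss_lyapunov / (gauss_lyapunov + \<kappa>)) \<le> hausdorff_dim ?W) (at_right 0)"
    using eventually_at_right_less
  proof eventually_elim
    case (elim \<kappa>)
    show ?case
      by (rule order_trans[OF hausdorff_dim_exp_target[OF x0 elim]
            hausdorff_dim_mono[OF exp_target_subset_powr_target[OF elim]]])
  qed
  ultimately have "ereal (gauss_lyapunov / (gauss_lyapunov + 0)) \<le> hausdorff_dim ?W"
    by (rule tendsto_upperbound) simp
  then show "1 \<le> hausdorff_dim ?W" using gauss_lyapunov_pos by (simp add: one_ereal_def)
qed

theorem theorem1p5:
  shows
    "(\<forall>\<alpha>::real. \<alpha> > 1 \<longrightarrow>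
        (AE x0\<in>{0..1} in lebesgue. slow_cf x0 \<and>
           (AE x\<in>{0..1} in lebesgue.
              liminf (\<lambda>n. ereal (real n powr (1 / \<alpha>) * \<bar>(gauss_map ^^ n) x - x0\<bar>)) = 0)) \<and>
        (\<forall>x0. slow_cf x0 \<longrightarrow>
           (AE x\<in>{0..1} in lebesgue.
              liminf (\<lambda>n. ereal (real n powr (1 / \<alpha>) * \<bar>(gauss_map ^^ n) x - x0\<bar>)) = 0)))
     \<and>
     (\<forall>\<alpha>::real. 0 < \<alpha> \<and> \<alpha> < 1 \<longrightarrow>
        (\<forall>x0\<in>{0..1}.
           AE x\<in>{0..1} in lebesgue.
              liminf (\<lambda>n. ereal (real n powr (1 / \<alpha>) * \<bar>(gauss_map ^^ n) x - x0\<bar>)) = \<infinity>))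
     \<and>
     (\<forall>x0. slow_cf x0 \<longrightarrow>
        (\<forall>\<alpha>::real. \<alpha> > 0 \<longrightarrow>
           hausdorff_dim {x \<in> {0..1}.
              liminf (\<lambda>n. ereal (real n powr (1 / \<alpha>) * \<bar>(gauss_map ^^ n) x - x0\<bar>)) = 0} = 1) \<and>
        (\<forall>\<kappa>::real. \<kappa> > 0 \<longrightarrow>
           hausdorff_dim {x \<in> {0..1}.
              liminf (\<lambda>n. ereal (exp (real n * \<kappa>) * \<bar>(gauss_map ^^ n) x - x0\<bar>)) = 0}
             \<ge> ereal (pi\<^sup>2 / (pi\<^sup>2 + 6 * \<kappa> * ln 2))))"
proof (intro conjI allI impI)
  fix \<alpha> :: real assume \<alpha>: "\<alpha> > 1"
  show zero: "AE x\<in>{0..1} in lebesgue.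
      liminf (\<lambda>n. ereal (real n powr (1 / \<alpha>) * \<bar>(gauss_map ^^ n) x - x0\<bar>)) = 0" if "slow_cf x0" for x0
    by (rule AE_shrinking_target_zero[OF slow_cf_irr01[OF that] \<alpha>])
  show "AE x0\<in>{0..1} in lebesgue. slow_cf x0 \<and> (AE x\<in>{0..1} in lebesgue.
      liminf (\<lambda>n. ereal (real n powr (1 / \<alpha>) * \<bar>(gauss_map ^^ n) x - x0\<bar>)) = 0)"
    using AE_slow_cf by (rule eventually_mono) (use zero in blast)
next
  fix \<alpha> :: real assume "0 < \<alpha> \<and> \<alpha> < 1"
  then show "\<forall>x0\<in>{0..1}. AE x\<in>{0..1} in lebesgue.
      liminf (\<lambda>n. ereal (real n powr (1 / \<alpha>) * \<bar>(gauss_map ^^ n) x - x0\<bar>)) = \<infinity>"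
    using AE_shrinking_target_infinite by blast
next
  fix x0 \<alpha> :: real assume "slow_cf x0"
  then show "hausdorff_dim {x \<in> {0..1}.
      liminf (\<lambda>n. ereal (real n powr (1 / \<alpha>) * \<bar>(gauss_map ^^ n) x - x0\<bar>)) = 0} = 1"
    by (rule hausdorff_dim_powr_target)
next
  fix x0 \<kappa> :: real assume x0: "slow_cf x0" and \<kappa>: "\<kappa> > 0"
  have "gauss_lyapunov / (gauss_lyapunov + \<kappa>) = pi\<^sup>2 / (pi\<^sup>2 + 6 * \<kappa> * ln 2)"
  proof -
    have "gauss_lyapunov + \<kappa> = (pi\<^sup>2 + 6 * \<kappa> * ln 2) / (6 * ln 2)" by (simp add: gauss_lyapunov_def field_simps)
    then show ?thesis by (simp add: gauss_lyapunov_def)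
  qed
  then show "hausdorff_dim {x \<in> {0..1}.
      liminf (\<lambda>n. ereal (exp (real n * \<kappa>) * \<bar>(gauss_map ^^ n) x - x0\<bar>)) = 0}
      \<ge> ereal (pi\<^sup>2 / (pi\<^sup>2 + 6 * \<kappa> * ln 2))"
    using hausdorff_dim_exp_target[OF x0 \<kappa>] by simp
qed

end
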